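(* Let $\kappa\in(0,8)$, $\beta=4/\kappa\in(1/2,\infty)$ and $h=\frac{6-\kappa}{2\kappa}$. For $\alpha=\{\{a_1,b_1\},\{a_2,b_2\},\{a_3,b_3\}\}\in \mathrm{LP}_3$, a function $F$ on $(0,1)^3$ and a constant $c_\alpha\in(0,\infty)$, put $H(r_1,r_2,r_3)=(r_1r_2r_3)^{2/\kappa}F(r_1,r_2,r_3)$ and define, for $x=(x_1,\dots,x_6)\in\mathfrak X_6$, $$\mathcal Z_\alpha(x)=c_\alpha\prod_{j=1}^3|x_{a_j}-x_{b_j}|^{-2h}\, H\Big(C_{\{x_{a_1},x_{b_1}\},\{x_{a_2},x_{b_2}\}},\,C_{\{x_{a_2},x_{b_2}\},\{x_{a_3},x_{b_3}\}},\,C_{\{x_{a_3},x_{b_3}\},\{x_{a_1},x_{b_1}\}}\Big).\qquad( * )$$ (i) Let $\alpha\in\mathrm{LP}_3$ be a rainbow pattern. Let $F,G\in C^\infty((0,1)^3)$ be such that for any $j,k,\ell$ with $\{j,k,\ell\}=\{1,2,3\}$, $$\big(r_\ell(1-r_\ell)\partial_{r_\ell}^2+(2\beta-2r_\ell)\partial_{r_\ell}-\beta(1-\beta)\big)F=(1-r_j)(1-r_k)G,\qquad(1)$$ $$\big(2r_jr_k\partial_{r_j}\partial_{r_k}+\beta r_j\partial_{r_j}+\beta r_k\partial_{r_k}-\beta r_\ell\partial_{r_\ell}\big)F=\big(r_\ell(1+r_jr_k)-(r_j+r_k)\big)G.\qquad(2)$$ Then for any $c_\alpha\in(0,\infty)$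 the function $\mathcal Z_\alpha$ defined by $( * )$ satisfies (PDE) and (COV) (with $N=3$). (ii) Let $\alpha\in\mathrm{LP}_3$ be a neighbor pattern. Let $F,G\in C^\infty((0,1)^3)$ be such that for any $j,k,\ell$ with $\{j,k,\ell\}=\{1,2,3\}$, (1) holds and $$\big(2r_jr_k\partial_{r_j}\partial_{r_k}+\beta r_j\partial_{r_j}+\beta r_k\partial_{r_k}+\beta r_\ell\partial_{r_\ell}+\beta^2\big)F=\big(r_\ell(r_j+r_k)-(1+r_jr_k)\big)G.\qquad(3)$$ Then for any $c_\alpha\in(0,\infty)$ the function $\mathcal Z_\alpha$ defined by $( * )$ satisfies (PDE) and (COV) (with $N=3$). (iii) Suppose the $F$ in (i) (resp. (ii)) extends continuously to $[0,1]^3$ and satisfies, for some $c_F\in(0,\infty)$, $$F(r,1,1)=F(1,r,1)=F(1,1,r)=c_F\cdot{}_2F_1(1-\beta,\beta;2\beta;r),\quad r\in(0,1).$$ Then the $\mathcal Z_\alpha$ in (i) (resp. (ii)) with $c_\alpha:=c_F^{-1}\,{}_2F_1(1-\beta,\beta;2\beta;1)^{-1}$ satisfies (ASY) for $N=3$. (iv) Suppose the $F$ in (i) (resp. (ii)) extends continuously to $[0,1]^3$ and is positive on the boundary $\partial[0,1]^3$. Then the $\mathcal Z_\alpha$ defined in (i) (resp. (ii)) is positive on $\mathfrak X_6$, for all $\kappa\in(0,8)$ (i.e. all $\beta>1/2$).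
   Context: Notation. $[n]=\{1,\dots,n\}$. $\mathfrak X_{2N}=\{(x_1,\dots,x_{2N})\in\mathbb R^{2N}:x_j<x_k\text{ if }j<k\}$. $\mathbb H$ is the open upper half-plane. ${}_2F_1$ is the Gauss hypergeometric function; for $\beta>1/2$ the series of ${}_2F_1(1-\beta,\beta;2\beta;\cdot)$ converges absolutely at $1$. (PDE): a smooth function $\mathcal Z$ on $\mathfrak X_{2N}$ satisfies (PDE) if for every $i\in[2N]$, $$\Big[\tfrac\kappa2\partial_i^2+\sum_{j\in[2N]\setminus\{i\}}\Big(\frac{2}{x_j-x_i}\partial_j-\frac{2h}{(x_j-x_i)^2}\Big)\Big]\mathcal Z=0 .$$ (COV): for all Möbius maps $\varphi$ of $\mathbb H$ with $\varphi(x_1)<\cdots<\varphi(x_{2N})$, $\mathcal Z(x_1,\dots,x_{2N})=\prod_{i=1}^{2N}\varphi'(x_i)^h\cdot\mathcal Z(\varphi(x_1),\dots,\varphi(x_{2N}))$. Link patterns: $\mathrm{LP}_N$ is the set of partitions $\{\{a_1,b_1\},\dots,\{a_N,b_N\}\}$ of $[2N]$ into pairs with $(a_j-a_k)(a_j-b_k)(b_j-a_k)(b_j-b_k)>0$ for all $j\neq k$. In $\mathrm{LP}_3$ the rainbow patterns are $\{\{1,6\},\{2,5\},\{3,4\}\}$, $\{\{1,4\},\{2,3\},\{5,6\}\}$, $\{\{1,2\},\{3,6\},\{4,5\}\}$, and the neighbor patterns are $\{\{1,2\},\{3,4\},\{5,6\}\}$, $\{\{1,6\},\{2,3\},\{4,5\}\}$.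 Unoriented cross-ratio: $C_{\{p_1,q_1\},\{p_2,q_2\}}:=\min\Big\{\frac{|p_1-p_2||q_1-q_2|}{|p_1-q_2||q_1-p_2|},\frac{|p_1-q_2||q_1-p_2|}{|p_1-p_2||q_1-q_2|}\Big\}$. Pure partition functions for $N=2$: for $\alpha'=\{\{a_1,b_1\},\{a_2,b_2\}\}\in\mathrm{LP}_2$ and $x\in\mathfrak X_4$, with $C=C_{\{x_{a_1},x_{b_1}\},\{x_{a_2},x_{b_2}\}}$, $$\mathcal Z_{\alpha'}(x)=\prod_{j=1}^2|x_{a_j}-x_{b_j}|^{-2h}\cdot\frac{C^{2/\kappa}\,{}_2F_1(1-\frac4\kappa,\frac4\kappa;\frac8\kappa;C)}{{}_2F_1(1-\frac4\kappa,\frac4\kappa;\frac8\kappa;1)} .$$ (ASY) for $N=3$ and $\alpha\in\mathrm{LP}_3$: for all $j\in[5]$ and $\xi\in\mathbb R$, with $x_1<\cdots<x_{j-1}<\xi<x_{j+2}<\cdots<x_6$ fixed and $x=(x_1,\dots,x_6)\in\mathfrak X_6$, $$\lim_{x_j,x_{j+1}\to\xi}\frac{\mathcal Z_\alpha(x)}{(x_{j+1}-x_j)^{-2h}}=\begin{cases}0,&\{j,j+1\}\notin\alpha,\\ \mathcal Z_{\alpha/\{j,j+1\}}(x/\{j,j+1\}),&\{j,j+1\}\in\alpha,\end{cases}$$ where $\alpha/\{j,j+1\}\in\mathrm{LP}_2$ is obtained from $\alpha$ by removing $\{j,j+1\}$ and relabeling the remaining indices by $[4]$ in increasing order, and $x/\{j,j+1\}\in\mathfrak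 X_4$ is obtained from $x$ by removing $x_j,x_{j+1}$. *)

theory Defs
  imports "HOL-Analysis.Analysis"
begin

text \<open>
  Points of \<open>\<real>\<^sup>6\<close> and \<open>\<real>\<^sup>4\<close> have the types \<^typ>\<open>real^6\<close> and \<^typ>\<open>real^4\<close>.  The labels \<open>1, \<dots>, 2N\<close>
  are natural numbers; the coordinate with label \<open>j\<close> is \<open>x $ of_nat j\<close>.  Since \<open>of_nat\<close> is a bijection from
  \<open>{1..6}\<close> onto the type \<open>6\<close> (with \<open>of_nat 6 = 0\<close>), each coordinate has exactly one label.
  The order of the coordinates is always that of their labels, not the order of the index type.
\<close>

definition coord :: "real ^ 'n::{finite,semiring_1} \<Rightarrow> nat \<Rightarrow> real"
  where "coord x j = x $ of_nat j"

definition chamber :: "(real ^ 'n::{finite,semiring_1}) set"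
  where "chamber = {x. \<forall>j\<in>{1..CARD('n)}. \<forall>k\<in>{1..CARD('n)}. j < k \<longrightarrow> coord x j < coord x k}"

definition partial_deriv :: "'n \<Rightarrow> (real ^ 'n::finite \<Rightarrow> real) \<Rightarrow> real ^ 'n \<Rightarrow> real"
  where "partial_deriv i f x = deriv (\<lambda>t. f (x + t *\<^sub>R axis i 1)) 0"

text \<open>The next two notions are only used for open sets \<open>S\<close>.\<close>

primrec Ck_on :: "nat \<Rightarrow> (real ^ 'n::finite) set \<Rightarrow> (real ^ 'n \<Rightarrow> real) \<Rightarrow> bool"
  where
    "Ck_on 0 S f \<longleftrightarrow> continuous_on S f"
  | "Ck_on (Suc k) S f \<longleftrightarrow>
       (\<forall>x\<in>S. f differentiable (at x)) \<and> (\<forall>i. Ck_on k S (partial_deriv i f))"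

definition smooth_on :: "(real ^ 'n::finite) set \<Rightarrow> (real ^ 'n \<Rightarrow> real) \<Rightarrow> bool"
  where "smooth_on S f \<longleftrightarrow> (\<forall>k. Ck_on k S f)"

definition hyp2F1 :: "real \<Rightarrow> real \<Rightarrow> real \<Rightarrow> real \<Rightarrow> real"
  where "hyp2F1 a b c z = eval_fps (fps_hypergeo [a, b] [c] 1) z"

definition satisfies_PDE :: "real \<Rightarrow> real \<Rightarrow> (real ^ 'n::{finite,semiring_1} \<Rightarrow> real) \<Rightarrow> bool"
  where "satisfies_PDE \<kappa> h Z \<longleftrightarrow>
    (\<forall>x\<in>chamber. \<forall>i.
      \<kappa> / 2 * partial_deriv i (partial_deriv i Z) x
      + (\<Sum>j\<in>UNIV - {i}. 2 / (x $ j - x $ i) * partial_deriv j Z x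
                          - 2 * h / (x $ j - x $ i)\<^sup>2 * Z x) = 0)"

text \<open>
  The Moebius maps of the upper half-plane are the maps \<open>t \<mapsto> (p t + q) / (r t + s)\<close> with real
  coefficients and \<open>p s - q r > 0\<close>.  As division by zero is total, the pole has to be excluded explicitly.
\<close>

definition moebius :: "real \<Rightarrow> real \<Rightarrow> real \<Rightarrow> real \<Rightarrow> real \<Rightarrow> real"
  where "moebius p q r s t = (p * t + q) / (r * t + s)"

definition satisfies_COV :: "real \<Rightarrow> (real ^ 'n::{finite,semiring_1} \<Rightarrow> real) \<Rightarrow> bool"
  where "satisfies_COV h Z \<longleftrightarrow>
    (\<forall>x\<in>chamber. \<forall>p q r s. p * s - q * r > 0 \<longrightarrow> (\<forall>i. r * x $ i + s \<noteq> 0) \<longrightarrow>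
      (let \<phi> = moebius p q r s; \<phi>x = (\<chi> i. \<phi> (x $ i)) in
        \<phi>x \<in> chamber \<longrightarrow> Z x = (\<Prod>i\<in>UNIV. deriv \<phi> (x $ i) powr h) * Z \<phi>x))"

definition LP :: "nat \<Rightarrow> nat set set set"
  where "LP N = {\<alpha>. partition_on {1..2 * N} \<alpha> \<and> (\<forall>e\<in>\<alpha>. card e = 2) \<and>
    (\<forall>a b c d. {a, b} \<in> \<alpha> \<longrightarrow> {c, d} \<in> \<alpha> \<longrightarrow> {a, b} \<noteq> {c, d} \<longrightarrow>
      (int a - int c) * (int a - int d) * (int b - int c) * (int b - int d) > 0)}"

definition rainbow_patterns :: "nat set set set"
  where "rainbow_patterns =
    {{{1, 6}, {2, 5}, {3, 4}}, {{1, 4}, {2, 3}, {5, 6}}, {{1, 2}, {3, 6}, {4, 5}}}"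

definition neighbor_patterns :: "nat set set set"
  where "neighbor_patterns = {{{1, 2}, {3, 4}, {5, 6}}, {{1, 6}, {2, 3}, {4, 5}}}"

text \<open>
  A way of writing a link pattern as \<open>{{a\<^sub>1, b\<^sub>1}, \<dots>, {a\<^sub>N, b\<^sub>N}}\<close>.  For \<open>\<alpha> \<in> LP N\<close> the links are
  then enumerated without repetition, since \<open>\<alpha>\<close> has \<open>N\<close> elements.
\<close>

definition labelling :: "nat \<Rightarrow> nat set set \<Rightarrow> (nat \<Rightarrow> nat) \<Rightarrow> (nat \<Rightarrow> nat) \<Rightarrow> bool"
  where "labelling N \<alpha> a b \<longleftrightarrow> \<alpha> = (\<lambda>j. {a j, b j}) ` {1..N}"

text \<open>Symmetric under exchanging \<open>p\<^sub>i\<close> with \<open>q\<^sub>i\<close>, as this swaps the two arguments of \<open>min\<close>.\<close>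

definition cross_ratio :: "real \<Rightarrow> real \<Rightarrow> real \<Rightarrow> real \<Rightarrow> real"
  where "cross_ratio p1 q1 p2 q2 =
    min (\<bar>p1 - p2\<bar> * \<bar>q1 - q2\<bar> / (\<bar>p1 - q2\<bar> * \<bar>q1 - p2\<bar>))
        (\<bar>p1 - q2\<bar> * \<bar>q1 - p2\<bar> / (\<bar>p1 - p2\<bar> * \<bar>q1 - q2\<bar>))"

definition link_cross_ratio ::
    "(nat \<Rightarrow> nat) \<Rightarrow> (nat \<Rightarrow> nat) \<Rightarrow> real ^ 'n::{finite,semiring_1} \<Rightarrow> nat \<Rightarrow> nat \<Rightarrow> real"
  where "link_cross_ratio a b x j k =
    cross_ratio (coord x (a j)) (coord x (b j)) (coord x (a k)) (coord x (b k))"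

text \<open>The pure partition function for two links; its value does not depend on the labelling.\<close>

definition pure_pf2 :: "real \<Rightarrow> real \<Rightarrow> (nat \<Rightarrow> nat) \<Rightarrow> (nat \<Rightarrow> nat) \<Rightarrow> real ^ 4 \<Rightarrow> real"
  where "pure_pf2 \<kappa> h a b x =
    (\<Prod>j\<in>{1..2}. \<bar>coord x (a j) - coord x (b j)\<bar> powr (- 2 * h)) *
    (let C = link_cross_ratio a b x 1 2 in
      C powr (2 / \<kappa>) * hyp2F1 (1 - 4 / \<kappa>) (4 / \<kappa>) (8 / \<kappa>) C
        / hyp2F1 (1 - 4 / \<kappa>) (4 / \<kappa>) (8 / \<kappa>) 1)"

text \<open>The three cross-ratios depend on the order of the links, and \<open>F\<close> need not be symmetric.\<close>

definition pf3 :: "real \<Rightarrow> real \<Rightarrow> real \<Rightarrow> (real ^ 3 \<Rightarrow> real) \<Rightarrow>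
    (nat \<Rightarrow> nat) \<Rightarrow> (nat \<Rightarrow> nat) \<Rightarrow> real ^ 6 \<Rightarrow> real"
  where "pf3 \<kappa> h c F a b x =
    (let H = (\<lambda>r. (r $ 1 * r $ 2 * r $ 3) powr (2 / \<kappa>) * F r) in
      c * (\<Prod>j\<in>{1..3}. \<bar>coord x (a j) - coord x (b j)\<bar> powr (- 2 * h)) *
      H (vector [link_cross_ratio a b x 1 2, link_cross_ratio a b x 2 3, link_cross_ratio a b x 3 1]))"

definition relabel_link :: "nat \<Rightarrow> nat set set \<Rightarrow> nat set set"
  where "relabel_link j \<alpha> = (\<lambda>e. (\<lambda>k. if k < j then k else k - 2) ` e) ` (\<alpha> - {{j, j + 1}})"

definition remove_points :: "nat \<Rightarrow> real ^ 6 \<Rightarrow> real ^ 4"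
  where "remove_points j x =
    (let y = (\<lambda>m. coord x (if m < j then m else m + 2)) in vector [y 1, y 2, y 3, y 4])"

text \<open>
  The point \<open>z\<close> carries the fixed coordinates and has \<open>\<xi>\<close> at the labels \<open>j\<close> and \<open>j + 1\<close>.  The limit is
  taken along \<open>x \<rightarrow> z\<close> inside the chamber, with only these two coordinates varying.
\<close>

definition satisfies_ASY :: "real \<Rightarrow> real \<Rightarrow> nat set set \<Rightarrow> (real ^ 6 \<Rightarrow> real) \<Rightarrow> bool"
  where "satisfies_ASY \<kappa> h \<alpha> Z \<longleftrightarrow>
    (\<forall>j\<in>{1..5}. \<forall>\<xi> z.
      coord z j = \<xi> \<and> coord z (j + 1) = \<xi> \<and>
      (\<forall>k\<in>{1..6}. \<forall>l\<in>{1..6}. k < l \<and> (k, l) \<noteq> (j, j + 1) \<longrightarrow> coord z k < coord z l) \<longrightarrow>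
      (let Q = (\<lambda>x. Z x / (coord x (j + 1) - coord x j) powr (- 2 * h));
           A = at z within {x \<in> chamber. \<forall>k\<in>{1..6} - {j, j + 1}. coord x k = coord z k}
       in ({j, j + 1} \<notin> \<alpha> \<longrightarrow> (Q \<longlongrightarrow> 0) A) \<and>
          ({j, j + 1} \<in> \<alpha> \<longrightarrow>
            (\<forall>a' b'. labelling 2 (relabel_link j \<alpha>) a' b' \<longrightarrow>
              (Q \<longlongrightarrow> pure_pf2 \<kappa> h a' b' (remove_points j z)) A))))"

text \<open>The open cube \<open>(0,1)\<^sup>3\<close> is \<open>box 0 1\<close>, the closed one \<open>cbox 0 1\<close>, as \<open>1 :: real^3\<close> is \<open>(1,1,1)\<close>.\<close>

definition hypergeo_eqs :: "real \<Rightarrow> (real ^ 3 \<Rightarrow> real) \<Rightarrow> (real ^ 3 \<Rightarrow> real) \<Rightarrow> bool"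
  where "hypergeo_eqs \<beta> F G \<longleftrightarrow>
    (\<forall>j k l :: 3. {j, k, l} = UNIV \<longrightarrow> (\<forall>r\<in>box 0 1.
      r $ l * (1 - r $ l) * partial_deriv l (partial_deriv l F) r
      + (2 * \<beta> - 2 * r $ l) * partial_deriv l F r
      - \<beta> * (1 - \<beta>) * F r
      = (1 - r $ j) * (1 - r $ k) * G r))"

definition rainbow_eqs :: "real \<Rightarrow> (real ^ 3 \<Rightarrow> real) \<Rightarrow> (real ^ 3 \<Rightarrow> real) \<Rightarrow> bool"
  where "rainbow_eqs \<beta> F G \<longleftrightarrow>
    (\<forall>j k l :: 3. {j, k, l} = UNIV \<longrightarrow> (\<forall>r\<in>box 0 1.
      2 * r $ j * r $ k * partial_deriv j (partial_deriv k F) r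
      + \<beta> * r $ j * partial_deriv j F r
      + \<beta> * r $ k * partial_deriv k F r
      - \<beta> * r $ l * partial_deriv l F r
      = (r $ l * (1 + r $ j * r $ k) - (r $ j + r $ k)) * G r))"

definition neighbor_eqs :: "real \<Rightarrow> (real ^ 3 \<Rightarrow> real) \<Rightarrow> (real ^ 3 \<Rightarrow> real) \<Rightarrow> bool"
  where "neighbor_eqs \<beta> F G \<longleftrightarrow>
    (\<forall>j k l :: 3. {j, k, l} = UNIV \<longrightarrow> (\<forall>r\<in>box 0 1.
      2 * r $ j * r $ k * partial_deriv j (partial_deriv k F) r
      + \<beta> * r $ j * partial_deriv j F r
      + \<beta> * r $ k * partial_deriv k F r
      + \<beta> * r $ l * partial_deriv l F r
      + \<beta>\<^sup>2 * F r
      = (r $ l * (r $ j + r $ k) - (1 + r $ j * r $ k)) * G r))"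

definition rainbow_setting ::
    "real \<Rightarrow> nat set set \<Rightarrow> (real ^ 3 \<Rightarrow> real) \<Rightarrow> (real ^ 3 \<Rightarrow> real) \<Rightarrow> bool"
  where "rainbow_setting \<beta> \<alpha> F G \<longleftrightarrow> \<alpha> \<in> rainbow_patterns \<and>
    smooth_on (box 0 1) F \<and> smooth_on (box 0 1) G \<and> hypergeo_eqs \<beta> F G \<and> rainbow_eqs \<beta> F G"

definition neighbor_setting ::
    "real \<Rightarrow> nat set set \<Rightarrow> (real ^ 3 \<Rightarrow> real) \<Rightarrow> (real ^ 3 \<Rightarrow> real) \<Rightarrow> bool"
  where "neighbor_setting \<beta> \<alpha> F G \<longleftrightarrow> \<alpha> \<in> neighbor_patterns \<and>
    smooth_on (box 0 1) F \<and> smooth_on (box 0 1) G \<and> hypergeo_eqs \<beta> F G \<and> neighbor_eqs \<beta> F G"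

definition extends_continuously_by :: "(real ^ 3 \<Rightarrow> real) \<Rightarrow> (real ^ 3 \<Rightarrow> real) \<Rightarrow> bool"
  where "extends_continuously_by F E \<longleftrightarrow> continuous_on (cbox 0 1) E \<and> (\<forall>r\<in>box 0 1. E r = F r)"

end

theory Submission
  imports Defs
begin

text \<open>
  Send \<open>x\<^sub>i\<close> to infinity by \<open>u\<^sub>j = 1 / (x\<^sub>j - x\<^sub>i)\<close>.  The operator \<open>\<Sum>\<^sub>j 2 u\<^sub>j \<partial>\<^sub>j\<close> maps \<open>log \<bar>x\<^sub>j - x\<^sub>k\<bar>\<close> to
  \<open>- 2 u\<^sub>j u\<^sub>k\<close>, so the \<open>i\<close>-th equation of (PDE) becomes polynomial in the \<open>u\<^sub>j\<close> and in the partial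
  derivatives of \<open>F\<close>.  It is a combination of (1) for the two cross-ratios that involve the link of
  \<open>x\<^sub>i\<close> and of (2) or (3); the function \<open>G\<close> drops out because the three cross-ratios, as functions of
  the \<open>u\<^sub>j\<close>, satisfy one quadratic relation.

  For positivity, the same elimination of \<open>G\<close> is done inside the cube, in a direction \<open>v\<close> with
  nonnegative entries that is isotropic for a quadratic form depending on the point; such a \<open>v\<close> exists
  by the intermediate value theorem.  It yields a degenerate elliptic equation \<open>L\<^sub>v F = 0\<close>.  If \<open>F\<close> had a
  nonpositive value, comparison with a supersolution and a subsolution that are monomials in the
  cross-ratios would contradict the second-order condition at a minimum.
\<close>

section \<open>Smooth functions of several variables\<close>

text \<open>Orienting the links turns every cross-ratio into either the first quotient in
  \<open>cross_ratio\<close> (\<sigma> = 1) or its inverse (\<sigma> = - 1). This removes the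
  \<open>min\<close>, and rainbow and neighbor patterns are handled by one computation with a sign.

  For positivity the plain maximum principle does not apply. Nothing is known about the sign of
  \<open>G\<close>, and the zero-order coefficient -\<beta>(1 - \<beta>) of (1) becomes positive for
  \<beta> > 1; (3) adds the positive term \<open>\<beta>\<^sup>2\<close> to it. The isotropic
  direction deals with \<open>G\<close>, and dividing \<open>F\<close> by a strictly positive strict
  supersolution replaces the sign condition on the zero-order term. The entries of \<open>v\<close>
  are nonnegative so that the mixed equations enter with nonnegative weights and their contributions
  have a known sign. The subsolution settles the case that \<open>F\<close> vanishes without being
  negative: subtracting a small multiple of it makes the minimum of the quotient strictly negative,
  which the comparison requires.\<close>

lemma partial_deriv_eq:
  assumes "(f has_derivative f') (at x)"
  shows "partial_deriv i f x = f' (axis i 1)"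
proof -
  have "((\<lambda>t. x + t *\<^sub>R axis i 1) has_derivative (\<lambda>t. t *\<^sub>R axis i 1)) (at (0::real))"
    by (auto intro!: derivative_eq_intros)
  then have "((\<lambda>t. f (x + t *\<^sub>R axis i 1)) has_derivative (\<lambda>t. f' (t *\<^sub>R axis i 1))) (at 0)"
    using has_derivative_compose[of "\<lambda>t. x + t *\<^sub>R axis i 1" _ 0 UNIV f f'] assms by simp
  moreover have "(\<lambda>t. f' (t *\<^sub>R axis i 1)) = (*) (f' (axis i 1))"
    using assms has_derivative_linear linear_scale by (fastforce simp: mult.commute)
  ultimately show ?thesis
    unfolding partial_deriv_def by (simp add: DERIV_imp_deriv has_field_derivative_def)
qed

lemma has_derivative_vec_nth: "((\<lambda>x. x $ p) has_derivative (\<lambda>v. v $ p)) F"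
  by (intro bounded_linear_imp_has_derivative bounded_linear_vec_nth)

lemma differentiable_imp_has_derivative:
  fixes f :: "real ^ 'n::finite \<Rightarrow> real"
  assumes "f differentiable (at x)"
  shows "(f has_derivative (\<lambda>v. \<Sum>i\<in>UNIV. v $ i * partial_deriv i f x)) (at x)"
proof -
  obtain f' where f': "(f has_derivative f') (at x)"
    using assms by (auto simp: differentiable_def)
  then have lin: "linear f'"
    by (rule has_derivative_linear)
  have "f' v = (\<Sum>i\<in>UNIV. v $ i * partial_deriv i f x)" for v
  proof -
    have "f' v = f' (\<Sum>i\<in>UNIV. v $ i *\<^sub>R axis i 1)"
      by (simp add: basis_expansion flip: scalar_mult_eq_scaleR)
    also have "\<dots> = (\<Sum>i\<in>UNIV. v $ i * f' (axis i 1))"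
      by (simp add: linear_sum[OF lin] linear_scale[OF lin])
    finally show ?thesis
      by (simp add: partial_deriv_eq[OF f'])
  qed
  then have "f' = (\<lambda>v. \<Sum>i\<in>UNIV. v $ i * partial_deriv i f x)"
    by (rule ext)
  with f' show ?thesis
    by (simp only:)
qed

section \<open>Closure properties of the classes C^k on open sets\<close>

lemma partial_deriv_cong:
  fixes f g :: "real ^ 'n::finite \<Rightarrow> real"
  assumes "open S" "x \<in> S" "\<And>y. y \<in> S \<Longrightarrow> f y = g y"
  shows "partial_deriv i f x = partial_deriv i g x"
  unfolding partial_deriv_def
proof (rule deriv_cong_ev)
  have "((\<lambda>t. x + t *\<^sub>R axis i 1) \<longlongrightarrow> x + 0 *\<^sub>R axis i 1) (nhds (0::real))"
    by (intro tendsto_intros tendsto_ident_at filterlim_ident)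
  then have "\<forall>\<^sub>F t in nhds (0::real). x + t *\<^sub>R axis i 1 \<in> S"
    using assms(1,2) by (simp add: tendsto_def)
  then show "\<forall>\<^sub>F t in nhds 0. f (x + t *\<^sub>R axis i 1) = g (x + t *\<^sub>R axis i 1)"
    by eventually_elim (use assms(3) in auto)
qed auto

lemma differentiable_cong_open:
  assumes "open S" "x \<in> S" "\<And>y. y \<in> S \<Longrightarrow> f y = g y" "f differentiable (at x)"
  shows "g differentiable (at x)"
  using assms has_derivative_transform_within_open unfolding differentiable_def by blast

text \<open>\<open>partial_deriv i f\<close> is a function on the whole space, but at a point of the
  open set \<open>S\<close> it only depends on values in \<open>S\<close>. Hence agreement on
  \<open>S\<close> passes from \<open>f\<close> to its partial derivatives, and the induction runs
  with \<open>f\<close> and \<open>g\<close> arbitrary.\<close>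

lemma Ck_on_cong:
  assumes "open S" "\<And>y. y \<in> S \<Longrightarrow> f y = g y" "Ck_on k S f"
  shows "Ck_on k S g"
  using assms(2,3)
proof (induction k arbitrary: f g)
  case 0
  then show ?case
    using continuous_on_cong[of S S f g] by simp
next
  case (Suc k)
  have "g differentiable (at x)" if "x \<in> S" for x
    using differentiable_cong_open[OF assms(1) that, of f g] Suc.prems that by simp
  moreover have "Ck_on k S (partial_deriv i g)" for i
    using Suc.IH[of "partial_deriv i f" "partial_deriv i g"] Suc.prems
      partial_deriv_cong[OF assms(1), of _ f g i] by simp
  ultimately show ?case
    by simp
qed

lemma Ck_on_Suc_imp: "Ck_on (Suc k) S f \<Longrightarrow> Ck_on k S f"
proof (induction k arbitrary: f)
  case 0
  then show ?case
    by (auto intro!: continuous_at_imp_continuous_on differentiable_imp_continuous_within)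
next
  case (Suc k)
  then show ?case
    using Ck_on.simps(2) by blast
qed

text \<open>Reduces one more order of differentiability to an explicit total derivative, whose
  values on the axes are the partial derivatives on \<open>S\<close>. The closure lemmas below all
  follow this scheme.\<close>

lemma Ck_on_SucI:
  fixes f :: "real ^ 'n::finite \<Rightarrow> real"
  assumes "open S" "\<And>x. x \<in> S \<Longrightarrow> (f has_derivative f' x) (at x)"
    and "\<And>i. Ck_on k S (\<lambda>x. f' x (axis i 1))"
  shows "Ck_on (Suc k) S f"
proof -
  have "Ck_on k S (partial_deriv i f)" for i
    using assms(3)[of i] partial_deriv_eq[OF assms(2)]
    by (intro Ck_on_cong[OF assms(1) _ assms(3)[of i]]) simp
  then show ?thesis
    using assms(2) by (auto simp: differentiable_def)
qed

lemma Ck_on_SucD: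
  fixes f :: "real ^ 'n::finite \<Rightarrow> real"
  assumes "Ck_on (Suc k) S f" "x \<in> S"
  shows "(f has_derivative (\<lambda>v. \<Sum>i\<in>UNIV. v $ i * partial_deriv i f x)) (at x)"
  using assms differentiable_imp_has_derivative by auto

lemma sum_axis_nth [simp]:
  fixes g :: "'n::finite \<Rightarrow> real"
  shows "(\<Sum>j\<in>UNIV. axis i 1 $ j * g j) = g i"
  by (simp add: axis_def if_distrib[of "\<lambda>c. c * _"] cong: if_cong)

lemma Ck_on_const: "Ck_on k (S :: (real ^ 'n::finite) set) (\<lambda>x. c)"
proof (induction k arbitrary: c)
  case (Suc k)
  have "partial_deriv i (\<lambda>x. c) = (\<lambda>x. 0)" for i :: 'n
    by (simp add: partial_deriv_def fun_eq_iff)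
  with Suc[of 0] show ?case
    by simp
qed simp

lemma Ck_on_add:
  assumes "open S" "Ck_on k S f" "Ck_on k S g"
  shows "Ck_on k S (\<lambda>x. f x + g x)"
  using assms(2,3)
proof (induction k arbitrary: f g)
  case 0
  then show ?case
    by (auto intro: continuous_on_add)
next
  case (Suc k)
  show ?case
  proof (rule Ck_on_SucI[OF assms(1)])
    fix x assume "x \<in> S"
    then show "((\<lambda>x. f x + g x) has_derivative
        (\<lambda>v. (\<Sum>i\<in>UNIV. v $ i * partial_deriv i f x) + (\<Sum>i\<in>UNIV. v $ i * partial_deriv i g x))) (at x)"
      using Suc.prems by (intro has_derivative_add Ck_on_SucD)
  qed (use Suc in \<open>simp\<close>)
qed

lemma Ck_on_mult:
  assumes "open S" "Ck_on k S f" "Ck_on k S g"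
  shows "Ck_on k S (\<lambda>x. f x * g x)"
  using assms(2,3)
proof (induction k arbitrary: f g)
  case 0
  then show ?case
    by (auto intro: continuous_on_mult)
next
  case (Suc k)
  show ?case
  proof (rule Ck_on_SucI[OF assms(1)])
    fix x assume "x \<in> S"
    then show "((\<lambda>x. f x * g x) has_derivative
        (\<lambda>v. f x * (\<Sum>i\<in>UNIV. v $ i * partial_deriv i g x) + (\<Sum>i\<in>UNIV. v $ i * partial_deriv i f x) * g x)) (at x)"
      using Suc.prems by (intro has_derivative_mult Ck_on_SucD)
  next
    fix i
    have "Ck_on k S f" "Ck_on k S g" "Ck_on k S (partial_deriv i f)" "Ck_on k S (partial_deriv i g)"
      using Suc.prems Ck_on_Suc_imp by auto
    then show "Ck_on k S (\<lambda>x. f x * (\<Sum>j\<in>UNIV. axis i 1 $ j * partial_deriv j g x) +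
        (\<Sum>j\<in>UNIV. axis i 1 $ j * partial_deriv j f x) * g x)"
      using Suc.IH Ck_on_add[OF assms(1)] by simp
  qed
qed

lemma Ck_on_sum:
  assumes "open S" "\<And>j. j \<in> A \<Longrightarrow> Ck_on k S (f j)"
  shows "Ck_on k S (\<lambda>x. \<Sum>j\<in>A. f j x)"
  using assms(2)
proof (induction A rule: infinite_finite_induct)
  case (insert j A)
  then show ?case
    using Ck_on_add[OF assms(1), of k "f j" "\<lambda>x. \<Sum>j\<in>A. f j x"] by simp
qed (simp_all add: Ck_on_const)

lemma Ck_on_exp:
  assumes "open S" "Ck_on k S f"
  shows "Ck_on k S (\<lambda>x. exp (f x))"
  using assms(2)
proof (induction k)
  case 0
  then show ?case
    by (auto intro: continuous_on_exp)
next
  case (Suc k)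
  show ?case
  proof (rule Ck_on_SucI[OF assms(1)])
    fix x assume "x \<in> S"
    then show "((\<lambda>x. exp (f x)) has_derivative
        (\<lambda>v. exp (f x) * (\<Sum>i\<in>UNIV. v $ i * partial_deriv i f x))) (at x)"
      using Ck_on_SucD[OF Suc.prems, of x] by (auto intro!: derivative_eq_intros)
  next
    fix i
    show "Ck_on k S (\<lambda>x. exp (f x) * (\<Sum>j\<in>UNIV. axis i 1 $ j * partial_deriv j f x))"
      using Suc Ck_on_Suc_imp[of k S f] Ck_on_mult[OF assms(1)] by simp
  qed
qed

lemma has_derivative_chain:
  fixes r :: "real ^ 'n::finite \<Rightarrow> real ^ 'm::finite"
  assumes "\<And>l. ((\<lambda>x. r x $ l) has_derivative r' l) (at x)" "F differentiable (at (r x))"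
  shows "((\<lambda>x. F (r x)) has_derivative (\<lambda>v. \<Sum>l\<in>UNIV. r' l v * partial_deriv l F (r x))) (at x)"
proof -
  have "(r has_derivative (\<lambda>v. \<chi> l. r' l v)) (at x)"
    unfolding has_derivative_componentwise_within[of r]
    using assms(1) by (auto simp: Basis_vec_def inner_axis)
  from has_derivative_compose[OF this differentiable_imp_has_derivative[OF assms(2)]]
  show ?thesis
    by simp
qed

text \<open>By the chain rule each partial derivative is a sum of products of a derivative of a
  component of \<open>r\<close> with some \<open>partial_deriv l F\<close> composed with the same
  \<open>r\<close>. So the induction keeps \<open>r\<close> fixed and varies
  \<open>F\<close>.\<close>

lemma Ck_on_compose:
  fixes r :: "real ^ 'n::finite \<Rightarrow> real ^ 'm::finite"
  assumes "open S" "\<And>l. Ck_on k S (\<lambda>x. r x $ l)" "\<And>x. x \<in> S \<Longrightarrow> r x \<in> T" "Ck_on k T F"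
  shows "Ck_on k S (\<lambda>x. F (r x))"
  using assms(2,4)
proof (induction k arbitrary: F)
  case 0
  have "continuous_on S r"
    unfolding continuous_on_componentwise[of S r]
    using 0 by (auto simp: Basis_vec_def inner_axis)
  then show ?case
    using 0 assms(3) continuous_on_compose2[of T F S r] by auto
next
  case (Suc k)
  let ?d = "\<lambda>x v. \<Sum>l\<in>UNIV. (\<Sum>j\<in>UNIV. v $ j * partial_deriv j (\<lambda>x. r x $ l) x) * partial_deriv l F (r x)"
  show ?case
  proof (rule Ck_on_SucI[OF assms(1)])
    fix x assume x: "x \<in> S"
    show "((\<lambda>x. F (r x)) has_derivative ?d x) (at x)"
      using Ck_on_SucD[OF Suc.prems(1) x] Suc.prems(2) assms(3)[OF x]
      by (intro has_derivative_chain[of r "\<lambda>l v. \<Sum>j\<in>UNIV. v $ j * partial_deriv j (\<lambda>x. r x $ l) x"]) auto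
  next
    fix i
    have "Ck_on k S (\<lambda>x. partial_deriv i (\<lambda>x. r x $ l) x * partial_deriv l F (r x))" for l
    proof (rule Ck_on_mult[OF assms(1)])
      show "Ck_on k S (\<lambda>x. partial_deriv l F (r x))"
        by (rule Suc.IH, rule Ck_on_Suc_imp[OF Suc.prems(1)]) (use Suc.prems(2) in simp)
    qed (use Suc.prems in simp)
    then show "Ck_on k S (\<lambda>x. ?d x (axis i 1))"
      by (simp add: Ck_on_sum[OF assms(1)])
  qed
qed

text \<open>The derivative of the function is a constant times its own square, so the induction
  needs products only.\<close>

lemma Ck_on_inverse_diff:
  fixes S :: "(real ^ 'n::finite) set"
  assumes "open S" "\<And>x. x \<in> S \<Longrightarrow> x $ p \<noteq> x $ q"
  shows "Ck_on k S (\<lambda>x. 1 / (x $ p - x $ q))"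
proof (induction k)
  case 0
  show ?case
    using assms by (auto intro!: continuous_intros)
next
  case (Suc k)
  show ?case
  proof (rule Ck_on_SucI[OF assms(1)])
    fix x assume x: "x \<in> S"
    have "x $ p - x $ q \<noteq> 0" 
      using assms(2)[OF x] by simp
    then show "((\<lambda>x. 1 / (x $ p - x $ q)) has_derivative
        (\<lambda>v. (v $ q - v $ p) * (1 / (x $ p - x $ q) * (1 / (x $ p - x $ q))))) (at x)"
      by (auto intro!: derivative_eq_intros has_derivative_vec_nth simp: fun_eq_iff field_simps)
  next
    fix i
    show "Ck_on k S (\<lambda>x. (axis i 1 $ q - axis i 1 $ p) * (1 / (x $ p - x $ q) * (1 / (x $ p - x $ q))))"
      by (intro Ck_on_mult[OF assms(1)] Ck_on_const Suc)
  qed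
qed

lemma DERIV_ln_abs:
  fixes t :: real
  assumes "t \<noteq> 0"
  shows "((\<lambda>t. ln \<bar>t\<bar>) has_field_derivative inverse t) (at t)"
proof (cases "t > 0")
  case True
  show ?thesis
    by (rule has_field_derivative_transform_within_open[of ln _ _ "{0<..}"])
      (use True in \<open>auto intro!: derivative_eq_intros simp: inverse_eq_divide\<close>)
next
  case False
  show ?thesis
    by (rule has_field_derivative_transform_within_open[of "\<lambda>t. ln (- t)" _ _ "{..<0}"])
      (use False assms in \<open>auto intro!: derivative_eq_intros simp: inverse_eq_divide\<close>)
qed

lemma has_derivative_ln_abs_diff:
  fixes x :: "real ^ 'n::finite"
  assumes "x $ p \<noteq> x $ q"
  shows "((\<lambda>x. ln \<bar>x $ p - x $ q\<bar>) has_derivative (\<lambda>v. (v $ p - v $ q) / (x $ p - x $ q))) (at x)"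
proof -
  have "((\<lambda>x. x $ p - x $ q) has_derivative (\<lambda>v. v $ p - v $ q)) (at x)"
    by (intro has_derivative_diff has_derivative_vec_nth)
  moreover have "((\<lambda>t. ln \<bar>t\<bar>) has_derivative (\<lambda>t. t / (x $ p - x $ q))) (at (x $ p - x $ q))"
    using assms by (intro has_derivative_eq_rhs[OF DERIV_ln_abs[unfolded has_field_derivative_def]])
      (auto simp: fun_eq_iff divide_inverse)
  ultimately show ?thesis
    using has_derivative_compose[of "\<lambda>x. x $ p - x $ q" "\<lambda>v. v $ p - v $ q" x UNIV "\<lambda>t. ln \<bar>t\<bar>"] by simp
qed

lemma Ck_on_ln_abs_diff:
  fixes S :: "(real ^ 'n::finite) set"
  assumes "open S" "\<And>x. x \<in> S \<Longrightarrow> x $ p \<noteq> x $ q"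
  shows "Ck_on k S (\<lambda>x. ln \<bar>x $ p - x $ q\<bar>)"
proof -
  have "Ck_on (Suc k) S (\<lambda>x. ln \<bar>x $ p - x $ q\<bar>)"
  proof (rule Ck_on_SucI[OF assms(1)])
    show "((\<lambda>x. ln \<bar>x $ p - x $ q\<bar>) has_derivative (\<lambda>v. (v $ p - v $ q) * (1 / (x $ p - x $ q)))) (at x)"
      if "x \<in> S" for x
      using has_derivative_ln_abs_diff[of x p q] assms(2)[OF that] by simp
    show "Ck_on k S (\<lambda>x. (axis i 1 $ p - axis i 1 $ q) * (1 / (x $ p - x $ q)))" for i
      by (intro Ck_on_mult[OF assms(1)] Ck_on_const Ck_on_inverse_diff assms)
  qed
  then show ?thesis
    by (rule Ck_on_Suc_imp)
qed

section \<open>The partial differential equations\<close>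

text \<open>The logarithm of the first quotient in \<open>cross_ratio\<close>. As a sum of
  logarithms of differences it has a derivative that is linear in the terms
  \<open>dlog\<close>.\<close>

definition log_ratio :: "'n \<Rightarrow> 'n \<Rightarrow> 'n \<Rightarrow> 'n \<Rightarrow> real ^ 'n \<Rightarrow> real"
  where "log_ratio p q p' q' x =
    ln \<bar>x $ p - x $ p'\<bar> + ln \<bar>x $ q - x $ q'\<bar> - ln \<bar>x $ p - x $ q'\<bar> - ln \<bar>x $ q - x $ p'\<bar>"

text \<open>The derivative of \<open>ln \<bar>x $ p - x $ q\<bar>\<close> in the direction
  \<open>v\<close>.\<close>

definition dlog :: "real ^ 'n \<Rightarrow> 'n \<Rightarrow> 'n \<Rightarrow> real ^ 'n \<Rightarrow> real"
  where "dlog x p q v = (v $ p - v $ q) / (x $ p - x $ q)"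

lemma has_derivative_log_ratio:
  fixes x :: "real ^ 'n::finite"
  assumes "x $ p \<noteq> x $ p'" "x $ q \<noteq> x $ q'" "x $ p \<noteq> x $ q'" "x $ q \<noteq> x $ p'"
  shows "(log_ratio p q p' q' has_derivative
      (\<lambda>v. dlog x p p' v + dlog x q q' v - dlog x p q' v - dlog x q p' v)) (at x)"
  unfolding log_ratio_def[abs_def] dlog_def
  by (intro has_derivative_add has_derivative_diff has_derivative_ln_abs_diff assms)

lemma exp_log_ratio:
  fixes x :: "real ^ 'n::finite"
  assumes "(x $ p - x $ p') * (x $ q - x $ q') * ((x $ p - x $ q') * (x $ q - x $ p')) > 0"
  shows "exp (log_ratio p q p' q' x) =
    ((x $ p - x $ p') * (x $ q - x $ q')) / ((x $ p - x $ q') * (x $ q - x $ p'))"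
proof -
  have "x $ p - x $ p' \<noteq> 0" "x $ q - x $ q' \<noteq> 0" "x $ p - x $ q' \<noteq> 0" "x $ q - x $ p' \<noteq> 0"
    using assms by auto
  then have "exp (log_ratio p q p' q' x) =
      (\<bar>x $ p - x $ p'\<bar> * \<bar>x $ q - x $ q'\<bar>) / (\<bar>x $ p - x $ q'\<bar> * \<bar>x $ q - x $ p'\<bar>)"
    by (simp add: log_ratio_def exp_add exp_diff)
  also have "\<dots> = \<bar>((x $ p - x $ p') * (x $ q - x $ q')) / ((x $ p - x $ q') * (x $ q - x $ p'))\<bar>"
    by (simp add: abs_mult)
  also have "\<dots> = ((x $ p - x $ p') * (x $ q - x $ q')) / ((x $ p - x $ q') * (x $ q - x $ p'))"
    using assms by (intro abs_of_pos) (metis zero_less_divide_iff zero_less_mult_iff)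
  finally show ?thesis .
qed

text \<open>
  Here \<open>\<sigma> = 1\<close> for equation (2) and \<open>\<sigma> = - 1\<close> for equation (3); \<open>r1\<close> and \<open>r3\<close> are the cross-ratios that
  involve the link of \<open>x\<^sub>i\<close>.  The letters \<open>p, q, m\<close> stand for the logarithmic derivatives in \<open>x\<^sub>i\<close> of \<open>r1\<close>,
  \<open>r3\<close> and of the prefactor, \<open>p1, q1, m1\<close> for the derivatives of these, and \<open>t1, t2, t3, tm\<close> for the
  logarithmic derivatives along \<open>\<Sum>\<^sub>j 2 u\<^sub>j \<partial>\<^sub>j\<close>.
\<close>

lemma reduced_identity:
  fixes \<beta> wb wc v r1 r2 r3 F F1 F2 F3 F11 F13 F31 F33 G K :: real
  assumes e1: "r1 * (1 - r1) * F11 + (2 * \<beta> - 2 * r1) * F1 - \<beta> * (1 - \<beta>) * F = (1 - r2) * (1 - r3) * G"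
    and e3: "r3 * (1 - r3) * F33 + (2 * \<beta> - 2 * r3) * F3 - \<beta> * (1 - \<beta>) * F = (1 - r2) * (1 - r1) * G"
    and e2: "r1 * r3 * (F13 + F31) + \<beta> * r1 * F1 + \<beta> * r3 * F3 - \<beta> * \<sigma> * r2 * F2 + (1 - \<sigma>) / 2 * \<beta>\<^sup>2 * F = K * G"
    and rel: "(1 - r2) * (r1 * wb\<^sup>2 + r3 * wc\<^sup>2) + wb * wc * K = 0"
    and h: "h = 3 * \<beta> / 4 - 1 / 2"
    and p: "p = - wb * (1 - r1)" and q: "q = - wc * (1 - r3)"
    and p1: "p1 = p * (wb * (1 + r1) + 2 * v)" and q1: "q1 = q * (wc * (1 + r3) + 2 * v)"
    and m: "m = 2 * h * v + \<beta> / 2 * (p + q)"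
    and m1: "m1 = 2 * h * v\<^sup>2 + \<beta> / 2 * (p1 + q1)"
    and t1: "t1 = - 2 * p * (wb * (1 + r1) + 3 * v)" and t3: "t3 = - 2 * q * (wc * (1 + r3) + 3 * v)"
    and t2: "t2 = - 2 * \<sigma> * p * q"
    and ub: "ub = wb + v" and ub': "ub' = r1 * wb + v"
    and uc: "uc = wc + v" and uc': "uc' = r3 * wc + v"
    and tm: "tm = - 2 * h * (2 * v\<^sup>2 - 2 * ub * ub' - 2 * uc * uc') + \<beta> / 2 * (t1 + t2 + t3)"
  shows "((m\<^sup>2 + m1) * F + 2 * m * (p * r1 * F1 + q * r3 * F3)
      + p * r1 * (r1 * p * F11 + r3 * q * F31 + p * F1) + p1 * r1 * F1
      + q * r3 * (r1 * p * F13 + r3 * q * F33 + q * F3) + q1 * r3 * F3)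
    + \<beta> / 2 * (tm * F + t1 * r1 * F1 + t2 * r2 * F2 + t3 * r3 * F3
      - 2 * h * (v\<^sup>2 + ub\<^sup>2 + ub'\<^sup>2 + uc\<^sup>2 + uc'\<^sup>2) * F) = 0" (is "?L = 0")
proof -
  \<comment> \<open>With \<open>g\<close> and \<open>\<tau>\<close> the parameters \<beta>, 2h and
    \<sigma> become polynomials with integer coefficients, so every comparison of coefficients below
    is a polynomial identity.\<close>
  define g where "g = \<beta> / 4"
  define \<tau> where "\<tau> = (1 - \<sigma>) / 2"
  have subst: "2 * h = 6 * g - 1" "\<beta> = 4 * g" "\<sigma> = 1 - 2 * \<tau>"
    unfolding g_def \<tau>_def h by (simp_all add: field_simps)
  have h': "h = 3 * g - 1 / 2"
    using subst(1) by simp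
  define m' p1' q1' tm' where defs: "m' = (6 * g - 1) * v + 2 * g * (p + q)"
    "p1' = p * (wb * (1 + r1) + 2 * v)" "q1' = q * (wc * (1 + r3) + 2 * v)"
    "tm' = - (6 * g - 1) * (2 * v\<^sup>2 - 2 * ub * ub' - 2 * uc * uc') + 2 * g * (t1 + t2 + t3)"
  have eqs: "m = m'" "p1 = p1'" "q1 = q1'" "tm = tm'" "m1 = (6 * g - 1) * v\<^sup>2 + 2 * g * (p1 + q1)"
    unfolding m p1 q1 tm m1 defs h' subst(2) by (simp_all add: algebra_simps)
  \<comment> \<open>The next facts compare the coefficients of \<open>F\<close> and of its
    derivatives on the left with those of the combination of (1) for \<open>r1\<close>, (1) for
    \<open>r3\<close> and (2) or (3), with weights \<open>wb\<^sup>2 * (1 - r1) * r1\<close>,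
    \<open>wc\<^sup>2 * (1 - r3) * r3\<close> and
    \<open>wb * wc * (1 - r1) * (1 - r3)\<close>.\<close>
  have cF: "m\<^sup>2 + m1 + 2 * g * (tm - (6 * g - 1) * (v\<^sup>2 + ub\<^sup>2 + ub'\<^sup>2 + uc\<^sup>2 + uc'\<^sup>2))
      = - wb\<^sup>2 * (1 - r1) * r1 * (4 * g * (1 - 4 * g)) - wc\<^sup>2 * (1 - r3) * r3 * (4 * g * (1 - 4 * g))
        + wb * wc * (1 - r1) * (1 - r3) * (\<tau> * (4 * g)\<^sup>2)"
    unfolding eqs defs t1 t2 t3 p q ub ub' uc uc' subst by algebra
  have c1: "2 * m * p * r1 + p * p * r1 + p1 * r1 + 2 * g * t1 * r1
      = wb\<^sup>2 * (1 - r1) * r1 * (2 * (4 * g) - 2 * r1) + wb * wc * (1 - r1) * (1 - r3) * (4 * g * r1)"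
    unfolding eqs defs t1 p q by algebra
  have c3: "2 * m * q * r3 + q * q * r3 + q1 * r3 + 2 * g * t3 * r3
      = wc\<^sup>2 * (1 - r3) * r3 * (2 * (4 * g) - 2 * r3) + wb * wc * (1 - r1) * (1 - r3) * (4 * g * r3)"
    unfolding eqs defs t3 p q by algebra
  have c2: "2 * g * t2 = - wb * wc * (1 - r1) * (1 - r3) * (4 * g * \<sigma>)"
    unfolding t2 p q by algebra
  have c11: "p * p = wb\<^sup>2 * (1 - r1) * (1 - r1)" "q * q = wc\<^sup>2 * (1 - r3) * (1 - r3)" "p * q = wb * wc * (1 - r1) * (1 - r3)"
    unfolding p q by algebra+
  have "?L = (m\<^sup>2 + m1 + 2 * g * (tm - (6 * g - 1) * (v\<^sup>2 + ub\<^sup>2 + ub'\<^sup>2 + uc\<^sup>2 + uc'\<^sup>2))) * F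
      + (2 * m * p * r1 + p * p * r1 + p1 * r1 + 2 * g * t1 * r1) * F1
      + (2 * m * q * r3 + q * q * r3 + q1 * r3 + 2 * g * t3 * r3) * F3
      + 2 * g * t2 * r2 * F2 + p * p * r1 * r1 * F11 + q * q * r3 * r3 * F33 + p * q * r1 * r3 * (F13 + F31)"
    unfolding subst by (simp add: algebra_simps power2_eq_square)
  also have "\<dots> = wb\<^sup>2 * (1 - r1) * r1 * (r1 * (1 - r1) * F11 + (2 * \<beta> - 2 * r1) * F1 - \<beta> * (1 - \<beta>) * F)
      + wc\<^sup>2 * (1 - r3) * r3 * (r3 * (1 - r3) * F33 + (2 * \<beta> - 2 * r3) * F3 - \<beta> * (1 - \<beta>) * F)
      + wb * wc * (1 - r1) * (1 - r3) * (r1 * r3 * (F13 + F31) + \<beta> * r1 * F1 + \<beta> * r3 * F3 - \<beta> * \<sigma> * r2 * F2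
          + \<tau> * \<beta>\<^sup>2 * F)"
    unfolding cF c1 c3 c2 unfolding c11 subst(2) by algebra
  \<comment> \<open>The three right-hand sides share the factor
    \<open>G * (1 - r1) * (1 - r3)\<close>; what is left is the quadratic relation
    \<open>rel\<close>.\<close>
  also have "\<dots> = G * (1 - r1) * (1 - r3) * ((1 - r2) * (r1 * wb\<^sup>2 + r3 * wc\<^sup>2) + wb * wc * K)"
    unfolding \<tau>_def e1 e2 e3 by (simp add: algebra_simps)
  finally show ?thesis
    unfolding rel by simp
qed

section \<open>Coordinate labels and the open chamber\<close>

lemma of_nat_6_image: "(of_nat :: nat \<Rightarrow> 6) ` {1..6} = UNIV"
proof -
  have "p \<in> (of_nat :: nat \<Rightarrow> 6) ` {1..6}" for p
  proof (cases p)
    case (of_int z)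
    then have z: "0 \<le> z" "z < 6"
      by simp_all
    show ?thesis
    proof (cases "z = 0")
      \<comment> \<open>The index 0 carries the label 6; every other index carries its own value as
        label.\<close>
      case True
      then show ?thesis
        using of_int(1) by (intro image_eqI[of _ _ 6]) simp_all
    next
      case False
      then show ?thesis
        using z of_int(1) by (intro image_eqI[of _ _ "nat z"]) auto
    qed
  qed
  then show ?thesis
    by blast
qed

lemma inj_on_of_nat_6: "inj_on (of_nat :: nat \<Rightarrow> 6) {1..6}"
  by (rule eq_card_imp_inj_on) (simp_all add: of_nat_6_image del: atLeastAtMost_iff One_nat_def)

lemma chamber_6: "x \<in> chamber \<longleftrightarrow> (\<forall>j\<in>{1..6}. \<forall>k\<in>{1..6}. j < k \<longrightarrow> coord (x :: real ^ 6) j < coord x k)"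
  by (simp add: chamber_def)

lemma chamber_coord_neq:
  assumes "(x :: real ^ 6) \<in> chamber" "j \<in> {1..6}" "k \<in> {1..6}" "j \<noteq> k"
  shows "coord x j \<noteq> coord x k"
  using assms by (metis chamber_6 less_irrefl nat_neq_iff)

lemma chamber_nth_neq:
  assumes "(x :: real ^ 6) \<in> chamber" "p \<noteq> q"
  shows "x $ p \<noteq> x $ q"
proof -
  obtain j k where "p = of_nat j" "q = of_nat k" "j \<in> {1..6}" "k \<in> {1..6}"
    using of_nat_6_image by (metis UNIV_I imageE)
  with assms chamber_coord_neq[OF assms(1), of j k] show ?thesis
    by (auto simp: coord_def)
qed

lemma open_chamber: "open (chamber :: (real ^ 6) set)"
proof -
  have eq: "chamber = (\<Inter>j\<in>{1..6}. \<Inter>k\<in>{1..6} \<inter> {k. j < k}. {x :: real ^ 6. x $ of_nat j < x $ of_nat k})"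
    by (auto simp: chamber_6 coord_def)
  have "open {x :: real ^ 6. x $ p < x $ q}" for p q
    by (intro open_Collect_less continuous_intros)
  then show ?thesis
    unfolding eq by (intro open_INT ballI) auto
qed

text \<open>The point \<open>i\<close> is linked to \<open>i'\<close>, and the two other links are
  oriented relative to this one, so that the cross-ratios involving \<open>i\<close> are the
  quotients themselves. The sign \<sigma> then affects only the cross-ratio of the two other links.
  The positions \<open>l1\<close>, \<open>l2\<close>, \<open>l3\<close> are variable because
  \<open>F\<close> need not be symmetric.\<close>

lemma pde_at_index:
  fixes i i' b b' c c' :: 6 and l1 l2 l3 :: 3 and Z :: "real ^ 6 \<Rightarrow> real" and F G :: "real ^ 3 \<Rightarrow> real"
  assumes dist: "distinct [i, i', b, b', c, c']" and l: "distinct [l1, l2, l3]"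
    and \<beta>: "\<beta> > 0" and h: "h = 3 * \<beta> / 4 - 1 / 2" and \<kappa>: "\<kappa> = 4 / \<beta>"
    and F: "smooth_on (box 0 1) F" and eq1: "hypergeo_eqs \<beta> F G"
    and eq2: "\<sigma> = 1 \<and> rainbow_eqs \<beta> F G \<or> \<sigma> = - 1 \<and> neighbor_eqs \<beta> F G"
    and nc: "\<And>x. x \<in> chamber \<Longrightarrow> (x $ i - x $ b) * (x $ i' - x $ b') * ((x $ i - x $ b') * (x $ i' - x $ b)) > 0"
      "\<And>x. x \<in> chamber \<Longrightarrow> (x $ i - x $ c) * (x $ i' - x $ c') * ((x $ i - x $ c') * (x $ i' - x $ c)) > 0"
      "\<And>x. x \<in> chamber \<Longrightarrow> (x $ b - x $ c) * (x $ b' - x $ c') * ((x $ b - x $ c') * (x $ b' - x $ c)) > 0"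
    and neg: "\<And>x. x \<in> chamber \<Longrightarrow> log_ratio i i' b b' x < 0" 
      "\<And>x. x \<in> chamber \<Longrightarrow> log_ratio i i' c c' x < 0"
      "\<And>x. x \<in> chamber \<Longrightarrow> \<sigma> * log_ratio b b' c c' x < 0"
    and Z: "\<And>x. x \<in> chamber \<Longrightarrow> Z x = C * exp (- 2 * h * (ln \<bar>x $ i - x $ i'\<bar> + ln \<bar>x $ b - x $ b'\<bar> + ln \<bar>x $ c - x $ c'\<bar>)
        + \<beta> / 2 * (log_ratio i i' b b' x + log_ratio i i' c c' x + \<sigma> * log_ratio b b' c c' x))
        * F (\<chi> l. exp (if l = l1 then log_ratio i i' b b' x else if l = l3 then log_ratio i i' c c' x
              else \<sigma> * log_ratio b b' c c' x))"
    and x: "x \<in> chamber"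
  shows "\<kappa> / 2 * partial_deriv i (partial_deriv i Z) x
      + (\<Sum>j\<in>UNIV - {i}. 2 / (x $ j - x $ i) * partial_deriv j Z x
                          - 2 * h / (x $ j - x $ i)\<^sup>2 * Z x) = 0"
proof -
  define R where "R y l = (if l = l1 then log_ratio i i' b b' y else if l = l3 then log_ratio i i' c c' y
              else \<sigma> * log_ratio b b' c c' y)" for y and l :: 3
  define r :: "real ^ 6 \<Rightarrow> real ^ 3" where "r y = (\<chi> l. exp (R y l))" for y
  define LM where "LM y = - 2 * h * (ln \<bar>y $ i - y $ i'\<bar> + ln \<bar>y $ b - y $ b'\<bar> + ln \<bar>y $ c - y $ c'\<bar>)
        + \<beta> / 2 * (log_ratio i i' b b' y + log_ratio i i' c c' y + \<sigma> * log_ratio b b' c c' y)" for y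
  define d1 where "d1 y v = dlog y i b v + dlog y i' b' v - dlog y i b' v - dlog y i' b v" for y v
  define d3 where "d3 y v = dlog y i c v + dlog y i' c' v - dlog y i c' v - dlog y i' c v" for y v
  define d2 where "d2 y v = \<sigma> * (dlog y b c v + dlog y b' c' v - dlog y b c' v - dlog y b' c v)" for y v
  define dM where "dM y v = - 2 * h * (dlog y i i' v + dlog y b b' v + dlog y c c' v)
      + \<beta> / 2 * (d1 y v + d3 y v + d2 y v)" for y v
  have ne: "y $ p \<noteq> y $ q" if "y \<in> chamber" "p \<noteq> q" for y :: "real ^ 6" and p q
    using chamber_nth_neq that by blast
  have UNIV3: "(UNIV :: 3 set) = {l1, l2, l3}"
    using l by (intro card_subset_eq[symmetric]) auto
  have r_box: "r y \<in> box 0 1" if "y \<in> chamber" for y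
    using neg that by (auto simp: mem_box_cart r_def R_def)
  have D1: "(log_ratio i i' b b' has_derivative d1 y) (at y)"
    and D3: "(log_ratio i i' c c' has_derivative d3 y) (at y)"
    and D2: "((\<lambda>y. \<sigma> * log_ratio b b' c c' y) has_derivative d2 y) (at y)"
    if "y \<in> chamber" for y
    unfolding d1_def d2_def d3_def using ne[OF that] dist
    by (auto intro!: has_derivative_mult_right has_derivative_log_ratio)
  have Dexp: "((\<lambda>y. exp (f y)) has_derivative (\<lambda>v. exp (f y) * f' v)) (at y)"
    if "(f has_derivative f') (at y)" for f :: "real ^ 6 \<Rightarrow> real" and f' y
    using has_derivative_exp[OF that] by (simp add: mult.commute)
  have DM: "((\<lambda>y. exp (LM y)) has_derivative (\<lambda>v. exp (LM y) * dM y v)) (at y)" if "y \<in> chamber" for y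
  proof -
    have "(LM has_derivative dM y) (at y)"
      unfolding LM_def[abs_def] dM_def[abs_def] dlog_def using ne[OF that] dist D1[OF that] D2[OF that] D3[OF that]
      by (intro has_derivative_add has_derivative_mult_right has_derivative_ln_abs_diff) auto
    then show ?thesis
      by (rule Dexp)
  qed
  define dR where "dR y l v = (if l = l1 then d1 y v else if l = l3 then d3 y v else d2 y v)" for y v and l :: 3
  have DR: "((\<lambda>y. r y $ l) has_derivative (\<lambda>v. exp (R y l) * dR y l v)) (at y)" if "y \<in> chamber" for y l
  proof -
    have "((\<lambda>y. R y l) has_derivative dR y l) (at y)"
      unfolding R_def dR_def[abs_def] using D1[OF that] D2[OF that] D3[OF that]
      by (cases "l = l1"; cases "l = l3") simp_all
    then show ?thesis
      unfolding r_def by (auto intro: Dexp)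
  qed
  have chain: "((\<lambda>y. f (r y)) has_derivative (\<lambda>v. \<Sum>l\<in>UNIV. exp (R y l) * dR y l v * partial_deriv l f (r y))) (at y)"
    if "y \<in> chamber" "f differentiable (at (r y))" for y f
    using DR[OF that(1)] that(2) by (rule has_derivative_chain)
  have chain': "((\<lambda>y. f (r y)) has_derivative (\<lambda>v. exp (R y l1) * d1 y v * partial_deriv l1 f (r y)
      + exp (R y l2) * d2 y v * partial_deriv l2 f (r y) + exp (R y l3) * d3 y v * partial_deriv l3 f (r y))) (at y)"
    if "y \<in> chamber" "f differentiable (at (r y))" for y f
    using chain[OF that] l unfolding UNIV3 by (simp add: dR_def add.assoc not_sym)
  have Fdiff: "F differentiable (at (r y))" "partial_deriv l F differentiable (at (r y))" if "y \<in> chamber" for y l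
    using F r_box[OF that] unfolding smooth_on_def by (metis Ck_on.simps(2))+
  define dZ where "dZ y v = C * exp (LM y) * (dM y v * F (r y) + exp (R y l1) * d1 y v * partial_deriv l1 F (r y)
      + exp (R y l2) * d2 y v * partial_deriv l2 F (r y) + exp (R y l3) * d3 y v * partial_deriv l3 F (r y))" for y v
  have Zr: "Z y = C * exp (LM y) * F (r y)" if "y \<in> chamber" for y
    unfolding Z[OF that] r_def R_def LM_def by simp
  have DZ: "(Z has_derivative dZ y) (at y)" if y: "y \<in> chamber" for y
  proof -
    have "((\<lambda>y. C * exp (LM y) * F (r y)) has_derivative dZ y) (at y)"
      unfolding dZ_def
      by (rule derivative_eq_intros DM[OF y] chain'[OF y] Fdiff[OF y] refl)+ (simp add: algebra_simps)
    then show ?thesis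
      by (rule has_derivative_transform_within_open[OF _ open_chamber y]) (simp add: Zr)
  qed
  \<comment> \<open>The coordinates in which \<open>x $ i\<close> lies at infinity.\<close>
  define u where "u p y = 1 / (y $ p - y $ i)" for p and y :: "real ^ 6"
  define P Q M where "P y = u b' y - u b y" and "Q y = u c' y - u c y"
    and "M y = 2 * h * u i' y + \<beta> / 2 * (P y + Q y)" for y
  have d_i: "d1 y (axis i 1) = P y" "d3 y (axis i 1) = Q y" "d2 y (axis i 1) = 0" "dM y (axis i 1) = M y" for y
  proof -
    have neg: "1 / (s - t) = - (1 / (t - s))" for s t :: real
      by (metis minus_diff_eq minus_divide_right)
    have A: "axis i 1 $ p = (0 :: real)" if "i \<noteq> p" for p
      using that by (simp add: axis_def)
    show d: "d1 y (axis i 1) = P y" "d3 y (axis i 1) = Q y" "d2 y (axis i 1) = 0"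
      unfolding d1_def d3_def d2_def dlog_def P_def Q_def u_def
      using dist neg[of "y $ i"] by (simp_all add: A)
    show "dM y (axis i 1) = M y"
      unfolding dM_def d M_def dlog_def u_def using dist neg[of "y $ i"] by (simp add: A)
  qed
  have Du: "(u p has_derivative (\<lambda>v. (v $ i - v $ p) * (u p y)\<^sup>2)) (at y)" if "y \<in> chamber" "p \<noteq> i" for p y
  proof -
    have "y $ p - y $ i \<noteq> 0"
      using ne[OF that] by simp
    then show ?thesis
      unfolding u_def[abs_def]
      by (auto intro!: derivative_eq_intros has_derivative_vec_nth simp: fun_eq_iff field_simps power2_eq_square)
  qed
  \<comment> \<open>A closed form of the first partial derivative, valid on the whole chamber. The
    cross-ratio at \<open>l2\<close> does not involve \<open>x $ i\<close> and contributes nothing,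
    so one further differentiation gives the second-order term.\<close>
  define W where "W y = C * exp (LM y) * (M y * F (r y) + exp (R y l1) * P y * partial_deriv l1 F (r y)
      + exp (R y l3) * Q y * partial_deriv l3 F (r y))" for y
  have pdZ: "partial_deriv i Z y = W y" if "y \<in> chamber" for y
    unfolding partial_deriv_eq[OF DZ[OF that]] dZ_def W_def d_i by simp
  let ?e = "axis i 1 :: real ^ 6"
  define p1 q1 m1 where "p1 = (u b' x)\<^sup>2 - (u b x)\<^sup>2" and "q1 = (u c' x)\<^sup>2 - (u c x)\<^sup>2"
    and "m1 = 2 * h * (u i' x)\<^sup>2 + \<beta> / 2 * (p1 + q1)"
  let ?r1 = "exp (R x l1)" and ?r2 = "exp (R x l2)" and ?r3 = "exp (R x l3)"
  let ?F1 = "partial_deriv l1 F (r x)" and ?F2 = "partial_deriv l2 F (r x)" and ?F3 = "partial_deriv l3 F (r x)"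
  let ?F11 = "partial_deriv l1 (partial_deriv l1 F) (r x)" and ?F33 = "partial_deriv l3 (partial_deriv l3 F) (r x)"
  let ?F13 = "partial_deriv l1 (partial_deriv l3 F) (r x)" and ?F31 = "partial_deriv l3 (partial_deriv l1 F) (r x)"
  have ax: "?e $ i = 1" "?e $ i' = 0" "?e $ b = 0" "?e $ b' = 0" "?e $ c = 0" "?e $ c' = 0"
    using dist by (auto simp: axis_def)
  have pdW: "partial_deriv i W x = C * exp (LM x) * (((M x)\<^sup>2 + m1) * F (r x)
      + 2 * M x * (P x * ?r1 * ?F1 + Q x * ?r3 * ?F3)
      + P x * ?r1 * (?r1 * P x * ?F11 + ?r3 * Q x * ?F31 + P x * ?F1) + p1 * ?r1 * ?F1
      + Q x * ?r3 * (?r1 * P x * ?F13 + ?r3 * Q x * ?F33 + Q x * ?F3) + q1 * ?r3 * ?F3)"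
  proof -
    let ?f = "\<lambda>f v. exp (R x l1) * d1 x v * partial_deriv l1 f (r x)
      + exp (R x l2) * d2 x v * partial_deriv l2 f (r x) + exp (R x l3) * d3 x v * partial_deriv l3 f (r x)"
    let ?dP = "\<lambda>v. (v $ i - v $ b') * (u b' x)\<^sup>2 - (v $ i - v $ b) * (u b x)\<^sup>2"
    let ?dQ = "\<lambda>v. (v $ i - v $ c') * (u c' x)\<^sup>2 - (v $ i - v $ c) * (u c x)\<^sup>2"
    let ?dM = "\<lambda>v. 2 * h * ((v $ i - v $ i') * (u i' x)\<^sup>2) + \<beta> / 2 * (?dP v + ?dQ v)"
    have DP: "(P has_derivative ?dP) (at x)" and DQ: "(Q has_derivative ?dQ) (at x)"
      unfolding P_def[abs_def] Q_def[abs_def] using dist by (auto intro!: has_derivative_diff Du[OF x])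
    have DMm: "(M has_derivative ?dM) (at x)"
      unfolding M_def[abs_def] using dist
      by (intro has_derivative_add has_derivative_mult_right Du[OF x] DP DQ) auto
    have D1': "((\<lambda>y. exp (R y l1)) has_derivative (\<lambda>v. exp (R x l1) * d1 x v)) (at x)"
      and D3': "((\<lambda>y. exp (R y l3)) has_derivative (\<lambda>v. exp (R x l3) * d3 x v)) (at x)"
      using DR[OF x, of l1] DR[OF x, of l3] l by (simp_all add: r_def dR_def not_sym)
    note Df = chain'[OF x Fdiff(1)[OF x]] chain'[OF x Fdiff(2)[OF x, of l1]] chain'[OF x Fdiff(2)[OF x, of l3]]
    have "(W has_derivative (\<lambda>v. C * (exp (LM x) * ((M x * ?f F v + ?dM v * F (r x))
         + (exp (R x l1) * P x * ?f (partial_deriv l1 F) v + (exp (R x l1) * ?dP v + exp (R x l1) * d1 x v * P x) * ?F1)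
         + (exp (R x l3) * Q x * ?f (partial_deriv l3 F) v + (exp (R x l3) * ?dQ v + exp (R x l3) * d3 x v * Q x) * ?F3))
        + exp (LM x) * dM x v * (M x * F (r x) + exp (R x l1) * P x * ?F1 + exp (R x l3) * Q x * ?F3)))) (at x)"
      unfolding W_def[abs_def] mult.assoc[of C]
      by (intro has_derivative_mult_right has_derivative_mult has_derivative_add DM[OF x] D1' D3' DP DQ DMm Df)
    from partial_deriv_eq[OF this, of i] show ?thesis
      unfolding d_i p1_def q1_def m1_def ax by (simp add: algebra_simps power2_eq_square)
  qed
  \<comment> \<open>The first-order part of the equation is the derivative of \<open>Z\<close> in
    this direction. Along it, \<open>ln \<bar>x $ p - x $ q\<bar>\<close> has derivative
    \<open>- 2 * u p x * u q x\<close>, or \<open>2 * (u q x)\<^sup>2\<close> if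
    \<open>p = i\<close>, since \<open>V $ i = 0\<close>.\<close>
  define V :: "real ^ 6" where "V = (\<chi> j. if j = i then 0 else 2 * u j x)"
  have UNIV_i: "UNIV - {i} = {i', b, b', c, c'}"
  proof -
    have "{i, i', b, b', c, c'} = UNIV"
      using dist by (intro card_subset_eq) auto
    then show ?thesis
      using dist by auto
  qed
  have T: "(\<Sum>j\<in>UNIV - {i}. 2 / (x $ j - x $ i) * partial_deriv j Z x) = dZ x V"
  proof -
    have "dZ x = (\<lambda>v. \<Sum>j\<in>UNIV. v $ j * partial_deriv j Z x)"
      using DZ[OF x] differentiable_imp_has_derivative has_derivative_unique unfolding differentiable_def by blast
    then have "dZ x V = (\<Sum>j\<in>UNIV. V $ j * partial_deriv j Z x)"
      by simp
    also have "\<dots> = (\<Sum>j\<in>UNIV - {i}. V $ j * partial_deriv j Z x)"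
      by (rule sum.mono_neutral_right) (auto simp: V_def)
    also have "\<dots> = (\<Sum>j\<in>UNIV - {i}. 2 / (x $ j - x $ i) * partial_deriv j Z x)"
      by (rule sum.cong) (auto simp: V_def u_def)
    finally show ?thesis
      by simp
  qed
  have dlogV: "dlog x p q V = - 2 * u p x * u q x" if "p \<noteq> i" "q \<noteq> i" "p \<noteq> q" for p q
  proof -
    have "x $ p - x $ i \<noteq> 0" "x $ q - x $ i \<noteq> 0" "x $ p - x $ q \<noteq> 0"
      using ne[OF x] that by simp_all
    then show ?thesis
      using that by (simp add: dlog_def V_def u_def nonzero_divide_eq_eq) (simp add: divide_simps)
  qed
  have dlogVi: "dlog x i q V = 2 * (u q x)\<^sup>2" if "q \<noteq> i" for q
  proof -
    have "x $ i - x $ q \<noteq> 0" "x $ q - x $ i \<noteq> 0"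
      using ne[OF x] that by simp_all
    then show ?thesis
      using that by (simp add: dlog_def V_def u_def nonzero_divide_eq_eq) (simp add: divide_simps power2_eq_square)
  qed
  have ni: "i' \<noteq> i" "b \<noteq> i" "b' \<noteq> i" "c \<noteq> i" "c' \<noteq> i"
    using dist by auto
  have d_V: "d1 x V = 2 * (u b x)\<^sup>2 - 2 * u i' x * u b' x - 2 * (u b' x)\<^sup>2 + 2 * u i' x * u b x"
    "d3 x V = 2 * (u c x)\<^sup>2 - 2 * u i' x * u c' x - 2 * (u c' x)\<^sup>2 + 2 * u i' x * u c x"
    "d2 x V = - 2 * \<sigma> * P x * Q x"
    "dM x V = - 2 * h * (2 * (u i' x)\<^sup>2 - 2 * u b x * u b' x - 2 * u c x * u c' x)
        + \<beta> / 2 * (d1 x V + d3 x V + d2 x V)"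
    unfolding dM_def unfolding d1_def d2_def d3_def P_def Q_def using dist
    by (simp_all add: dlogV dlogVi ni algebra_simps)
  have pot: "(\<Sum>j\<in>UNIV - {i}. 2 * h / (x $ j - x $ i)\<^sup>2 * Z x) =
      2 * h * ((u i' x)\<^sup>2 + (u b x)\<^sup>2 + (u b' x)\<^sup>2 + (u c x)\<^sup>2 + (u c' x)\<^sup>2) * Z x"
  proof -
    have "(\<Sum>j\<in>UNIV - {i}. 2 * h / (x $ j - x $ i)\<^sup>2 * Z x) = (\<Sum>j\<in>UNIV - {i}. 2 * h * (u j x)\<^sup>2 * Z x)"
      by (simp add: u_def power_divide)
    also have "\<dots> = 2 * h * ((u i' x)\<^sup>2 + (u b x)\<^sup>2 + (u b' x)\<^sup>2 + (u c x)\<^sup>2 + (u c' x)\<^sup>2) * Z x"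
      unfolding UNIV_i using dist by (simp add: algebra_simps)
    finally show ?thesis .
  qed
  have ppZ: "partial_deriv i (partial_deriv i Z) x = partial_deriv i W x"
    by (rule partial_deriv_cong[OF open_chamber x pdZ])
  \<comment> \<open>Translating by \<open>u i' x\<close> puts the partner of \<open>x $ i\<close> at
    the origin. With the other end at infinity, the cross-ratios at \<open>l1\<close> and
    \<open>l3\<close> become plain quotients: the ends of the two other links lie at
    \<open>wb\<close>, \<open>?r1 * wb\<close> and \<open>wc\<close>,
    \<open>?r3 * wc\<close>.\<close>
  define wb wc where "wb = u b x - u i' x" and "wc = u c x - u i' x"
  have ne6: "x $ i - x $ i' \<noteq> 0" "x $ i - x $ b \<noteq> 0" "x $ i - x $ b' \<noteq> 0" "x $ i - x $ c \<noteq> 0" "x $ i - x $ c' \<noteq> 0"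
    "x $ i' - x $ b \<noteq> 0" "x $ i' - x $ b' \<noteq> 0" "x $ i' - x $ c \<noteq> 0" "x $ i' - x $ c' \<noteq> 0"
    "x $ b - x $ b' \<noteq> 0" "x $ b - x $ c \<noteq> 0" "x $ b - x $ c' \<noteq> 0"
    "x $ b' - x $ c \<noteq> 0" "x $ b' - x $ c' \<noteq> 0" "x $ c - x $ c' \<noteq> 0"
    using ne[OF x] dist by simp_all
  have ratio: "(s - t) * (s' - t') / ((s - t') * (s' - t)) * (1 / (t - s) - 1 / (s' - s)) = 1 / (t' - s) - 1 / (s' - s)"
    if "s - s' \<noteq> 0" "s - t \<noteq> 0" "s - t' \<noteq> 0" "s' - t \<noteq> 0" for s s' t t' :: real
  proof -
    have "s' - s \<noteq> 0" "t - s \<noteq> 0" "t' - s \<noteq> 0"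
      using that by auto
    with that show ?thesis
      by (simp add: divide_simps) (simp add: algebra_simps)
  qed
  have R: "R x l1 = log_ratio i i' b b' x" "R x l3 = log_ratio i i' c c' x" "R x l2 = \<sigma> * log_ratio b b' c c' x"
    using l by (auto simp: R_def)
  have wb': "u b' x = ?r1 * wb + u i' x" and wc': "u c' x = ?r3 * wc + u i' x"
    unfolding R exp_log_ratio[OF nc(1)[OF x]] exp_log_ratio[OF nc(2)[OF x]] wb_def wc_def u_def
    using ratio[of "x $ i" "x $ i'" "x $ b" "x $ b'"] ratio[of "x $ i" "x $ i'" "x $ c" "x $ c'"] ne6 by simp_all
  have diff_u: "u p x - u q x = (x $ q - x $ p) * u p x * u q x" if "p \<noteq> i" "q \<noteq> i" for p q
  proof -
    have "x $ p - x $ i \<noteq> 0" "x $ q - x $ i \<noteq> 0"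
      using ne[OF x] that by simp_all
    then show ?thesis
      by (simp add: u_def divide_simps)
  qed
  \<comment> \<open>The cross-ratio of the two other links, computed at these four points. Expanding
    it, with \<open>?r2\<close> the exponential of the logarithm times \<sigma>, gives the quadratic
    relation that cancels \<open>G\<close>.\<close>
  have X: "(wb - wc) * (?r1 * wb - ?r3 * wc) = exp (log_ratio b b' c c' x) * ((wb - ?r3 * wc) * (?r1 * wb - wc))"
  proof -
    have "wb - wc = (x $ c - x $ b) * u b x * u c x" "?r1 * wb - ?r3 * wc = (x $ c' - x $ b') * u b' x * u c' x"
      "wb - ?r3 * wc = (x $ c' - x $ b) * u b x * u c' x" "?r1 * wb - wc = (x $ c - x $ b') * u b' x * u c x"
      using diff_u[of b c] diff_u[of b' c'] diff_u[of b c'] diff_u[of b' c] dist wb' wc'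
      by (simp_all add: ni wb_def wc_def)
    then show ?thesis
      unfolding exp_log_ratio[OF nc(3)[OF x]] using ne6 by (simp add: divide_simps) (simp add: algebra_simps)
  qed
  define K where "K = (if \<sigma> = 1 then ?r2 * (1 + ?r1 * ?r3) - (?r1 + ?r3) else ?r2 * (?r1 + ?r3) - (1 + ?r1 * ?r3))"
  have rel: "(1 - ?r2) * (?r1 * wb\<^sup>2 + ?r3 * wc\<^sup>2) + wb * wc * K = 0"
    using eq2
  proof (elim disjE conjE)
    assume \<sigma>: "\<sigma> = 1"
    then show ?thesis
      using X unfolding K_def R(3) by (simp add: algebra_simps power2_eq_square)
  next
    assume \<sigma>: "\<sigma> = - 1"
    then have "?r2 * ((wb - wc) * (?r1 * wb - ?r3 * wc)) = (wb - ?r3 * wc) * (?r1 * wb - wc)"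
      unfolding R(3) X by (simp add: exp_minus)
    then show ?thesis
      using \<sigma> unfolding K_def by (simp add: algebra_simps power2_eq_square)
  qed
  have r_nth: "r x $ l = exp (R x l)" for l
    by (simp add: r_def)
  have perm: "{l2, l3, l1} = UNIV" "{l2, l1, l3} = UNIV" "{l1, l3, l2} = UNIV" "{l3, l1, l2} = UNIV"
    unfolding UNIV3 by auto
  have e1: "?r1 * (1 - ?r1) * ?F11 + (2 * \<beta> - 2 * ?r1) * ?F1 - \<beta> * (1 - \<beta>) * F (r x) = (1 - ?r2) * (1 - ?r3) * G (r x)"
    and e3: "?r3 * (1 - ?r3) * ?F33 + (2 * \<beta> - 2 * ?r3) * ?F3 - \<beta> * (1 - \<beta>) * F (r x) = (1 - ?r2) * (1 - ?r1) * G (r x)"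
    using eq1[unfolded hypergeo_eqs_def, rule_format, OF perm(1) r_box[OF x]]
      eq1[unfolded hypergeo_eqs_def, rule_format, OF perm(2) r_box[OF x]] by (simp_all add: r_nth)
  \<comment> \<open>The average of the equations for (\<open>l1\<close>, \<open>l3\<close>) and
    (\<open>l3\<close>, \<open>l1\<close>), in which both orders of the mixed derivative occur, as
    in the expansion of the second derivative of \<open>Z\<close>.\<close>
  have e2: "?r1 * ?r3 * (?F13 + ?F31) + \<beta> * ?r1 * ?F1 + \<beta> * ?r3 * ?F3 - \<beta> * \<sigma> * ?r2 * ?F2
      + (1 - \<sigma>) / 2 * \<beta>\<^sup>2 * F (r x) = K * G (r x)"
    using eq2
  proof (elim disjE conjE)
    assume \<sigma>: "\<sigma> = 1" and rb: "rainbow_eqs \<beta> F G"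
    show ?thesis
      using rb[unfolded rainbow_eqs_def, rule_format, OF perm(3) r_box[OF x]]
        rb[unfolded rainbow_eqs_def, rule_format, OF perm(4) r_box[OF x]]
      unfolding K_def \<sigma> by (simp add: r_nth algebra_simps)
  next
    assume \<sigma>: "\<sigma> = - 1" and nb: "neighbor_eqs \<beta> F G"
    show ?thesis
      using nb[unfolded neighbor_eqs_def, rule_format, OF perm(3) r_box[OF x]]
        nb[unfolded neighbor_eqs_def, rule_format, OF perm(4) r_box[OF x]]
      unfolding K_def \<sigma> by (simp add: r_nth algebra_simps)
  qed
  let ?S = "((M x)\<^sup>2 + m1) * F (r x)
      + 2 * M x * (P x * ?r1 * ?F1 + Q x * ?r3 * ?F3)
      + P x * ?r1 * (?r1 * P x * ?F11 + ?r3 * Q x * ?F31 + P x * ?F1) + p1 * ?r1 * ?F1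
      + Q x * ?r3 * (?r1 * P x * ?F13 + ?r3 * Q x * ?F33 + Q x * ?F3) + q1 * ?r3 * ?F3"
  let ?T = "dM x V * F (r x) + d1 x V * ?r1 * ?F1 + d2 x V * ?r2 * ?F2 + d3 x V * ?r3 * ?F3
      - 2 * h * ((u i' x)\<^sup>2 + (u b x)\<^sup>2 + (u b' x)\<^sup>2 + (u c x)\<^sup>2 + (u c' x)\<^sup>2) * F (r x)"
  have "?S + \<beta> / 2 * ?T = 0"
  proof (rule reduced_identity[OF e1 e3 e2 rel h])
    show "P x = - wb * (1 - ?r1)" "Q x = - wc * (1 - ?r3)"
      unfolding P_def Q_def wb' wc' by (simp_all add: wb_def wc_def algebra_simps)
    show "p1 = P x * (wb * (1 + ?r1) + 2 * u i' x)" "q1 = Q x * (wc * (1 + ?r3) + 2 * u i' x)"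
      unfolding p1_def q1_def P_def Q_def wb' wc' by (simp_all add: wb_def wc_def algebra_simps power2_eq_square)
    show "d1 x V = - 2 * P x * (wb * (1 + ?r1) + 3 * u i' x)" "d3 x V = - 2 * Q x * (wc * (1 + ?r3) + 3 * u i' x)"
      unfolding d_V P_def Q_def wb' wc' by (simp_all add: wb_def wc_def algebra_simps power2_eq_square)
    show "dM x V = - 2 * h * (2 * (u i' x)\<^sup>2 - 2 * u b x * u b' x - 2 * u c x * u c' x)
        + \<beta> / 2 * (d1 x V + d2 x V + d3 x V)"
      unfolding d_V(4) by (simp add: algebra_simps)
  qed (use wb' wc' in \<open>simp_all add: M_def m1_def d_V(3) wb_def wc_def\<close>)
  moreover have "\<kappa> / 2 * partial_deriv i (partial_deriv i Z) x
      + (\<Sum>j\<in>UNIV - {i}. 2 / (x $ j - x $ i) * partial_deriv j Z x - 2 * h / (x $ j - x $ i)\<^sup>2 * Z x)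
      = C * exp (LM x) * (2 / \<beta>) * (?S + \<beta> / 2 * ?T)"
  proof -
    have Zx: "Z x = C * exp (LM x) * F (r x)"
      by (rule Zr[OF x])
    have "A * (2 / \<beta>) * (S + \<beta> / 2 * T) = \<kappa> / 2 * (A * S) + A * T" for A S T
      using \<beta> unfolding \<kappa> by (simp add: field_simps)
    then have "C * exp (LM x) * (2 / \<beta>) * (?S + \<beta> / 2 * ?T) = \<kappa> / 2 * (C * exp (LM x) * ?S) + C * exp (LM x) * ?T"
      by blast
    moreover have "dZ x V - 2 * h * ((u i' x)\<^sup>2 + (u b x)\<^sup>2 + (u b' x)\<^sup>2 + (u c x)\<^sup>2 + (u c' x)\<^sup>2) * Z x
        = C * exp (LM x) * ?T"
      unfolding dZ_def Zx by (simp add: algebra_simps)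
    ultimately show ?thesis
      unfolding sum_subtractf T pot ppZ pdW by simp
  qed
  ultimately show ?thesis
    by simp
qed

section \<open>Oriented links and conformal covariance\<close>

lemma log_ratio_swap:
  "log_ratio q p q' p' x = log_ratio p q p' q' x"
  "log_ratio p' q' p q x = log_ratio p q p' q' x"
  "log_ratio p q q' p' x = - log_ratio p q p' q' x"
  unfolding log_ratio_def
  by (simp_all add: abs_minus_commute)

text \<open>Reversing one of two links negates their \<open>log_ratio\<close>, reversing both
  preserves it. To meet the sign conditions of \<open>pde_at_index\<close> no link is reversed for
  \<sigma> = 1 and \<open>i = p\<close>, all three for \<sigma> = 1 and \<open>i = q\<close>, the
  two other links for \<sigma> = - 1 and \<open>i = p\<close>, and only the link of \<open>i\<close>
  for \<sigma> = - 1 and \<open>i = q\<close>. The two other links are always treated alike, which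
  leaves their mutual ratio unchanged.\<close>

lemma pde_at_link:
  fixes p q p' q' p'' q'' :: 6 and l1 l2 l3 :: 3 and Z :: "real ^ 6 \<Rightarrow> real" and F G :: "real ^ 3 \<Rightarrow> real"
  assumes dist: "distinct [p, q, p', q', p'', q'']" and l: "distinct [l1, l2, l3]"
    and "\<beta> > 0" "h = 3 * \<beta> / 4 - 1 / 2" "\<kappa> = 4 / \<beta>"
    and "smooth_on (box 0 1) F" "hypergeo_eqs \<beta> F G"
    and eq2: "\<sigma> = 1 \<and> rainbow_eqs \<beta> F G \<or> \<sigma> = - 1 \<and> neighbor_eqs \<beta> F G"
    and nc: "\<And>x. x \<in> chamber \<Longrightarrow> (x $ p - x $ p') * (x $ q - x $ q') * ((x $ p - x $ q') * (x $ q - x $ p')) > 0"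
      "\<And>x. x \<in> chamber \<Longrightarrow> (x $ p - x $ p'') * (x $ q - x $ q'') * ((x $ p - x $ q'') * (x $ q - x $ p'')) > 0"
      "\<And>x. x \<in> chamber \<Longrightarrow> (x $ p' - x $ p'') * (x $ q' - x $ q'') * ((x $ p' - x $ q'') * (x $ q' - x $ p'')) > 0"
    and neg: "\<And>x. x \<in> chamber \<Longrightarrow> \<sigma> * log_ratio p q p' q' x < 0"
      "\<And>x. x \<in> chamber \<Longrightarrow> \<sigma> * log_ratio p q p'' q'' x < 0"
      "\<And>x. x \<in> chamber \<Longrightarrow> \<sigma> * log_ratio p' q' p'' q'' x < 0"
    and Z: "\<And>x. x \<in> chamber \<Longrightarrow> Z x = C * exp (- 2 * h * (ln \<bar>x $ p - x $ q\<bar> + ln \<bar>x $ p' - x $ q'\<bar> + ln \<bar>x $ p'' - x $ q''\<bar>)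
        + \<beta> / 2 * (\<sigma> * log_ratio p q p' q' x + \<sigma> * log_ratio p q p'' q'' x + \<sigma> * log_ratio p' q' p'' q'' x))
        * F (\<chi> l. exp (if l = l1 then \<sigma> * log_ratio p q p' q' x else if l = l3 then \<sigma> * log_ratio p q p'' q'' x
              else \<sigma> * log_ratio p' q' p'' q'' x))"
    and x: "x \<in> chamber" and i: "i = p \<or> i = q"
  shows "\<kappa> / 2 * partial_deriv i (partial_deriv i Z) x
      + (\<Sum>j\<in>UNIV - {i}. 2 / (x $ j - x $ i) * partial_deriv j Z x
                          - 2 * h / (x $ j - x $ i)\<^sup>2 * Z x) = 0"
proof -
  note pde = pde_at_index[OF _ assms(2-8) _ _ _ _ _ _ _ x, where Z = Z and C = C]
  have nc': "(y $ p - y $ p') * (y $ q - y $ q') * ((y $ p - y $ q') * (y $ q - y $ p')) > 0"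
      "(y $ p - y $ q') * (y $ q - y $ p') * ((y $ p - y $ p') * (y $ q - y $ q')) > 0"
      "(y $ q - y $ p') * (y $ p - y $ q') * ((y $ q - y $ q') * (y $ p - y $ p')) > 0"
      "(y $ q - y $ q') * (y $ p - y $ p') * ((y $ q - y $ p') * (y $ p - y $ q')) > 0"
      "(y $ p - y $ p'') * (y $ q - y $ q'') * ((y $ p - y $ q'') * (y $ q - y $ p'')) > 0"
      "(y $ p - y $ q'') * (y $ q - y $ p'') * ((y $ p - y $ p'') * (y $ q - y $ q'')) > 0"
      "(y $ q - y $ p'') * (y $ p - y $ q'') * ((y $ q - y $ q'') * (y $ p - y $ p'')) > 0"
      "(y $ q - y $ q'') * (y $ p - y $ p'') * ((y $ q - y $ p'') * (y $ p - y $ q'')) > 0"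
      "(y $ p' - y $ p'') * (y $ q' - y $ q'') * ((y $ p' - y $ q'') * (y $ q' - y $ p'')) > 0"
      "(y $ q' - y $ q'') * (y $ p' - y $ p'') * ((y $ q' - y $ p'') * (y $ p' - y $ q'')) > 0"
    if "y \<in> chamber" for y
    using nc(1)[OF that] nc(2)[OF that] nc(3)[OF that] by (simp_all add: ac_simps)
  have Z': "Z y = C * exp (- 2 * h * (ln \<bar>y $ s - y $ t\<bar> + ln \<bar>y $ s' - y $ t'\<bar> + ln \<bar>y $ s'' - y $ t''\<bar>)
        + \<beta> / 2 * (log_ratio s t u u' y + log_ratio s t v v' y + \<sigma> * log_ratio u u' v v' y))
        * F (\<chi> l. exp (if l = l1 then log_ratio s t u u' y else if l = l3 then log_ratio s t v v' y
              else \<sigma> * log_ratio u u' v v' y))"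
    if "y \<in> chamber" "{s, t} = {p, q}" "{s', t'} = {p', q'}" "{s'', t''} = {p'', q''}"
      "log_ratio s t u u' y = \<sigma> * log_ratio p q p' q' y" "log_ratio s t v v' y = \<sigma> * log_ratio p q p'' q'' y"
      "log_ratio u u' v v' y = log_ratio p' q' p'' q'' y" for y s t s' t' s'' t'' u u' v v'
  proof -
    have "\<bar>y $ s - y $ t\<bar> = \<bar>y $ p - y $ q\<bar>" "\<bar>y $ s' - y $ t'\<bar> = \<bar>y $ p' - y $ q'\<bar>"
      "\<bar>y $ s'' - y $ t''\<bar> = \<bar>y $ p'' - y $ q''\<bar>"
      using that(2-4) by (auto simp: doubleton_eq_iff)
    then show ?thesis
      unfolding Z[OF that(1)] that(5-7) by simp
  qed
  have sw: "log_ratio q p q' p' y = log_ratio p q p' q' y" "log_ratio q p q'' p'' y = log_ratio p q p'' q'' y"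
      "log_ratio q' p' q'' p'' y = log_ratio p' q' p'' q'' y"
      "log_ratio p q q' p' y = - log_ratio p q p' q' y" "log_ratio p q q'' p'' y = - log_ratio p q p'' q'' y"
      "log_ratio q p p' q' y = - log_ratio p q p' q' y" "log_ratio q p p'' q'' y = - log_ratio p q p'' q'' y" for y
    by (simp_all add: log_ratio_def abs_minus_commute)
  consider "\<sigma> = 1" "i = p" | "\<sigma> = 1" "i = q" | "\<sigma> = - 1" "i = p" | "\<sigma> = - 1" "i = q"
    using eq2 i by blast
  then show ?thesis
  proof cases
    case 1
    show ?thesis
      unfolding 1(2) by (rule pde[of p q p' q' p'' q'']; (rule Z')?)
        (use dist nc' neg in \<open>auto simp: 1(1) sw\<close>)
  next
    case 2
    show ?thesis
      unfolding 2(2) by (rule pde[of q p q' p' q'' p'']; (rule Z')?)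
        (use dist nc' neg in \<open>auto simp: 2(1) sw\<close>)
  next
    case 3
    show ?thesis
      unfolding 3(2) by (rule pde[of p q q' p' q'' p'']; (rule Z')?)
        (use dist nc' neg in \<open>auto simp: 3(1) sw\<close>)
  next
    case 4
    show ?thesis
      unfolding 4(2) by (rule pde[of q p p' q' p'' q'']; (rule Z')?)
        (use dist nc' neg in \<open>auto simp: 4(1) sw\<close>)
  qed
qed

section \<open>Cross-ratios of oriented links and the exponential form of the partition
  function\<close>

lemma cross_ratio_oriented:
  fixes p q p' q' :: real
  assumes nc: "(p - p') * (q - q') * ((p - q') * (q - p')) > 0"
  defines "X \<equiv> (p - p') * (q - q') / ((p - q') * (q - p'))"
  shows "X > 0" "cross_ratio p q p' q' = min X (inverse X)"
    "(p - p') * (q - q') * ((p - q) * (p' - q')) < 0 \<Longrightarrow> X < 1"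
    "(p - p') * (q - q') * ((p - q) * (p' - q')) > 0 \<Longrightarrow> X > 1"
proof -
  define u w d where "u = (p - p') * (q - q')" and "w = (p - q') * (q - p')" and "d = (p - q) * (p' - q')"
  have w: "w = u - d" and uw: "u * w > 0" and X: "X = u / w"
    using nc by (simp_all add: u_def w_def d_def X_def algebra_simps)
  show X0: "X > 0"
    using uw unfolding X by (simp add: zero_less_divide_iff zero_less_mult_iff)
  have "cross_ratio p q p' q' = min (\<bar>u\<bar> / \<bar>w\<bar>) (\<bar>w\<bar> / \<bar>u\<bar>)"
    by (simp add: cross_ratio_def u_def w_def abs_mult)
  also have XX: "\<bar>u\<bar> / \<bar>w\<bar> = X"
    using X0 X by (simp flip: abs_divide)
  also have "\<bar>w\<bar> / \<bar>u\<bar> = inverse X"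
    unfolding XX[symmetric] by simp
  finally show "cross_ratio p q p' q' = min X (inverse X)" .
  \<comment> \<open>By the three-term identity \<open>w = u - d\<close>, the denominator
    \<open>w\<close> exceeds the numerator \<open>u\<close> in absolute value exactly when
    \<open>u\<close> and \<open>d\<close> have opposite signs; \<open>u\<close> and \<open>w\<close>
    have the same sign.\<close>
  show "X < 1" if "(p - p') * (q - q') * ((p - q) * (p' - q')) < 0"
    using that uw unfolding X w u_def[symmetric] d_def[symmetric]
    by (cases u "0::real" rule: linorder_cases) (auto simp: zero_less_mult_iff mult_less_0_iff divide_simps)
  show "X > 1" if "(p - p') * (q - q') * ((p - q) * (p' - q')) > 0"
    using that uw unfolding X w u_def[symmetric] d_def[symmetric]
    by (cases u "0::real" rule: linorder_cases) (auto simp: zero_less_mult_iff mult_less_0_iff divide_simps)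
qed

lemma sgn_coord_diff:
  assumes "(x :: real ^ 6) \<in> chamber" "j \<in> {1..6}" "k \<in> {1..6}"
  shows "sgn (coord x j - coord x k) = sgn (real j - real k)"
  using assms(1)[unfolded chamber_6, rule_format, of j k] assms(1)[unfolded chamber_6, rule_format, of k j] assms(2,3)
  by (cases j k rule: linorder_cases) auto

text \<open>
  The second condition says that the first quotient in the definition of \<open>cross_ratio\<close> is less than \<open>1\<close> if
  \<open>\<sigma> = 1\<close> and greater than \<open>1\<close> if \<open>\<sigma> = - 1\<close>.  The links of a rainbow pattern can be oriented so that all
  pairs have \<open>\<sigma> = 1\<close>, those of a neighbor pattern so that all pairs have \<open>\<sigma> = - 1\<close>.
\<close>

definition compat :: "real \<Rightarrow> nat \<Rightarrow> nat \<Rightarrow> nat \<Rightarrow> nat \<Rightarrow> bool"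
  where "compat \<sigma> p q p' q' \<longleftrightarrow>
    (real p - real p') * (real q - real q') * ((real p - real q') * (real q - real p')) > 0 \<and>
    \<sigma> * ((real p - real p') * (real q - real q') * ((real p - real q) * (real p' - real q'))) < 0"

definition oriented :: "real \<Rightarrow> (nat \<Rightarrow> nat) \<Rightarrow> (nat \<Rightarrow> nat) \<Rightarrow> bool"
  where "oriented \<sigma> a b \<longleftrightarrow> (\<forall>j\<in>{1..3}. a j \<in> {1..6} \<and> b j \<in> {1..6} \<and> a j \<noteq> b j) \<and>
    (\<forall>j\<in>{1..3}. \<forall>k\<in>{1..3}. j \<noteq> k \<longrightarrow> compat \<sigma> (a j) (b j) (a k) (b k))"

lemma link_cross_ratio_oriented:
  assumes "oriented \<sigma> a b" "\<sigma> = 1 \<or> \<sigma> = - 1" "x \<in> chamber" "j \<in> {1..3}" "k \<in> {1..3}" "j \<noteq> k"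
  defines "L \<equiv> log_ratio (of_nat (a j)) (of_nat (b j)) (of_nat (a k)) (of_nat (b k)) (x :: real ^ 6)"
  shows "(coord x (a j) - coord x (a k)) * (coord x (b j) - coord x (b k)) *
      ((coord x (a j) - coord x (b k)) * (coord x (b j) - coord x (a k))) > 0"
    "link_cross_ratio a b x j k = exp (\<sigma> * L)" "\<sigma> * L < 0"
proof -
  have lab: "a j \<in> {1..6}" "b j \<in> {1..6}" "a k \<in> {1..6}" "b k \<in> {1..6}" and "compat \<sigma> (a j) (b j) (a k) (b k)"
    using assms(1,4-6) unfolding oriented_def by auto
  then have c: "(real (a j) - real (a k)) * (real (b j) - real (b k)) * ((real (a j) - real (b k)) * (real (b j) - real (a k))) > 0"
    "\<sigma> * ((real (a j) - real (a k)) * (real (b j) - real (b k)) * ((real (a j) - real (b j)) * (real (a k) - real (b k)))) < 0"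
    by (auto simp: compat_def)
  \<comment> \<open>Both conditions are signs of products of differences. As \<open>sgn\<close> is
    multiplicative, they pass factor by factor from the labels to the coordinates.\<close>
  have pos: "0 < t \<longleftrightarrow> sgn t = 1" and neg: "t < 0 \<longleftrightarrow> sgn t = - 1" for t :: real
    by (auto simp: sgn_if)
  note sg = sgn_coord_diff[OF assms(3)]
  show nc: "(coord x (a j) - coord x (a k)) * (coord x (b j) - coord x (b k)) *
      ((coord x (a j) - coord x (b k)) * (coord x (b j) - coord x (a k))) > 0"
    using c(1) lab unfolding pos by (simp add: sgn_mult sg del: atLeastAtMost_iff)
  have d: "\<sigma> * ((coord x (a j) - coord x (a k)) * (coord x (b j) - coord x (b k)) *
      ((coord x (a j) - coord x (b j)) * (coord x (a k) - coord x (b k)))) < 0"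
    using c(2) lab unfolding neg by (simp add: sgn_mult sg del: atLeastAtMost_iff)
  define X where "X = (coord x (a j) - coord x (a k)) * (coord x (b j) - coord x (b k)) /
      ((coord x (a j) - coord x (b k)) * (coord x (b j) - coord x (a k)))"
  have X: "exp L = X"
    unfolding L_def X_def coord_def using nc by (intro exp_log_ratio) (simp add: coord_def)
  note cr = cross_ratio_oriented[OF nc, folded X_def]
  have "link_cross_ratio a b x j k = exp (\<sigma> * L) \<and> \<sigma> * L < 0"
    using assms(2)
  proof
    assume \<sigma>: "\<sigma> = 1"
    then have "X < 1"
      using d by (intro cr(3)) simp
    then show ?thesis
      using cr(1,2) X \<sigma> unfolding link_cross_ratio_def
      by (metis exp_less_one_iff less_eq_real_def min_def mult_1 one_le_inverse order_trans)
  next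
    assume \<sigma>: "\<sigma> = - 1"
    then have "X > 1"
      using d by (intro cr(4)) simp
    then have "link_cross_ratio a b x j k = inverse X" "exp L > 1"
      using cr(1,2) X unfolding link_cross_ratio_def
      by (simp_all add: min_def inverse_less_1_iff) (smt (verit) inverse_less_1_iff)
    then have "0 < L \<and> link_cross_ratio a b x j k = inverse (exp L)"
      using X by (metis one_less_exp_iff)
    then show ?thesis
      using \<sigma> by (simp add: exp_minus)
  qed
  then show "link_cross_ratio a b x j k = exp (\<sigma> * L)" "\<sigma> * L < 0"
    by simp_all
qed

lemma oriented_labels:
  assumes "oriented \<sigma> a b" "j \<in> {1..3}"
  shows "a j \<in> {1..6}" "b j \<in> {1..6}" "a j \<noteq> b j"
  using assms by (auto simp: oriented_def)

lemma atLeastAtMost_1_3: "{1..3::nat} = {1, 2, 3}"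
  by auto

lemma ball_1_3: "(\<forall>j\<in>{1..3::nat}. P j) \<longleftrightarrow> P 1 \<and> P 2 \<and> P 3"
  unfolding atLeastAtMost_1_3 by simp

lemma oriented_distinct:
  assumes "oriented \<sigma> a b"
  shows "distinct [a 1, b 1, a 2, b 2, a 3, b 3]"
    and "distinct [of_nat (a 1), of_nat (b 1), of_nat (a 2), of_nat (b 2), of_nat (a 3), of_nat (b 3) :: 6]"
proof -
  have "compat \<sigma> (a 1) (b 1) (a 2) (b 2)" "compat \<sigma> (a 1) (b 1) (a 3) (b 3)" "compat \<sigma> (a 2) (b 2) (a 3) (b 3)"
    using assms unfolding oriented_def ball_1_3 by simp_all
  moreover have "p \<noteq> p' \<and> q \<noteq> q' \<and> p \<noteq> q' \<and> q \<noteq> p' \<and> p \<noteq> q \<and> p' \<noteq> q'" if "compat \<sigma> p q p' q'" for p q p' q'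
    using that unfolding compat_def by auto
  ultimately show d: "distinct [a 1, b 1, a 2, b 2, a 3, b 3]"
    by simp
  have "set [a 1, b 1, a 2, b 2, a 3, b 3] \<subseteq> {1..6}"
    using oriented_labels[OF assms] unfolding atLeastAtMost_1_3 by auto
  then have "inj_on (of_nat :: nat \<Rightarrow> 6) (set [a 1, b 1, a 2, b 2, a 3, b 3])"
    using inj_on_of_nat_6 inj_on_subset by blast
  with d have "distinct (map (of_nat :: nat \<Rightarrow> 6) [a 1, b 1, a 2, b 2, a 3, b 3])"
    unfolding distinct_map by blast
  then show "distinct [of_nat (a 1), of_nat (b 1), of_nat (a 2), of_nat (b 2), of_nat (a 3), of_nat (b 3) :: 6]"
    by simp
qed

text \<open>Once the \<open>min\<close> is resolved, all powers merge into one exponential of a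
  combination of logarithms of differences. This form is the one to differentiate, and it shows that
  every factor other than \<open>c\<close> and \<open>F\<close> is positive.\<close>

lemma pf3_oriented:
  assumes or: "oriented \<sigma> a b" "\<sigma> = 1 \<or> \<sigma> = - 1" and "x \<in> chamber"
  defines "A \<equiv> \<lambda>j. of_nat (a j) :: 6" and "B \<equiv> \<lambda>j. of_nat (b j) :: 6"
  shows "pf3 \<kappa> h c F a b x = c * exp (- 2 * h * (ln \<bar>x $ A 1 - x $ B 1\<bar> + ln \<bar>x $ A 2 - x $ B 2\<bar> + ln \<bar>x $ A 3 - x $ B 3\<bar>)
        + 2 / \<kappa> * (\<sigma> * log_ratio (A 1) (B 1) (A 2) (B 2) x + \<sigma> * log_ratio (A 2) (B 2) (A 3) (B 3) x
          + \<sigma> * log_ratio (A 3) (B 3) (A 1) (B 1) x))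
        * F (\<chi> l. exp (if l = 1 then \<sigma> * log_ratio (A 1) (B 1) (A 2) (B 2) x
            else if l = 2 then \<sigma> * log_ratio (A 2) (B 2) (A 3) (B 3) x else \<sigma> * log_ratio (A 3) (B 3) (A 1) (B 1) x))"
proof -
  have r: "link_cross_ratio a b x j k = exp (\<sigma> * log_ratio (A j) (B j) (A k) (B k) x)"
    if "j \<in> {1..3}" "k \<in> {1..3}" "j \<noteq> k" for j k
    unfolding A_def B_def by (rule link_cross_ratio_oriented(2)[OF or assms(3) that])
  have "\<bar>coord x (a j) - coord x (b j)\<bar> powr (- 2 * h) = exp (- 2 * h * ln \<bar>x $ A j - x $ B j\<bar>)" if "j \<in> {1..3}" for j
  proof -
    have "coord x (a j) \<noteq> coord x (b j)"
      using chamber_coord_neq[OF assms(3)] oriented_labels[OF or(1) that] by blast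
    then show ?thesis
      by (simp add: powr_def coord_def A_def B_def)
  qed
  then have prod: "(\<Prod>j\<in>{1..3}. \<bar>coord x (a j) - coord x (b j)\<bar> powr (- 2 * h)) =
      exp (- 2 * h * (ln \<bar>x $ A 1 - x $ B 1\<bar> + ln \<bar>x $ A 2 - x $ B 2\<bar> + ln \<bar>x $ A 3 - x $ B 3\<bar>))"
    unfolding atLeastAtMost_1_3 by (simp add: algebra_simps flip: exp_add)
  define v :: "real ^ 3" where "v = vector [link_cross_ratio a b x 1 2, link_cross_ratio a b x 2 3, link_cross_ratio a b x 3 1]"
  have v: "v $ 1 = exp (\<sigma> * log_ratio (A 1) (B 1) (A 2) (B 2) x)"
    "v $ 2 = exp (\<sigma> * log_ratio (A 2) (B 2) (A 3) (B 3) x)"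
    "v $ 3 = exp (\<sigma> * log_ratio (A 3) (B 3) (A 1) (B 1) x)"
    unfolding v_def by (simp_all add: vector_3 r)
  have "v = (\<chi> l. exp (if l = 1 then \<sigma> * log_ratio (A 1) (B 1) (A 2) (B 2) x
            else if l = 2 then \<sigma> * log_ratio (A 2) (B 2) (A 3) (B 3) x else \<sigma> * log_ratio (A 3) (B 3) (A 1) (B 1) x))"
    unfolding vec_eq_iff forall_3 by (simp add: v)
  moreover have "(v $ 1 * v $ 2 * v $ 3) powr (2 / \<kappa>) = exp (2 / \<kappa> * (\<sigma> * log_ratio (A 1) (B 1) (A 2) (B 2) x
      + \<sigma> * log_ratio (A 2) (B 2) (A 3) (B 3) x + \<sigma> * log_ratio (A 3) (B 3) (A 1) (B 1) x))"
    unfolding v by (simp add: powr_def flip: exp_add)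
  ultimately show ?thesis
    unfolding pf3_def Let_def v_def[symmetric] prod exp_add by (simp add: mult.assoc)
qed

lemma smooth_on_pf3:
  assumes or: "oriented \<sigma> a b" "\<sigma> = 1 \<or> \<sigma> = - 1" and F: "smooth_on (box 0 1) F"
  shows "smooth_on chamber (pf3 \<kappa> h c F a b)"
  unfolding smooth_on_def
proof
  fix k
  define A B where "A j = (of_nat (a j) :: 6)" and "B j = (of_nat (b j) :: 6)" for j
  define \<rho> where "\<rho> j m x = \<sigma> * log_ratio (A j) (B j) (A m) (B m) x" for j m x
  have ne: "x $ p \<noteq> x $ q" if "x \<in> chamber" "p \<noteq> q" for x :: "real ^ 6" and p q
    using chamber_nth_neq[OF that] .
  have ln: "Ck_on k chamber (\<lambda>x :: real ^ 6. ln \<bar>x $ p - x $ q\<bar>)" if "p \<noteq> q" for p q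
    using that by (intro Ck_on_ln_abs_diff[OF open_chamber] ne)
  have diff: "Ck_on k chamber (\<lambda>x :: real ^ 6. f x - g x)" if "Ck_on k chamber f" "Ck_on k chamber g" for f g
    using Ck_on_add[OF open_chamber that(1) Ck_on_mult[OF open_chamber Ck_on_const[of _ _ "-1"] that(2)]] by simp
  have dist: "distinct [A 1, B 1, A 2, B 2, A 3, B 3]"
    using oriented_distinct(2)[OF or(1)] unfolding A_def B_def .
  have \<rho>: "Ck_on k chamber (\<rho> j m)" if "j \<in> {1..3}" "m \<in> {1..3}" "j \<noteq> m" for j m
  proof -
    have "A j \<noteq> A m" "B j \<noteq> B m" "A j \<noteq> B m" "B j \<noteq> A m"
      using dist that unfolding atLeastAtMost_1_3 by auto
    then show ?thesis
      unfolding \<rho>_def[abs_def] log_ratio_def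
      by (intro Ck_on_mult[OF open_chamber] Ck_on_const diff Ck_on_add[OF open_chamber] ln)
  qed
  define r :: "real ^ 6 \<Rightarrow> real ^ 3" where
    "r x = (\<chi> l. exp (if l = 1 then \<rho> 1 2 x else if l = 2 then \<rho> 2 3 x else \<rho> 3 1 x))" for x
  have rk: "Ck_on k chamber (\<lambda>x. r x $ l)" for l
    using Ck_on_exp[OF open_chamber \<rho>[of 1 2]] Ck_on_exp[OF open_chamber \<rho>[of 2 3]] Ck_on_exp[OF open_chamber \<rho>[of 3 1]]
    by (cases "l = 1"; cases "l = 2") (simp_all add: r_def)
  have "r x \<in> box 0 1" if "x \<in> chamber" for x
    using link_cross_ratio_oriented(3)[OF or that, of 1 2] link_cross_ratio_oriented(3)[OF or that, of 2 3]
      link_cross_ratio_oriented(3)[OF or that, of 3 1]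
    by (auto simp: mem_box_cart r_def \<rho>_def A_def B_def)
  then have Fr: "Ck_on k chamber (\<lambda>x. F (r x))"
    by (rule Ck_on_compose[OF open_chamber rk]) (use F in \<open>auto simp: smooth_on_def\<close>)
  have "Ck_on k chamber (\<lambda>x. c * exp (- 2 * h * (ln \<bar>x $ A 1 - x $ B 1\<bar> + ln \<bar>x $ A 2 - x $ B 2\<bar> + ln \<bar>x $ A 3 - x $ B 3\<bar>)
        + 2 / \<kappa> * (\<rho> 1 2 x + \<rho> 2 3 x + \<rho> 3 1 x)) * F (r x))"
    using dist by (intro Ck_on_mult[OF open_chamber] Ck_on_exp[OF open_chamber] Ck_on_add[OF open_chamber] Ck_on_const ln \<rho> Fr) auto
  then show "Ck_on k chamber (pf3 \<kappa> h c F a b)"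
    by (rule Ck_on_cong[OF open_chamber, rotated])
      (simp only: pf3_oriented[OF or] r_def \<rho>_def A_def B_def)
qed

lemma UNIV_6_oriented:
  assumes "oriented \<sigma> a b"
  shows "(UNIV :: 6 set) = {of_nat (a 1), of_nat (b 1), of_nat (a 2), of_nat (b 2), of_nat (a 3), of_nat (b 3)}"
  using oriented_distinct(2)[OF assms] by (intro card_subset_eq[symmetric]) auto

text \<open>Each link in turn takes the first place in \<open>pde_at_link\<close>. The cross-ratios
  are listed in the cyclic order 12, 23, 31, so the positions \<open>l1\<close>, \<open>l2\<close>,
  \<open>l3\<close> rotate along with the links.\<close>

lemma satisfies_PDE_pf3:
  assumes or: "oriented \<sigma> a b" and \<sigma>: "\<sigma> = 1 \<or> \<sigma> = - 1"
    and \<kappa>: "0 < \<kappa>" and \<beta>: "\<beta> = 4 / \<kappa>" and h: "h = (6 - \<kappa>) / (2 * \<kappa>)"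
    and F: "smooth_on (box 0 1) F" and eq1: "hypergeo_eqs \<beta> F G"
    and eq2: "\<sigma> = 1 \<and> rainbow_eqs \<beta> F G \<or> \<sigma> = - 1 \<and> neighbor_eqs \<beta> F G"
  shows "satisfies_PDE \<kappa> h (pf3 \<kappa> h c F a b)"
  unfolding satisfies_PDE_def
proof (intro ballI allI)
  fix x :: "real ^ 6" and i :: 6
  assume x: "x \<in> chamber"
  define A B where "A j = (of_nat (a j) :: 6)" and "B j = (of_nat (b j) :: 6)" for j
  have par: "\<beta> > 0" "h = 3 * \<beta> / 4 - 1 / 2" "\<kappa> = 4 / \<beta>"
    using \<kappa> unfolding h \<beta> by (simp_all add: field_simps)
  have dist: "distinct [A 1, B 1, A 2, B 2, A 3, B 3]"
    using oriented_distinct(2)[OF or] unfolding A_def B_def .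
  note lcr = link_cross_ratio_oriented[OF or \<sigma>]
  have nc: "(y $ A j - y $ A k) * (y $ B j - y $ B k) * ((y $ A j - y $ B k) * (y $ B j - y $ A k)) > 0"
    and neg: "\<sigma> * log_ratio (A j) (B j) (A k) (B k) y < 0"
    if "j \<in> {1..3}" "k \<in> {1..3}" "j \<noteq> k" "y \<in> chamber" for j k y
    using lcr(1)[OF that(4,1-3)] lcr(3)[OF that(4,1-3)] unfolding A_def B_def coord_def .
  have sw: "log_ratio (A 3) (B 3) (A 1) (B 1) y = log_ratio (A 1) (B 1) (A 3) (B 3) y"
    "log_ratio (A 2) (B 2) (A 1) (B 1) y = log_ratio (A 1) (B 1) (A 2) (B 2) y"
    "log_ratio (A 3) (B 3) (A 2) (B 2) y = log_ratio (A 2) (B 2) (A 3) (B 3) y" for y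
    by (rule log_ratio_swap(2))+
  note Z = pf3_oriented[OF or \<sigma>, where \<kappa> = \<kappa>, folded A_def B_def]
  have "2 / \<kappa> = \<beta> / 2"
    using \<beta> by simp
  note Z' = Z[unfolded this]
  have "i \<in> {A 1, B 1, A 2, B 2, A 3, B 3}"
    using UNIV_6_oriented[OF or] unfolding A_def B_def by blast
  then consider "i = A 1 \<or> i = B 1" | "i = A 2 \<or> i = B 2" | "i = A 3 \<or> i = B 3"
    by blast
  then show "\<kappa> / 2 * partial_deriv i (partial_deriv i (pf3 \<kappa> h c F a b)) x
      + (\<Sum>j\<in>UNIV - {i}. 2 / (x $ j - x $ i) * partial_deriv j (pf3 \<kappa> h c F a b) x
                          - 2 * h / (x $ j - x $ i)\<^sup>2 * pf3 \<kappa> h c F a b x) = 0"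
  proof cases
    case 1
    have Z1: "pf3 \<kappa> h c F a b y = c * exp (- 2 * h * (ln \<bar>y $ A 1 - y $ B 1\<bar> + ln \<bar>y $ A 2 - y $ B 2\<bar> + ln \<bar>y $ A 3 - y $ B 3\<bar>)
        + \<beta> / 2 * (\<sigma> * log_ratio (A 1) (B 1) (A 2) (B 2) y + \<sigma> * log_ratio (A 1) (B 1) (A 3) (B 3) y + \<sigma> * log_ratio (A 2) (B 2) (A 3) (B 3) y))
        * F (\<chi> l. exp (if l = 1 then \<sigma> * log_ratio (A 1) (B 1) (A 2) (B 2) y
            else if l = 3 then \<sigma> * log_ratio (A 1) (B 1) (A 3) (B 3) y else \<sigma> * log_ratio (A 2) (B 2) (A 3) (B 3) y))"
      if "y \<in> chamber" for y
    proof -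
      have "(\<chi> l. exp (if l = 1 then \<sigma> * log_ratio (A 1) (B 1) (A 2) (B 2) y
            else if l = 2 then \<sigma> * log_ratio (A 2) (B 2) (A 3) (B 3) y else \<sigma> * log_ratio (A 3) (B 3) (A 1) (B 1) y))
        = ((\<chi> l. exp (if l = 1 then \<sigma> * log_ratio (A 1) (B 1) (A 2) (B 2) y
            else if l = 3 then \<sigma> * log_ratio (A 1) (B 1) (A 3) (B 3) y else \<sigma> * log_ratio (A 2) (B 2) (A 3) (B 3) y)) :: real ^ 3)"
        by (simp add: vec_eq_iff forall_3 sw del: One_nat_def)
      then show ?thesis
        unfolding Z'[OF that] by (simp only: sw ac_simps)
    qed
    show ?thesis
      by (rule pde_at_link[of "A 1" "B 1" "A 2" "B 2" "A 3" "B 3" 1 2 3, OF _ _ par F eq1 eq2 _ _ _ _ _ _ Z1 x 1])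
        (use dist nc neg in auto)
  next
    case 2
    have Z1: "pf3 \<kappa> h c F a b y = c * exp (- 2 * h * (ln \<bar>y $ A 2 - y $ B 2\<bar> + ln \<bar>y $ A 3 - y $ B 3\<bar> + ln \<bar>y $ A 1 - y $ B 1\<bar>)
        + \<beta> / 2 * (\<sigma> * log_ratio (A 2) (B 2) (A 3) (B 3) y + \<sigma> * log_ratio (A 2) (B 2) (A 1) (B 1) y + \<sigma> * log_ratio (A 3) (B 3) (A 1) (B 1) y))
        * F (\<chi> l. exp (if l = 2 then \<sigma> * log_ratio (A 2) (B 2) (A 3) (B 3) y
            else if l = 1 then \<sigma> * log_ratio (A 2) (B 2) (A 1) (B 1) y else \<sigma> * log_ratio (A 3) (B 3) (A 1) (B 1) y))"
      if "y \<in> chamber" for y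
    proof -
      have "(\<chi> l. exp (if l = 1 then \<sigma> * log_ratio (A 1) (B 1) (A 2) (B 2) y
            else if l = 2 then \<sigma> * log_ratio (A 2) (B 2) (A 3) (B 3) y else \<sigma> * log_ratio (A 3) (B 3) (A 1) (B 1) y))
        = ((\<chi> l. exp (if l = 2 then \<sigma> * log_ratio (A 2) (B 2) (A 3) (B 3) y
            else if l = 1 then \<sigma> * log_ratio (A 2) (B 2) (A 1) (B 1) y else \<sigma> * log_ratio (A 3) (B 3) (A 1) (B 1) y)) :: real ^ 3)"
        by (simp add: vec_eq_iff forall_3 sw del: One_nat_def)
      then show ?thesis
        unfolding Z'[OF that] by (simp only: sw ac_simps)
    qed
    show ?thesis
      by (rule pde_at_link[of "A 2" "B 2" "A 3" "B 3" "A 1" "B 1" 2 3 1, OF _ _ par F eq1 eq2 _ _ _ _ _ _ Z1 x 2])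
        (use dist nc neg in auto)
  next
    case 3
    have Z1: "pf3 \<kappa> h c F a b y = c * exp (- 2 * h * (ln \<bar>y $ A 3 - y $ B 3\<bar> + ln \<bar>y $ A 1 - y $ B 1\<bar> + ln \<bar>y $ A 2 - y $ B 2\<bar>)
        + \<beta> / 2 * (\<sigma> * log_ratio (A 3) (B 3) (A 1) (B 1) y + \<sigma> * log_ratio (A 3) (B 3) (A 2) (B 2) y + \<sigma> * log_ratio (A 1) (B 1) (A 2) (B 2) y))
        * F (\<chi> l. exp (if l = 3 then \<sigma> * log_ratio (A 3) (B 3) (A 1) (B 1) y
            else if l = 2 then \<sigma> * log_ratio (A 3) (B 3) (A 2) (B 2) y else \<sigma> * log_ratio (A 1) (B 1) (A 2) (B 2) y))"
      if "y \<in> chamber" for y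
    proof -
      have "(\<chi> l. exp (if l = 1 then \<sigma> * log_ratio (A 1) (B 1) (A 2) (B 2) y
            else if l = 2 then \<sigma> * log_ratio (A 2) (B 2) (A 3) (B 3) y else \<sigma> * log_ratio (A 3) (B 3) (A 1) (B 1) y))
        = ((\<chi> l. exp (if l = 3 then \<sigma> * log_ratio (A 3) (B 3) (A 1) (B 1) y
            else if l = 2 then \<sigma> * log_ratio (A 3) (B 3) (A 2) (B 2) y else \<sigma> * log_ratio (A 1) (B 1) (A 2) (B 2) y)) :: real ^ 3)"
        by (simp add: vec_eq_iff forall_3 sw del: One_nat_def)
      then show ?thesis
        unfolding Z'[OF that] by (simp only: sw ac_simps)
    qed
    show ?thesis
      by (rule pde_at_link[of "A 3" "B 3" "A 1" "B 1" "A 2" "B 2" 3 1 2, OF _ _ par F eq1 eq2 _ _ _ _ _ _ Z1 x 3])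
        (use dist nc neg in auto)
  qed
qed

section \<open>Covariance under Moebius maps\<close>

lemma moebius_diff:
  assumes "r * s + t \<noteq> 0" "r * s' + t \<noteq> 0"
  shows "moebius p q r t s - moebius p q r t s' = (p * t - q * r) * (s - s') / ((r * s + t) * (r * s' + t))"
  using assms by (simp add: moebius_def divide_simps) (simp add: algebra_simps)

lemma deriv_moebius:
  assumes "r * s + t \<noteq> 0"
  shows "deriv (moebius p q r t) s = (p * t - q * r) / (r * s + t)\<^sup>2"
proof (rule DERIV_imp_deriv)
  have "((\<lambda>s. (p * s + q) / (r * s + t)) has_field_derivative (p * t - q * r) / (r * s + t)\<^sup>2) (at s)"
    using assms by (auto intro!: derivative_eq_intros simp: power2_eq_square algebra_simps)
  then show "(moebius p q r t has_field_derivative (p * t - q * r) / (r * s + t)\<^sup>2) (at s)"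
    by (simp add: moebius_def[abs_def])
qed

lemma cross_ratio_moebius:
  assumes "p * t - q * r > 0" "r * u + t \<noteq> 0" "r * v + t \<noteq> 0" "r * u' + t \<noteq> 0" "r * v' + t \<noteq> 0"
  shows "cross_ratio (moebius p q r t u) (moebius p q r t v) (moebius p q r t u') (moebius p q r t v')
    = cross_ratio u v u' v'"
proof -
  define D where "D = p * t - q * r"
  define w where "w s = \<bar>r * s + t\<bar>" for s
  have D: "D > 0" and w: "w u > 0" "w v > 0" "w u' > 0" "w v' > 0"
    using assms by (simp_all add: D_def w_def)
  have d: "\<bar>moebius p q r t s - moebius p q r t s'\<bar> = D * \<bar>s - s'\<bar> / (w s * w s')"
    if "r * s + t \<noteq> 0" "r * s' + t \<noteq> 0" for s s'
    unfolding moebius_diff[OF that] using D by (simp add: D_def w_def abs_mult)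
  have "(D * x1 / (a1 * a3)) * (D * x2 / (a2 * a4)) / ((D * x3 / (a1 * a4)) * (D * x4 / (a2 * a3))) = x1 * x2 / (x3 * x4)"
    if "a1 > 0" "a2 > 0" "a3 > 0" "a4 > 0" for x1 x2 x3 x4 a1 a2 a3 a4 :: real
    using that D by (simp add: field_simps)
  from this[of "w u" "w v" "w u'" "w v'"] this[of "w u" "w v" "w v'" "w u'"] show ?thesis
    unfolding cross_ratio_def using assms w by (simp add: d)
qed

text \<open>The cross-ratios are invariant, so only the prefactor changes. For a Moebius map the
  squared distance of two image points is the squared distance of the points times the product of
  the two derivatives. Since the links exhaust the indices, the product of all derivatives splits
  into one such factor per link.\<close>

lemma satisfies_COV_pf3:
  assumes or: "oriented \<sigma> a b"
  shows "satisfies_COV h (pf3 \<kappa> h c F a b)"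
  unfolding satisfies_COV_def Let_def
proof (intro ballI allI impI)
  fix x :: "real ^ 6" and p q r s :: real
  assume x: "x \<in> chamber" and D: "p * s - q * r > 0" and nz: "\<forall>i. r * x $ i + s \<noteq> 0"
  define y :: "real ^ 6" where "y = (\<chi> i. moebius p q r s (x $ i))"
  have y: "coord y j = moebius p q r s (coord x j)" for j
    by (simp add: y_def coord_def)
  have nz': "r * coord x j + s \<noteq> 0" for j
    using nz by (simp add: coord_def)
  have cr: "link_cross_ratio a b y j k = link_cross_ratio a b x j k" for j k
    unfolding link_cross_ratio_def y by (intro cross_ratio_moebius D nz')
  define w where "w j = \<bar>r * coord x j + s\<bar>" for j
  have w: "w j > 0" for j
    using nz' by (simp add: w_def)
  define D' where "D' = p * s - q * r"
  have D': "D' > 0"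
    using D by (simp add: D'_def)
  have fac: "deriv (moebius p q r s) (coord x (a j)) powr h * deriv (moebius p q r s) (coord x (b j)) powr h
      * \<bar>coord y (a j) - coord y (b j)\<bar> powr (- 2 * h) = \<bar>coord x (a j) - coord x (b j)\<bar> powr (- 2 * h)"
    if "j \<in> {1..3}" for j
  proof -
    have "coord x (a j) \<noteq> coord x (b j)"
      using chamber_coord_neq[OF x] oriented_labels[OF or that] by blast
    then have d: "\<bar>coord x (a j) - coord x (b j)\<bar> > 0"
      by simp
    have der: "deriv (moebius p q r s) (coord x k) = D' / (w k)\<^sup>2" for k
      using deriv_moebius[OF nz'] by (simp add: D'_def w_def)
    have diff: "\<bar>coord y (a j) - coord y (b j)\<bar> = D' * \<bar>coord x (a j) - coord x (b j)\<bar> / (w (a j) * w (b j))"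
      unfolding y moebius_diff[OF nz' nz'] using D by (simp add: D'_def w_def abs_mult)
    have "ln (D' / (w k)\<^sup>2) = ln D' - 2 * ln (w k)" for k
      using D' w[of k] by (simp add: ln_div ln_realpow)
    moreover have "ln \<bar>coord y (a j) - coord y (b j)\<bar> = ln D' + ln \<bar>coord x (a j) - coord x (b j)\<bar> - (ln (w (a j)) + ln (w (b j)))"
      unfolding diff using D' d w[of "a j"] w[of "b j"] by (simp add: ln_div ln_mult)
    ultimately have exponents: "h * ln (D' / (w (a j))\<^sup>2) + h * ln (D' / (w (b j))\<^sup>2)
        + (- 2 * h) * ln \<bar>coord y (a j) - coord y (b j)\<bar> = (- 2 * h) * ln \<bar>coord x (a j) - coord x (b j)\<bar>"
      by (simp only:) (simp add: algebra_simps)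
    have powr: "t powr u = exp (u * ln t)" if "t > 0" for t u :: real
      using that by (simp add: powr_def)
    have "D' / (w k)\<^sup>2 > 0" for k
      using D' w[of k] by simp
    moreover have "\<bar>coord y (a j) - coord y (b j)\<bar> > 0"
      unfolding diff using D' d w by simp
    ultimately show ?thesis
      unfolding der using d by (simp only: powr exponents exp_add[symmetric])
  qed
  have "(\<Prod>i\<in>UNIV. deriv (moebius p q r s) (x $ i) powr h) =
      (\<Prod>j\<in>{1..3}. deriv (moebius p q r s) (coord x (a j)) powr h * deriv (moebius p q r s) (coord x (b j)) powr h)"
    unfolding UNIV_6_oriented[OF or] atLeastAtMost_1_3 using oriented_distinct(2)[OF or]
    by (simp add: coord_def mult.assoc)
  then have "(\<Prod>i\<in>UNIV. deriv (moebius p q r s) (x $ i) powr h) * (\<Prod>j\<in>{1..3}. \<bar>coord y (a j) - coord y (b j)\<bar> powr (- 2 * h))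
      = (\<Prod>j\<in>{1..3}. \<bar>coord x (a j) - coord x (b j)\<bar> powr (- 2 * h))"
    using fac by (simp add: prod.distrib[symmetric] del: atLeastAtMost_iff)
  then show "pf3 \<kappa> h c F a b x = (\<Prod>i\<in>UNIV. deriv (moebius p q r s) (x $ i) powr h)
      * pf3 \<kappa> h c F a b (\<chi> i. moebius p q r s (x $ i))"
    unfolding y_def[symmetric] pf3_def Let_def cr by (simp add: mult_ac)
qed

section \<open>Asymptotics\<close>

lemma cross_ratio_commute:
  "cross_ratio q p p' q' = cross_ratio p q p' q'"
  "cross_ratio p q q' p' = cross_ratio p q p' q'"
  "cross_ratio p' q' p q = cross_ratio p q p' q'"
  by (simp_all add: cross_ratio_def min.commute abs_minus_commute mult.commute)

lemma pf3_swap: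
  assumes "\<And>j. j \<in> {1..3} \<Longrightarrow> a' j = a j \<and> b' j = b j \<or> a' j = b j \<and> b' j = a j"
  shows "pf3 \<kappa> h c F a' b' = pf3 \<kappa> h c F a b"
proof
  fix x :: "real ^ 6"
  have "\<bar>coord x (a' j) - coord x (b' j)\<bar> = \<bar>coord x (a j) - coord x (b j)\<bar>" if "j \<in> {1..3}" for j
    using assms[OF that] by auto
  then have "(\<Prod>j\<in>{1..3}. \<bar>coord x (a' j) - coord x (b' j)\<bar> powr (- 2 * h)) =
      (\<Prod>j\<in>{1..3}. \<bar>coord x (a j) - coord x (b j)\<bar> powr (- 2 * h))"
    by (intro prod.cong) simp_all
  moreover have "link_cross_ratio a' b' x j k = link_cross_ratio a b x j k" if "j \<in> {1..3}" "k \<in> {1..3}" for j k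
    using assms[OF that(1)] assms[OF that(2)] unfolding link_cross_ratio_def
    by (elim disjE conjE) (simp_all only: cross_ratio_commute(1,2))
  ultimately show "pf3 \<kappa> h c F a' b' x = pf3 \<kappa> h c F a b x"
    unfolding pf3_def Let_def by simp
qed

text \<open>A labelling lists the links in any order and with any orientation. Reversing the links
  that disagree with a reference orientation preserves the order, and because \<open>compat\<close>
  is symmetric in the two links, the order does not affect the conditions.\<close>

lemma orientation_exists:
  assumes lab: "labelling 3 \<alpha> a b" and \<alpha>: "\<alpha> = {{p1, q1}, {p2, q2}, {p3, q3}}"
    and lbl: "{p1, q1, p2, q2, p3, q3} = {1..6}"
    and c: "compat \<sigma> p1 q1 p2 q2" "compat \<sigma> p2 q2 p3 q3" "compat \<sigma> p3 q3 p1 q1"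
  shows "\<exists>a' b'. (\<forall>j\<in>{1..3}. a' j = a j \<and> b' j = b j \<or> a' j = b j \<and> b' j = a j) \<and> oriented \<sigma> a' b'"
proof -
  have sym: "compat \<sigma> p' q' p q" if "compat \<sigma> p q p' q'" for p q p' q'
    using that unfolding compat_def by (simp add: algebra_simps)
  have neq: "p \<noteq> q" "p' \<noteq> q'" "p \<noteq> p'" "p \<noteq> q'" "q \<noteq> p'" "q \<noteq> q'" if "compat \<sigma> p q p' q'" for p q p' q'
    using that unfolding compat_def by auto
  define S where "S = {(p1, q1), (p2, q2), (p3, q3)}"
  have compat: "compat \<sigma> (fst s) (snd s) (fst t) (snd t)" if "s \<in> S" "t \<in> S" "s \<noteq> t" for s t
    using that c sym unfolding S_def by auto
  have S: "fst s \<in> {1..6}" "snd s \<in> {1..6}" "fst s \<noteq> snd s" if "s \<in> S" for s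
    using that lbl c[THEN neq(1)] unfolding S_def by auto
  define a' b' where "a' j = (if (a j, b j) \<in> S then a j else b j)"
    and "b' j = (if (a j, b j) \<in> S then b j else a j)" for j
  have sw: "a' j = a j \<and> b' j = b j \<or> a' j = b j \<and> b' j = a j" for j
    by (simp add: a'_def b'_def)
  have inS: "(a' j, b' j) \<in> S" if "j \<in> {1..3}" for j
  proof -
    have "{a j, b j} \<in> \<alpha>"
      using that lab unfolding labelling_def by blast
    then show ?thesis
      unfolding \<alpha> a'_def b'_def S_def by (auto simp: doubleton_eq_iff)
  qed
  \<comment> \<open>Since the pattern has three links, different indices of the labelling name
    different links, as the pairwise conditions require.\<close>
  have "card \<alpha> = 3"
    using neq[OF c(1)] neq[OF c(2)] neq[OF c(3)] unfolding \<alpha> by (auto simp: doubleton_eq_iff card_insert_if)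
  moreover have "\<alpha> = (\<lambda>j. {a' j, b' j}) ` {1..3}"
  proof -
    have "{a' j, b' j} = {a j, b j}" for j
      using sw[of j] by auto
    then show ?thesis
      using lab unfolding labelling_def by simp
  qed
  ultimately have inj: "inj_on (\<lambda>j. {a' j, b' j}) {1..3}"
    by (intro eq_card_imp_inj_on) simp_all
  have "compat \<sigma> (a' j) (b' j) (a' k) (b' k)" if "j \<in> {1..3}" "k \<in> {1..3}" "j \<noteq> k" for j k
    using compat[OF inS[OF that(1)] inS[OF that(2)]] inj_onD[OF inj _ that(1,2)] that(3) by fastforce
  moreover have "a' j \<in> {1..6} \<and> b' j \<in> {1..6} \<and> a' j \<noteq> b' j" if "j \<in> {1..3}" for j
    using S[OF inS[OF that]] by simp
  ultimately have "oriented \<sigma> a' b'"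
    unfolding oriented_def by blast
  with sw show ?thesis
    by blast
qed

lemma rainbow_orientation:
  assumes "labelling 3 \<alpha> a b" "\<alpha> \<in> rainbow_patterns"
  shows "\<exists>a' b'. (\<forall>j\<in>{1..3}. a' j = a j \<and> b' j = b j \<or> a' j = b j \<and> b' j = a j) \<and> oriented 1 a' b'"
proof -
  \<comment> \<open>Rewriting a pair displays the reference orientation, first end first. Nested
    links are directed alike, links side by side in opposite directions.\<close>
  have e: "{5, 6::nat} = {6, 5}" "{3, 6::nat} = {6, 3}" "{4, 5::nat} = {5, 4}"
    by blast+
  consider "\<alpha> = {{1, 6}, {2, 5}, {3, 4}}" | "\<alpha> = {{1, 4}, {2, 3}, {6, 5}}" | "\<alpha> = {{1, 2}, {6, 3}, {5, 4}}"
    using assms(2) unfolding rainbow_patterns_def e insert_iff empty_iff by argo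
  then show ?thesis
  proof cases
    case 1
    show ?thesis
      by (rule orientation_exists[OF assms(1) 1]) (auto simp: compat_def)
  next
    case 2
    show ?thesis
      by (rule orientation_exists[OF assms(1) 2]) (auto simp: compat_def)
  next
    case 3
    show ?thesis
      by (rule orientation_exists[OF assms(1) 3]) (auto simp: compat_def)
  qed
qed

lemma neighbor_orientation:
  assumes "labelling 3 \<alpha> a b" "\<alpha> \<in> neighbor_patterns"
  shows "\<exists>a' b'. (\<forall>j\<in>{1..3}. a' j = a j \<and> b' j = b j \<or> a' j = b j \<and> b' j = a j) \<and> oriented (- 1) a' b'"
proof -
  have e: "{1, 6::nat} = {6, 1}"
    by blast
  consider "\<alpha> = {{1, 2}, {3, 4}, {5, 6}}" | "\<alpha> = {{6, 1}, {2, 3}, {4, 5}}"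
    using assms(2) unfolding neighbor_patterns_def e insert_iff empty_iff by argo
  then show ?thesis
  proof cases
    case 1
    show ?thesis
      by (rule orientation_exists[OF assms(1) 1]) (auto simp: compat_def)
  next
    case 2
    show ?thesis
      by (rule orientation_exists[OF assms(1) 2]) (auto simp: compat_def)
  qed
qed

section \<open>Collision of two neighboring points\<close>

lemma coord_remove_points:
  assumes "j \<in> {1..5}" "t \<in> {1..6} - {j, j + 1}"
  shows "coord (remove_points j z) (if t < j then t else t - 2) = coord z t"
proof -
  have v: "coord (remove_points j z) m = coord z (if m < j then m else m + 2)" if "m \<in> {1, 2, 3, 4}" for m
    using that unfolding remove_points_def Let_def coord_def
    by (auto simp: vector_def)
  have "(if t < j then t else t - 2) \<in> {1, 2, 3, 4}"
    using assms by auto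
  note v' = v[OF this]
  show ?thesis
  proof (cases "t < j")
    case False
    then have "\<not> t - 2 < j" "t - 2 + 2 = t"
      using assms by auto
    with False v' show ?thesis
      by simp
  qed (use v' in simp)
qed

lemma pure_pf2_eq:
  assumes "{{a 1, b 1}, {a 2, b 2}} = {{p, q}, {p', q'}}"
  shows "pure_pf2 \<kappa> h a b y = \<bar>coord y p - coord y q\<bar> powr (- 2 * h) * \<bar>coord y p' - coord y q'\<bar> powr (- 2 * h)
    * (cross_ratio (coord y p) (coord y q) (coord y p') (coord y q') powr (2 / \<kappa>)
       * hyp2F1 (1 - 4 / \<kappa>) (4 / \<kappa>) (8 / \<kappa>) (cross_ratio (coord y p) (coord y q) (coord y p') (coord y q'))
       / hyp2F1 (1 - 4 / \<kappa>) (4 / \<kappa>) (8 / \<kappa>) 1)"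
proof -
  have two: "{1..2::nat} = {1, 2}"
    by auto
  have "\<bar>coord y (a 1) - coord y (b 1)\<bar> powr (- 2 * h) * \<bar>coord y (a 2) - coord y (b 2)\<bar> powr (- 2 * h)
      = \<bar>coord y p - coord y q\<bar> powr (- 2 * h) * \<bar>coord y p' - coord y q'\<bar> powr (- 2 * h)"
    using assms unfolding doubleton_eq_iff by (elim disjE conjE) (simp_all add: abs_minus_commute mult.commute)
  moreover have "link_cross_ratio a b y 1 2 = cross_ratio (coord y p) (coord y q) (coord y p') (coord y q')"
    using assms unfolding doubleton_eq_iff link_cross_ratio_def
    by (elim disjE conjE) (simp_all add: cross_ratio_def min.commute abs_minus_commute mult.commute)
  ultimately show ?thesis
    unfolding pure_pf2_def Let_def two by simp
qed

text \<open>The ends of the three links are six distinct labels in a set of six elements, hence all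
  of it.\<close>

lemma link_containing:
  assumes or: "oriented \<sigma> a b" and t: "t \<in> {1..6}"
  obtains n p where "n \<in> {1..3}" "{a n, b n} = {t, p}" "p \<in> {1..6}" "p \<noteq> t"
    "t = a n \<and> p = b n \<or> t = b n \<and> p = a n"
proof -
  have "set [a 1, b 1, a 2, b 2, a 3, b 3] \<subseteq> {1..6}"
    using oriented_labels[OF or] by (simp add: atLeastAtMost_1_3)
  moreover have "card (set [a 1, b 1, a 2, b 2, a 3, b 3]) = card {1..6::nat}"
    using distinct_card[OF oriented_distinct(1)[OF or]] by simp
  ultimately have "set [a 1, b 1, a 2, b 2, a 3, b 3] = {1..6}"
    by (intro card_subset_eq) simp_all
  with t have "t \<in> set [a 1, b 1, a 2, b 2, a 3, b 3]"
    by simp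
  then have "\<exists>n\<in>{1..3}. t = a n \<or> t = b n"
    unfolding atLeastAtMost_1_3 by auto
  then obtain n where n: "n \<in> {1..3}" "t = a n \<or> t = b n"
    by blast
  note lab = oriented_labels[OF or n(1)]
  from n(2) show thesis
  proof
    assume "t = a n"
    then show thesis
      using n(1) lab by (intro that[of n "b n"]) auto
  next
    assume "t = b n"
    then show thesis
      using n(1) lab by (intro that[of n "a n"]) auto
  qed
qed

lemma cross_ratio_vector_in_box:
  assumes "oriented \<sigma> a b" "\<sigma> = 1 \<or> \<sigma> = - 1" "(x :: real ^ 6) \<in> chamber"
  shows "vector [link_cross_ratio a b x 1 2, link_cross_ratio a b x 2 3, link_cross_ratio a b x 3 1]
    \<in> (box 0 1 :: (real ^ 3) set)"
  using link_cross_ratio_oriented(2,3)[OF assms, of 1 2] link_cross_ratio_oriented(2,3)[OF assms, of 2 3]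
    link_cross_ratio_oriented(2,3)[OF assms, of 3 1]
  by (simp add: mem_box_cart forall_3 vector_3)

text \<open>The colliding points belong to two different links, whose cross-ratio is of the order of
  their distance \<delta>. So the cross-ratio power in the partition function contributes \<delta>
  to the power 2/\<kappa>, while \<open>F\<close> and the remaining factors stay bounded. Together
  with the factor \<open>\<delta> x powr (2 * h)\<close> the exponent is 8/\<kappa> - 1, which is
  positive for \<kappa> < 8.\<close>

lemma asy_at_other_link:
  fixes z :: "real ^ 6"
  assumes or: "oriented \<sigma> a b" and \<sigma>: "\<sigma> = 1 \<or> \<sigma> = - 1"
    and \<kappa>: "0 < \<kappa>" "\<kappa> < 8" and h: "h = (6 - \<kappa>) / (2 * \<kappa>)"
    and E: "extends_continuously_by F E"
    and j: "j \<in> {1..5}"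
    and z: "coord z j = \<xi>" "coord z (j + 1) = \<xi>"
      "\<forall>k\<in>{1..6}. \<forall>l\<in>{1..6}. k < l \<and> (k, l) \<noteq> (j, j + 1) \<longrightarrow> coord z k < coord z l"
    and nolink: "\<And>n. n \<in> {1..3} \<Longrightarrow> {a n, b n} \<noteq> {j, j + 1}"
  shows "((\<lambda>x. pf3 \<kappa> h c F a b x / (coord x (j + 1) - coord x j) powr (- 2 * h)) \<longlongrightarrow> 0)
    (at z within {x \<in> chamber. \<forall>k\<in>{1..6} - {j, j + 1}. coord x k = coord z k})"
proof -
  define S where "S = {x :: real ^ 6. x \<in> chamber \<and> (\<forall>k\<in>{1..6} - {j, j + 1}. coord x k = coord z k)}"
  have coord [tendsto_intros]: "((\<lambda>x :: real ^ 6. coord x k) \<longlongrightarrow> coord z k) (at z within S)" for k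
    unfolding coord_def by (intro tendsto_vec_nth tendsto_ident_at)
  have zne: "coord z k \<noteq> coord z l" if "k \<in> {1..6}" "l \<in> {1..6}" "k \<noteq> l" "{k, l} \<noteq> {j, j + 1}" for k l
    using z(3)[rule_format, OF that(1,2)] z(3)[rule_format, OF that(2,1)] that
    by (cases k l rule: linorder_cases) (force simp: doubleton_eq_iff)+
  have j6: "j \<in> {1..6}" "j + 1 \<in> {1..6}"
    using j by auto
  obtain n p where n: "n \<in> {1..3}" "{a n, b n} = {j, p}" "p \<in> {1..6}" "p \<noteq> j"
    "j = a n \<and> p = b n \<or> j = b n \<and> p = a n"
    using link_containing[OF or j6(1)] .
  obtain m q where m: "m \<in> {1..3}" "{a m, b m} = {j + 1, q}" "q \<in> {1..6}" "q \<noteq> j + 1"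
    "j + 1 = a m \<and> q = b m \<or> j + 1 = b m \<and> q = a m"
    using link_containing[OF or j6(2)] .
  have p: "p \<noteq> j + 1" and q: "q \<noteq> j"
    using nolink n(1,2) m(1,2) by (auto simp: insert_commute)
  have nm: "n \<noteq> m"
    using n(2) m(2) p n(4) m(4) by (auto simp: doubleton_eq_iff)
  \<comment> \<open>One of the two quotients in the cross-ratio of the links of \<open>j\<close> and
    \<open>j + 1\<close> is \<delta> times this factor; \<open>g\<close> has a finite limit because
    its denominator does not vanish at \<open>z\<close>.\<close>
  define g where "g x = \<bar>coord x p - coord x q\<bar> / (\<bar>coord x j - coord x q\<bar> * \<bar>coord x p - coord x (j + 1)\<bar>)" for x :: "real ^ 6"
  define \<delta> where "\<delta> x = coord x (j + 1) - coord x j" for x :: "real ^ 6"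
  define P where "P x = (\<Prod>j\<in>{1..3}. \<bar>coord x (a j) - coord x (b j)\<bar> powr (- 2 * h))" for x :: "real ^ 6"
  define v :: "real ^ 6 \<Rightarrow> real ^ 3" where
    "v x = vector [link_cross_ratio a b x 1 2, link_cross_ratio a b x 2 3, link_cross_ratio a b x 3 1]" for x
  have "bounded (E ` cbox 0 1)"
    using E unfolding extends_continuously_by_def by (intro compact_imp_bounded compact_continuous_image) auto
  then obtain B where B: "\<And>r. r \<in> cbox 0 1 \<Longrightarrow> \<bar>E r\<bar> \<le> B"
    unfolding bounded_iff by auto
  have bound: "\<bar>pf3 \<kappa> h c F a b x / \<delta> x powr (- 2 * h)\<bar> \<le> \<bar>c\<bar> * P x * (g x powr (2 / \<kappa>) * B) * \<delta> x powr (8 / \<kappa> - 1)"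
    if x: "x \<in> S" for x
  proof -
    have xc: "x \<in> chamber"
      using x by (simp add: S_def)
    have vb: "v x \<in> box 0 1"
      unfolding v_def by (rule cross_ratio_vector_in_box[OF or \<sigma> xc])
    then have v01: "0 < v x $ l" "v x $ l < 1" for l
      by (simp_all add: mem_box_cart)
    have \<delta>: "\<delta> x > 0"
      using xc j6 unfolding chamber_6 \<delta>_def by simp
    have "F (v x) = E (v x)"
      using E vb by (simp add: extends_continuously_by_def)
    then have FB: "\<bar>F (v x)\<bar> \<le> B"
      using B[of "v x"] vb box_subset_cbox by (metis subsetD)
    have cr_le: "cross_ratio u1 u2 u3 u4 \<le> \<bar>u1 - u3\<bar> * \<bar>u2 - u4\<bar> / (\<bar>u1 - u4\<bar> * \<bar>u2 - u3\<bar>)" for u1 u2 u3 u4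
      by (simp add: cross_ratio_def)
    have "link_cross_ratio a b x n m = cross_ratio (coord x j) (coord x p) (coord x (j + 1)) (coord x q)"
      using n(5) m(5) unfolding link_cross_ratio_def
      by (elim disjE conjE) (simp_all only: cross_ratio_commute(1,2))
    then have nm_le: "link_cross_ratio a b x n m \<le> \<delta> x * g x"
      using cr_le[of "coord x j" "coord x p" "coord x (j + 1)" "coord x q"] \<delta>
      by (simp add: \<delta>_def g_def)
    have sym: "link_cross_ratio a b x k l = link_cross_ratio a b x l k" for k l
      unfolding link_cross_ratio_def by (rule cross_ratio_commute(3))
    have vv: "v x $ 1 = link_cross_ratio a b x 1 2" "v x $ 2 = link_cross_ratio a b x 2 3" "v x $ 3 = link_cross_ratio a b x 3 1"
      by (simp_all add: v_def vector_3)
    obtain l where "v x $ l = link_cross_ratio a b x n m"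
      using n(1) m(1) nm vv sym unfolding atLeastAtMost_1_3 by (metis empty_iff insert_iff)
    then have vl: "v x $ l \<le> \<delta> x * g x"
      using nm_le by simp
    \<comment> \<open>The two other cross-ratios are less than 1 and may be dropped.\<close>
    have prod_le: "v x $ 1 * v x $ 2 * v x $ 3 \<le> v x $ l"
    proof -
      have "v x $ 1 * v x $ 2 * v x $ 3 \<le> v x $ 1" "v x $ 1 * v x $ 2 * v x $ 3 \<le> v x $ 2" "v x $ 1 * v x $ 2 * v x $ 3 \<le> v x $ 3"
        using v01 by (smt (verit, best) mult_le_cancel_left1 mult_le_cancel_right2 mult_pos_pos)+
      then show ?thesis
        using exhaust_3[of l] by auto
    qed
    have g0: "g x \<ge> 0"
      by (simp add: g_def)
    have "(v x $ 1 * v x $ 2 * v x $ 3) powr (2 / \<kappa>) \<le> (\<delta> x * g x) powr (2 / \<kappa>)"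
      using prod_le vl v01 \<kappa> by (intro powr_mono2) (auto intro!: mult_nonneg_nonneg less_imp_le)
    also have "\<dots> = \<delta> x powr (2 / \<kappa>) * g x powr (2 / \<kappa>)"
      using \<delta> g0 by (simp add: powr_mult)
    finally have pw: "(v x $ 1 * v x $ 2 * v x $ 3) powr (2 / \<kappa>) * \<bar>F (v x)\<bar> \<le> \<delta> x powr (2 / \<kappa>) * g x powr (2 / \<kappa>) * B"
      using FB by (intro mult_mono) auto
    have P0: "P x \<ge> 0"
      unfolding P_def by (intro prod_nonneg) auto
    have "pf3 \<kappa> h c F a b x = c * P x * ((v x $ 1 * v x $ 2 * v x $ 3) powr (2 / \<kappa>) * F (v x))"
      unfolding pf3_def Let_def P_def v_def ..
    then have "\<bar>pf3 \<kappa> h c F a b x / \<delta> x powr (- 2 * h)\<bar>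
        = \<bar>c\<bar> * P x * ((v x $ 1 * v x $ 2 * v x $ 3) powr (2 / \<kappa>) * \<bar>F (v x)\<bar>) * \<delta> x powr (2 * h)"
      using P0 by (simp add: abs_mult powr_minus_divide)
    also have "\<dots> \<le> \<bar>c\<bar> * P x * (\<delta> x powr (2 / \<kappa>) * g x powr (2 / \<kappa>) * B) * \<delta> x powr (2 * h)"
      using pw P0 by (intro mult_right_mono mult_left_mono) auto
    also have "\<dots> = \<bar>c\<bar> * P x * (g x powr (2 / \<kappa>) * B) * (\<delta> x powr (2 / \<kappa>) * \<delta> x powr (2 * h))"
      by (simp add: mult_ac)
    also have "\<delta> x powr (2 / \<kappa>) * \<delta> x powr (2 * h) = \<delta> x powr (8 / \<kappa> - 1)"
    proof -
      have "2 / \<kappa> + 2 * h = 8 / \<kappa> - 1"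
        unfolding h using \<kappa> by (simp add: divide_simps)
      then show ?thesis
        by (simp flip: powr_add)
    qed
    finally show ?thesis .
  qed
  have P_lim: "(P \<longlongrightarrow> P z) (at z within S)"
    unfolding P_def[abs_def]
  proof (intro tendsto_prod tendsto_powr tendsto_rabs tendsto_diff coord tendsto_const)
    fix k :: nat assume k: "k \<in> {1..3}"
    show "\<bar>coord z (a k) - coord z (b k)\<bar> \<noteq> 0"
      using zne[OF oriented_labels[OF or k] nolink[OF k]] by simp
  qed
  have ne: "coord z j \<noteq> coord z q" "coord z p \<noteq> coord z (j + 1)" "coord z p \<noteq> coord z q"
  proof -
    show "coord z j \<noteq> coord z q" "coord z p \<noteq> coord z (j + 1)"
      using zne[of j q] zne[of p "j + 1"] j6 n(3,4) m(3,4) p q by (auto simp: doubleton_eq_iff)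
    have "p \<noteq> q"
      using oriented_distinct(1)[OF or] n(1,5) m(1,5) nm unfolding atLeastAtMost_1_3 by auto
    then show "coord z p \<noteq> coord z q"
      using zne[of p q] n(3,4) m(3,4) p q by (auto simp: doubleton_eq_iff)
  qed
  have g_lim: "((\<lambda>x. g x powr (2 / \<kappa>)) \<longlongrightarrow> g z powr (2 / \<kappa>)) (at z within S)"
    unfolding g_def using ne by (intro tendsto_intros) auto
  have "((\<lambda>x. \<delta> x) \<longlongrightarrow> coord z (j + 1) - coord z j) (at z within S)"
    unfolding \<delta>_def by (intro tendsto_intros)
  then have "(\<delta> \<longlongrightarrow> 0) (at z within S)"
    using z(1,2) by simp
  \<comment> \<open>The base of the power tends to 0, so convergence of the power is obtained from
    nonnegative values of the base.\<close>
  moreover have "\<forall>\<^sub>F x in at z within S. 0 \<le> \<delta> x"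
    unfolding eventually_at_filter
    by (rule always_eventually) (use j6 in \<open>auto simp: S_def \<delta>_def chamber_6 less_imp_le\<close>)
  ultimately have "((\<lambda>x. \<delta> x powr (8 / \<kappa> - 1)) \<longlongrightarrow> 0 powr (8 / \<kappa> - 1)) (at z within S)"
    using \<kappa> by (intro tendsto_powr2 tendsto_const) auto
  then have \<delta>_lim: "((\<lambda>x. \<delta> x powr (8 / \<kappa> - 1)) \<longlongrightarrow> 0) (at z within S)"
    by simp
  have "((\<lambda>x. \<bar>c\<bar> * P x * (g x powr (2 / \<kappa>) * B) * \<delta> x powr (8 / \<kappa> - 1)) \<longlongrightarrow>
      \<bar>c\<bar> * P z * (g z powr (2 / \<kappa>) * B) * 0) (at z within S)"
    by (intro tendsto_mult P_lim g_lim \<delta>_lim tendsto_const)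
  then have "((\<lambda>x. \<bar>c\<bar> * P x * (g x powr (2 / \<kappa>) * B) * \<delta> x powr (8 / \<kappa> - 1)) \<longlongrightarrow> 0) (at z within S)"
    by simp
  moreover have "\<forall>\<^sub>F x in at z within S. norm (pf3 \<kappa> h c F a b x / \<delta> x powr (- 2 * h)) \<le>
      \<bar>c\<bar> * P x * (g x powr (2 / \<kappa>) * B) * \<delta> x powr (8 / \<kappa> - 1)"
    unfolding eventually_at_filter by (rule always_eventually) (use bound in auto)
  ultimately have "((\<lambda>x. pf3 \<kappa> h c F a b x / \<delta> x powr (- 2 * h)) \<longlongrightarrow> 0) (at z within S)"
    by (rule Lim_null_comparison[rotated])
  then show ?thesis
    unfolding S_def \<delta>_def .
qed

text \<open>Only the link \<open>n\<close> shrinks: its two cross-ratios tend to 1, while the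
  cross-ratio of the other two links is constant on \<open>S\<close>. The limit point thus lies on
  an edge of the cube where the boundary values of \<open>E\<close> are prescribed, and
  \<open>c\<close> turns them into the normalized hypergeometric factor for two links.\<close>

lemma asy_at_link:
  fixes z :: "real ^ 6"
  assumes or: "oriented \<sigma> a b" and \<sigma>: "\<sigma> = 1 \<or> \<sigma> = - 1"
    and lab: "labelling 3 \<alpha> a b" and \<kappa>: "0 < \<kappa>"
    and E: "extends_continuously_by F E" and cF: "cF > 0"
    and bdry: "\<And>r. r \<in> {0<..<1} \<Longrightarrow>
           E (vector [r, 1, 1]) = cF * hyp2F1 (1 - 4 / \<kappa>) (4 / \<kappa>) (8 / \<kappa>) r \<and>
           E (vector [1, r, 1]) = cF * hyp2F1 (1 - 4 / \<kappa>) (4 / \<kappa>) (8 / \<kappa>) r \<and>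
           E (vector [1, 1, r]) = cF * hyp2F1 (1 - 4 / \<kappa>) (4 / \<kappa>) (8 / \<kappa>) r"
    and j: "j \<in> {1..5}"
    and z: "coord z j = \<xi>" "coord z (j + 1) = \<xi>"
      "\<forall>k\<in>{1..6}. \<forall>l\<in>{1..6}. k < l \<and> (k, l) \<noteq> (j, j + 1) \<longrightarrow> coord z k < coord z l"
    and n: "n \<in> {1..3}" "{a n, b n} = {j, j + 1}"
    and lab': "labelling 2 (relabel_link j \<alpha>) a' b'"
  defines "S \<equiv> {x \<in> chamber. \<forall>k\<in>{1..6} - {j, j + 1}. coord x k = coord z k}"
    and "c \<equiv> inverse cF * inverse (hyp2F1 (1 - 4 / \<kappa>) (4 / \<kappa>) (8 / \<kappa>) 1)"
  shows "((\<lambda>x. pf3 \<kappa> h c F a b x / (coord x (j + 1) - coord x j) powr (- 2 * h)) \<longlongrightarrow>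
      pure_pf2 \<kappa> h a' b' (remove_points j z)) (at z within S)"
proof (cases "S = {}")
  case True
  then show ?thesis
    by simp
next
  case False
  \<comment> \<open>A point of the chamber with the given fixed coordinates shows that the constant
    cross-ratio lies strictly between 0 and 1.\<close>
  then obtain x0 where x0: "x0 \<in> S"
    by blast
  have coord [tendsto_intros]: "((\<lambda>x :: real ^ 6. coord x k) \<longlongrightarrow> coord z k) (at z within S)" for k
    unfolding coord_def by (intro tendsto_vec_nth tendsto_ident_at)
  \<comment> \<open>A cyclic choice, so that the surviving cross-ratio, that of \<open>m\<close> and
    \<open>k\<close>, is one of the listed ones 12, 23, 31 in the listed order.\<close>
  obtain m k where mk: "m \<in> {1..3}" "k \<in> {1..3}" "{n, m, k} = {1..3}" "distinct [n, m, k]"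
    "(n, m, k) \<in> {(1, 2, 3), (2, 3, 1), (3, 1, 2)}"
    using n(1) unfolding atLeastAtMost_1_3 by (elim insertE emptyE) (fastforce simp: insert_commute)+
  have disj: "a l \<notin> {j, j + 1} \<and> b l \<notin> {j, j + 1}" if "l \<in> {m, k}" for l
  proof -
    have "a l \<notin> {a n, b n} \<and> b l \<notin> {a n, b n}"
      using oriented_distinct(1)[OF or] mk(5) that by auto
    then show ?thesis
      unfolding n(2) .
  qed
  have fixed: "a l \<in> {1..6} - {j, j + 1}" "b l \<in> {1..6} - {j, j + 1}" if "l \<in> {m, k}" for l
    using disj[OF that] oriented_labels[OF or, of l] mk(1,2) that by auto
  have const: "coord x (a l) = coord z (a l)" "coord x (b l) = coord z (b l)" if "l \<in> {m, k}" "x \<in> S" for l x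
    using fixed[OF that(1)] that(2) unfolding S_def by blast+
  have z\<xi>: "coord z (a l) \<noteq> \<xi>" "coord z (b l) \<noteq> \<xi>" if "l \<in> {m, k}" for l
  proof -
    have "coord z t \<noteq> \<xi>" if "t \<in> {1..6} - {j, j + 1}" for t
      using z(3)[rule_format, of t j] z(3)[rule_format, of j t] that j z(1)
      by (cases t j rule: linorder_cases) auto
    then show "coord z (a l) \<noteq> \<xi>" "coord z (b l) \<noteq> \<xi>"
      using fixed[OF that] by blast+
  qed
  define \<rho> where "\<rho> = cross_ratio (coord z (a m)) (coord z (b m)) (coord z (a k)) (coord z (b k))"
  define Pm where "Pm = \<bar>coord z (a m) - coord z (b m)\<bar> powr (- 2 * h)"
  define Pk where "Pk = \<bar>coord z (a k) - coord z (b k)\<bar> powr (- 2 * h)"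
  define v :: "real ^ 6 \<Rightarrow> real ^ 3" where
    "v x = vector [link_cross_ratio a b x 1 2, link_cross_ratio a b x 2 3, link_cross_ratio a b x 3 1]" for x
  define L :: "real ^ 3" where "L = (if n = 1 then vector [1, \<rho>, 1] else if n = 2 then vector [1, 1, \<rho>] else vector [\<rho>, 1, 1])"
  have \<rho>: "link_cross_ratio a b x m k = \<rho>" if "x \<in> S" for x
    using const[OF _ that] by (simp add: link_cross_ratio_def \<rho>_def)
  have \<rho>01: "\<rho> \<in> {0<..<1}"
    using link_cross_ratio_oriented(2,3)[OF or \<sigma> _ mk(1,2), of x0] \<rho>[OF x0] x0 mk(4) by (auto simp: S_def)
  have one: "((\<lambda>x. link_cross_ratio a b x n l) \<longlongrightarrow> 1) (at z within S)" if l: "l \<in> {m, k}" for l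
  proof -
    have \<xi>: "coord z (a n) = \<xi>" "coord z (b n) = \<xi>"
      using n(2) z(1,2) by (auto simp: doubleton_eq_iff)
    have "((\<lambda>x. link_cross_ratio a b x n l) \<longlongrightarrow>
        cross_ratio (coord z (a n)) (coord z (b n)) (coord z (a l)) (coord z (b l))) (at z within S)"
      unfolding link_cross_ratio_def cross_ratio_def
      using z\<xi>[OF l] \<xi> by (intro tendsto_intros) auto
    also have "cross_ratio (coord z (a n)) (coord z (b n)) (coord z (a l)) (coord z (b l)) = 1"
      unfolding cross_ratio_def \<xi> using z\<xi>[OF l] by simp
    finally show ?thesis .
  qed
  have sym: "link_cross_ratio a b x k l = link_cross_ratio a b x l k" for k l and x :: "real ^ 6"
    unfolding link_cross_ratio_def by (rule cross_ratio_commute(3))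
  have \<rho>_lim: "((\<lambda>x. link_cross_ratio a b x m k) \<longlongrightarrow> \<rho>) (at z within S)"
    by (rule tendsto_eventually) (auto simp: eventually_at_filter \<rho>)
  have lims: "((\<lambda>x. v x $ 1) \<longlongrightarrow> L $ 1) (at z within S)" "((\<lambda>x. v x $ 2) \<longlongrightarrow> L $ 2) (at z within S)"
    "((\<lambda>x. v x $ 3) \<longlongrightarrow> L $ 3) (at z within S)"
    using mk(5) one[of m] one[of k] \<rho>_lim sym[of _ 3 1] sym[of _ 1 2] sym[of _ 2 3]
    unfolding v_def L_def by (auto simp: vector_3)
  have v_lim: "(v \<longlongrightarrow> L) (at z within S)"
  proof (rule vec_tendstoI)
    fix l
    show "((\<lambda>x. v x $ l) \<longlongrightarrow> L $ l) (at z within S)"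
      using exhaust_3[of l] lims by (elim disjE) simp_all
  qed
  have vb: "v x \<in> box 0 1" if "x \<in> S" for x
    unfolding v_def using that by (intro cross_ratio_vector_in_box[OF or \<sigma>]) (simp add: S_def)
  have L: "L \<in> cbox 0 1" "L $ 1 * L $ 2 * L $ 3 = \<rho>" "E L = cF * hyp2F1 (1 - 4 / \<kappa>) (4 / \<kappa>) (8 / \<kappa>) \<rho>"
    using \<rho>01 bdry[OF \<rho>01] unfolding L_def by (auto simp: mem_box_cart forall_3 vector_3)
  have "((\<lambda>x. E (v x)) \<longlongrightarrow> E L) (at z within S)"
  proof (rule continuous_on_tendsto_compose[OF _ v_lim L(1)])
    show "continuous_on (cbox 0 1) E"
      using E by (simp add: extends_continuously_by_def)
    show "\<forall>\<^sub>F x in at z within S. v x \<in> cbox 0 1"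
      unfolding eventually_at_filter using vb box_subset_cbox by (intro always_eventually) blast
  qed
  then have "((\<lambda>x. c * (Pm * Pk) * ((v x $ 1 * v x $ 2 * v x $ 3) powr (2 / \<kappa>) * E (v x))) \<longlongrightarrow>
      c * (Pm * Pk) * ((L $ 1 * L $ 2 * L $ 3) powr (2 / \<kappa>) * E L)) (at z within S)"
    using \<rho>01 L(2) by (intro tendsto_intros lims) auto
  moreover have "c * (Pm * Pk) * ((L $ 1 * L $ 2 * L $ 3) powr (2 / \<kappa>) * E L) = pure_pf2 \<kappa> h a' b' (remove_points j z)"
  proof -
    define f where "f t = (if t < j then t else t - 2)" for t :: nat
    have \<alpha>: "\<alpha> = {{a n, b n}, {a m, b m}, {a k, b k}}"
      using lab mk(3) unfolding labelling_def by auto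
    have "{a m, b m} \<noteq> {j, j + 1}" "{a k, b k} \<noteq> {j, j + 1}"
      using disj[of m] disj[of k] by auto
    then have "\<alpha> - {{j, j + 1}} = {{a m, b m}, {a k, b k}}"
      unfolding \<alpha> n(2) by auto
    then have "relabel_link j \<alpha> = {{f (a m), f (b m)}, {f (a k), f (b k)}}"
      unfolding relabel_link_def f_def[symmetric] by simp
    moreover have "{1..2::nat} = {1, 2}"
      by auto
    ultimately have "{{a' 1, b' 1}, {a' 2, b' 2}} = {{f (a m), f (b m)}, {f (a k), f (b k)}}"
      using lab' unfolding labelling_def by simp
    from pure_pf2_eq[OF this] have "pure_pf2 \<kappa> h a' b' (remove_points j z) =
        Pm * Pk * (\<rho> powr (2 / \<kappa>) * hyp2F1 (1 - 4 / \<kappa>) (4 / \<kappa>) (8 / \<kappa>) \<rho> / hyp2F1 (1 - 4 / \<kappa>) (4 / \<kappa>) (8 / \<kappa>) 1)"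
      using coord_remove_points[OF j, of _ z, folded f_def] fixed by (simp add: Pm_def Pk_def \<rho>_def)
    then show ?thesis
      unfolding L c_def using cF by (simp add: divide_inverse)
  qed
  moreover have "c * (Pm * Pk) * ((v x $ 1 * v x $ 2 * v x $ 3) powr (2 / \<kappa>) * E (v x)) =
      pf3 \<kappa> h c F a b x / (coord x (j + 1) - coord x j) powr (- 2 * h)" if x: "x \<in> S" for x
  proof -
    have "coord x (j + 1) - coord x j > 0"
      using x j unfolding S_def chamber_6 by auto
    then have \<delta>: "\<bar>coord x (a n) - coord x (b n)\<bar> = coord x (j + 1) - coord x j" "coord x (j + 1) - coord x j > 0"
      using n(2) by (auto simp: doubleton_eq_iff)
    have "(\<Prod>l\<in>{1..3}. \<bar>coord x (a l) - coord x (b l)\<bar> powr (- 2 * h)) = (coord x (j + 1) - coord x j) powr (- 2 * h) * (Pm * Pk)"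
      unfolding mk(3)[symmetric] using mk(4) const[OF _ x] by (simp add: \<delta>(1) Pm_def Pk_def)
    moreover have "E (v x) = F (v x)"
      using E vb[OF x] by (simp add: extends_continuously_by_def)
    ultimately show ?thesis
      using \<delta>(2) unfolding pf3_def Let_def v_def[symmetric] by simp
  qed
  ultimately show ?thesis
    by (auto elim!: Lim_transform_eventually simp: eventually_at_filter)
qed

lemma satisfies_ASY_pf3:
  assumes or: "oriented \<sigma> a b" and \<sigma>: "\<sigma> = 1 \<or> \<sigma> = - 1"
    and lab: "labelling 3 \<alpha> a b" and \<kappa>: "0 < \<kappa>" "\<kappa> < 8" and \<beta>: "\<beta> = 4 / \<kappa>" and h: "h = (6 - \<kappa>) / (2 * \<kappa>)"
    and E: "extends_continuously_by F E" and cF: "cF > 0"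
    and bdry: "\<forall>r\<in>{0<..<1}.
           E (vector [r, 1, 1]) = cF * hyp2F1 (1 - \<beta>) \<beta> (2 * \<beta>) r \<and>
           E (vector [1, r, 1]) = cF * hyp2F1 (1 - \<beta>) \<beta> (2 * \<beta>) r \<and>
           E (vector [1, 1, r]) = cF * hyp2F1 (1 - \<beta>) \<beta> (2 * \<beta>) r"
  shows "satisfies_ASY \<kappa> h \<alpha> (pf3 \<kappa> h (inverse cF * inverse (hyp2F1 (1 - \<beta>) \<beta> (2 * \<beta>) 1)) F a b)"
  unfolding satisfies_ASY_def Let_def
proof (intro ballI allI impI conjI; elim conjE)
  fix j \<xi> and z :: "real ^ 6"
  assume j: "j \<in> {1..5}" and z: "coord z j = \<xi>" "coord z (j + 1) = \<xi>"
      "\<forall>k\<in>{1..6}. \<forall>l\<in>{1..6}. k < l \<and> (k, l) \<noteq> (j, j + 1) \<longrightarrow> coord z k < coord z l"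
    and "{j, j + 1} \<notin> \<alpha>"
  then have "{a n, b n} \<noteq> {j, j + 1}" if "n \<in> {1..3}" for n
    using lab that unfolding labelling_def by blast
  then show "((\<lambda>x. pf3 \<kappa> h (inverse cF * inverse (hyp2F1 (1 - \<beta>) \<beta> (2 * \<beta>) 1)) F a b x
      / (coord x (j + 1) - coord x j) powr (- 2 * h)) \<longlongrightarrow> 0)
    (at z within {x \<in> chamber. \<forall>k\<in>{1..6} - {j, j + 1}. coord x k = coord z k})"
    by (rule asy_at_other_link[OF or \<sigma> \<kappa> h E j z])
next
  fix j \<xi> a' b' and z :: "real ^ 6"
  assume j: "j \<in> {1..5}" and z: "coord z j = \<xi>" "coord z (j + 1) = \<xi>"
      "\<forall>k\<in>{1..6}. \<forall>l\<in>{1..6}. k < l \<and> (k, l) \<noteq> (j, j + 1) \<longrightarrow> coord z k < coord z l"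
    and link: "{j, j + 1} \<in> \<alpha>" and lab': "labelling 2 (relabel_link j \<alpha>) a' b'"
  obtain n where n: "n \<in> {1..3}" "{a n, b n} = {j, j + 1}"
    using link lab unfolding labelling_def by auto
  have "2 * \<beta> = 8 / \<kappa>"
    using \<beta> by simp
  then show "((\<lambda>x. pf3 \<kappa> h (inverse cF * inverse (hyp2F1 (1 - \<beta>) \<beta> (2 * \<beta>) 1)) F a b x
      / (coord x (j + 1) - coord x j) powr (- 2 * h)) \<longlongrightarrow> pure_pf2 \<kappa> h a' b' (remove_points j z))
    (at z within {x \<in> chamber. \<forall>k\<in>{1..6} - {j, j + 1}. coord x k = coord z k})"
    using asy_at_link[OF or \<sigma> lab \<kappa>(1) E cF _ j z n lab', where h = h] bdry unfolding \<beta> by simp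
qed

section \<open>Positivity\<close>

text \<open>If the second derivative along the line through \<open>p\<close> in direction
  \<open>v\<close> were negative, the first derivative, zero at \<open>p\<close>, would be negative
  just after it, and the mean value theorem would give a value below the minimum.\<close>

lemma local_min_second_order:
  fixes W :: "real ^ 'n::finite \<Rightarrow> real"
  assumes S: "open S" and W: "Ck_on 2 S W" and p: "p \<in> S" and min: "\<And>y. y \<in> S \<Longrightarrow> W p \<le> W y"
  shows "partial_deriv k W p = 0"
    and "(\<Sum>k\<in>UNIV. \<Sum>l\<in>UNIV. v $ k * v $ l * partial_deriv l (partial_deriv k W) p) \<ge> 0"
proof -
  have W1: "Ck_on (Suc (Suc 0)) S W"
    using W by (simp add: numeral_2_eq_2)
  then have W2: "Ck_on (Suc 0) S (partial_deriv k W)" for k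
    by simp
  have dW: "(\<lambda>v. \<Sum>i\<in>UNIV. v $ i * partial_deriv i W p) = (\<lambda>v. 0)"
    using differential_zero_maxmin[OF p S Ck_on_SucD[OF W1 p]] min by blast
  show grad: "partial_deriv k W p = 0" for k
    using fun_cong[OF dW, of "axis k 1"] by simp
  let ?H = "\<Sum>k\<in>UNIV. \<Sum>l\<in>UNIV. v $ k * v $ l * partial_deriv l (partial_deriv k W) p"
  define \<phi> where "\<phi> t = W (p + t *\<^sub>R v)" for t
  define \<phi>' where "\<phi>' t = (\<Sum>k\<in>UNIV. v $ k * partial_deriv k W (p + t *\<^sub>R v))" for t
  have line: "((\<lambda>t. f (p + t *\<^sub>R v)) has_field_derivative (\<Sum>i\<in>UNIV. v $ i * partial_deriv i f (p + t *\<^sub>R v))) (at t)"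
    if "Ck_on (Suc 0) S f" "p + t *\<^sub>R v \<in> S" for f t
  proof -
    have "((\<lambda>t. p + t *\<^sub>R v) has_derivative (\<lambda>s. s *\<^sub>R v)) (at t)"
      by (auto intro!: derivative_eq_intros)
    from has_derivative_compose[OF this Ck_on_SucD[OF that]] show ?thesis
      unfolding has_field_derivative_def
      by (rule has_derivative_eq_rhs) (simp add: fun_eq_iff sum_distrib_left mult_ac)
  qed
  have "((\<lambda>t. p + t *\<^sub>R v) \<longlongrightarrow> p + 0 *\<^sub>R v) (at (0::real))"
    by (intro tendsto_intros)
  then have "\<forall>\<^sub>F t in at (0::real). p + t *\<^sub>R v \<in> S"
    using S p by (auto dest: topological_tendstoD)
  then obtain d where d: "d > 0" "\<And>t. \<bar>t\<bar> < d \<Longrightarrow> p + t *\<^sub>R v \<in> S"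
    unfolding eventually_at using p by (auto simp: dist_real_def) (metis abs_zero add.right_neutral scale_zero_left)
  have d1: "(\<phi> has_field_derivative \<phi>' t) (at t)" if "\<bar>t\<bar> < d" for t
    unfolding \<phi>_def[abs_def] \<phi>'_def using line[OF Ck_on_Suc_imp[OF W1] d(2)[OF that]] .
  have "(\<phi>' has_field_derivative (\<Sum>k\<in>UNIV. v $ k * (\<Sum>l\<in>UNIV. v $ l * partial_deriv l (partial_deriv k W) (p + 0 *\<^sub>R v)))) (at 0)"
    unfolding \<phi>'_def[abs_def] using p by (intro DERIV_sum DERIV_cmult line W2) simp
  then have d2: "(\<phi>' has_field_derivative ?H) (at 0)"
    by (simp add: sum_distrib_left mult.assoc)
  show "?H \<ge> 0"
  proof (rule ccontr)
    assume "\<not> ?H \<ge> 0"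
    then obtain e where e: "e > 0" "\<And>t. 0 < t \<Longrightarrow> t < e \<Longrightarrow> \<phi>' t < \<phi>' 0"
      using DERIV_neg_dec_right[OF d2] by auto
    define s where "s = min d e / 2"
    have s: "0 < s" "s < d" "s < e"
      using d(1) e(1) by (auto simp: s_def)
    obtain t where t: "0 < t" "t < s" "\<phi> s - \<phi> 0 = (s - 0) * \<phi>' t"
      using MVT2[OF s(1), of \<phi> \<phi>'] d1 s by auto
    have "\<phi>' 0 = 0"
      by (simp add: \<phi>'_def grad)
    then have "\<phi>' t < 0"
      using e(2)[of t] t s by simp
    then have "\<phi> s < \<phi> 0"
      using t(3) s(1) by (smt (verit) mult_pos_neg)
    moreover have "\<phi> 0 \<le> \<phi> s"
      unfolding \<phi>_def using min[OF d(2)[of s]] s by simp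
    ultimately show False
      by simp
  qed
qed

section \<open>Monomials with real exponents on the open cube\<close>

definition monom3 :: "(3 \<Rightarrow> real) \<Rightarrow> real ^ 3 \<Rightarrow> real"
  where "monom3 e r = exp (\<Sum>l\<in>UNIV. e l * ln (r $ l))"

lemma monom3_lower:
  assumes "r $ l > 0"
  shows "monom3 (e(l := e l - 1)) r = monom3 e r / r $ l"
proof -
  have "(\<Sum>m\<in>UNIV. (e(l := e l - 1)) m * ln (r $ m)) = (\<Sum>m\<in>UNIV. e m * ln (r $ m) - (if m = l then ln (r $ l) else 0))"
    by (intro sum.cong) (auto simp: algebra_simps)
  also have "\<dots> = (\<Sum>m\<in>UNIV. e m * ln (r $ m)) - ln (r $ l)"
    by (simp add: sum_subtractf)
  finally show ?thesis
    using assms by (simp add: monom3_def exp_diff)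
qed

lemma has_derivative_monom3:
  assumes "r \<in> box 0 1"
  shows "(monom3 e has_derivative (\<lambda>v. \<Sum>l\<in>UNIV. v $ l * (e l * monom3 (e(l := e l - 1)) r))) (at r)"
proof -
  have r: "r $ l > 0" for l
    using assms by (simp add: mem_box_cart)
  have "((\<lambda>r :: real ^ 3. \<Sum>l\<in>UNIV. e l * ln (r $ l)) has_derivative (\<lambda>v. \<Sum>l\<in>UNIV. e l * (v $ l * inverse (r $ l)))) (at r)"
  proof (intro has_derivative_sum has_derivative_mult_right)
    show "((\<lambda>r :: real ^ 3. ln (r $ l)) has_derivative (\<lambda>v. v $ l * inverse (r $ l))) (at r)" for l
      using has_derivative_ln[OF r has_derivative_vec_nth] by (simp add: divide_inverse)
  qed
  from has_derivative_exp[OF this] show ?thesis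
    unfolding monom3_lower[OF r] by (simp add: monom3_def[abs_def] sum_distrib_left sum_distrib_right divide_inverse mult_ac)
qed

text \<open>Differentiation only lowers one exponent, so the induction runs over all exponent
  vectors at once.\<close>

lemma Ck_on_monom3: "Ck_on k (box 0 1) (monom3 e)"
proof (induction k arbitrary: e)
  case 0
  show ?case
    using has_derivative_continuous[OF has_derivative_monom3]
    by (auto intro!: continuous_at_imp_continuous_on)
next
  case (Suc k)
  show ?case
  proof (rule Ck_on_SucI[OF open_box has_derivative_monom3])
    show "Ck_on k (box 0 1) (\<lambda>r. \<Sum>l\<in>UNIV. axis i 1 $ l * (e l * monom3 (e(l := e l - 1)) r))" for i
      by (intro Ck_on_sum Ck_on_mult Ck_on_const Suc open_box)
  qed
qed

lemma partial_deriv_monom3: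
  assumes "r \<in> box 0 1"
  shows "partial_deriv l (monom3 e) r = e l * monom3 e r / r $ l"
    and "partial_deriv l (partial_deriv k (monom3 e)) r =
      (if k = l then e l * (e l - 1) else e k * e l) * monom3 e r / (r $ k * r $ l)"
proof -
  have pd: "partial_deriv l (monom3 e) r = e l * monom3 (e(l := e l - 1)) r" if "r \<in> box 0 1" for r l e
    using partial_deriv_eq[OF has_derivative_monom3[OF that]] by simp
  have pos: "r $ l > 0" for l
    using assms by (simp add: mem_box_cart)
  show pd': "partial_deriv l (monom3 e) r = e l * monom3 e r / r $ l" for l e
    using pd[OF assms] monom3_lower[OF pos] by simp
  have "partial_deriv l (partial_deriv k (monom3 e)) r = partial_deriv l (\<lambda>r. e k * monom3 (e(k := e k - 1)) r) r"
    by (rule partial_deriv_cong[OF open_box assms pd])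
  also have "\<dots> = e k * partial_deriv l (monom3 (e(k := e k - 1))) r"
    using partial_deriv_eq[OF has_derivative_mult_right[OF has_derivative_monom3[OF assms]]]
      partial_deriv_eq[OF has_derivative_monom3[OF assms]] by metis
  also have "\<dots> = (if k = l then e l * (e l - 1) else e k * e l) * monom3 e r / (r $ k * r $ l)"
    unfolding pd' monom3_lower[OF pos] by (auto simp: field_simps)
  finally show "partial_deriv l (partial_deriv k (monom3 e)) r =
      (if k = l then e l * (e l - 1) else e k * e l) * monom3 e r / (r $ k * r $ l)" .
qed

section \<open>The quadratic form that multiplies \<open>G\<close> and its isotropic
  directions\<close>

definition Kcoeff :: "real \<Rightarrow> real \<Rightarrow> real \<Rightarrow> real \<Rightarrow> real"
  where "Kcoeff \<sigma> x y z = (if \<sigma> = 1 then x * (1 + y * z) - (y + z) else x * (y + z) - (1 + y * z))"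

text \<open>The coefficient of \<open>G\<close> that results from combining (1) and (2) or (3) with
  the weights of a direction \<open>v\<close>.\<close>

definition Gform :: "real \<Rightarrow> real ^ 3 \<Rightarrow> real ^ 3 \<Rightarrow> real"
  where "Gform \<sigma> r v =
    (v $ 1)\<^sup>2 / (r $ 1 * (1 - r $ 1)) * ((1 - r $ 2) * (1 - r $ 3))
    + (v $ 2)\<^sup>2 / (r $ 2 * (1 - r $ 2)) * ((1 - r $ 3) * (1 - r $ 1))
    + (v $ 3)\<^sup>2 / (r $ 3 * (1 - r $ 3)) * ((1 - r $ 1) * (1 - r $ 2))
    + v $ 1 * v $ 2 / (r $ 1 * r $ 2) * Kcoeff \<sigma> (r $ 3) (r $ 1) (r $ 2)
    + v $ 2 * v $ 3 / (r $ 2 * r $ 3) * Kcoeff \<sigma> (r $ 1) (r $ 2) (r $ 3)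
    + v $ 3 * v $ 1 / (r $ 3 * r $ 1) * Kcoeff \<sigma> (r $ 2) (r $ 3) (r $ 1)"

text \<open>The value of the quadratic form on a coordinate plane at a vector whose second entry
  minimizes it for the given first entry, with denominators cleared. Its sign is decided by the
  discriminant of the plane.\<close>

lemma two_component_identity:
  fixes x y z K :: real
  assumes "0 < x" "x < 1" "0 < y" "y < 1" "0 < z" "z < 1"
  shows "(2 * x * (1 - x) * (1 - z))\<^sup>2 / (x * (1 - x)) * ((1 - y) * (1 - z))
    + (- K * (1 - y))\<^sup>2 / (y * (1 - y)) * ((1 - z) * (1 - x))
    + (2 * x * (1 - x) * (1 - z)) * (- K * (1 - y)) / (x * y) * K
    = (1 - x) * (1 - y) * (1 - z) / y * (4 * x * y * (1 - z)\<^sup>2 - K\<^sup>2)"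
proof -
  have "x \<noteq> 0" "1 - x \<noteq> 0" "y \<noteq> 0" "1 - y \<noteq> 0"
    using assms by auto
  then show ?thesis
    by (simp add: divide_simps) algebra
qed

text \<open>The form is positive on the axes, so by continuity it suffices to find one nonnegative
  vector on which it is nonpositive. Such a vector lies in a coordinate plane if the discriminant
  there is nonnegative and the mixed coefficient is negative.\<close>

lemma null_direction:
  assumes r: "r \<in> box 0 1" and \<sigma>: "\<sigma> = 1 \<or> \<sigma> = - 1"
  obtains v :: "real ^ 3" where "\<And>l. v $ l \<ge> 0" "\<exists>l. v $ l > 0" "Gform \<sigma> r v = 0" "\<sigma> = - 1 \<Longrightarrow> v $ 1 = 0"
proof -
  define x y z where "x = r $ 1" and "y = r $ 2" and "z = r $ 3"
  have x: "0 < x" "x < 1" and y: "0 < y" "y < 1" and z: "0 < z" "z < 1"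
    using r by (simp_all add: mem_box_cart x_def y_def z_def)
  \<comment> \<open>Up to a positive factor, the discriminant of the form restricted to coordinates
    2 and 3. The next fact shows that the coordinates 3 and 1 give the same number, so a single sign
    distinction serves both planes.\<close>
  define D where "D = (Kcoeff \<sigma> x y z)\<^sup>2 - 4 * y * z * (1 - x)\<^sup>2"
  have D2: "D = (Kcoeff \<sigma> y z x)\<^sup>2 - 4 * z * x * (1 - y)\<^sup>2"
    using \<sigma> unfolding D_def Kcoeff_def by (auto simp: algebra_simps power2_eq_square)
  have "\<exists>v. (\<forall>l. v $ l \<ge> 0) \<and> (\<exists>l. v $ l > 0) \<and> Gform \<sigma> r v \<le> 0 \<and> (\<sigma> = - 1 \<longrightarrow> v $ 1 = 0)"
  proof -
    have a: ?thesis if D: "D \<ge> 0" and K: "Kcoeff \<sigma> x y z < 0"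
    proof -
      let ?v = "vector [0, 2 * y * (1 - y) * (1 - x), - Kcoeff \<sigma> x y z * (1 - z)] :: real ^ 3"
      have "Gform \<sigma> r ?v = (1 - y) * (1 - z) * (1 - x) / z * (4 * y * z * (1 - x)\<^sup>2 - (Kcoeff \<sigma> x y z)\<^sup>2)"
        unfolding two_component_identity[OF y z x, of "Kcoeff \<sigma> x y z", symmetric]
        by (simp add: Gform_def vector_3 x_def y_def z_def)
      also have "\<dots> \<le> 0"
        using D x y z unfolding D_def by (intro mult_nonneg_nonpos) auto
      finally have "Gform \<sigma> r ?v \<le> 0" .
      moreover have "?v $ 2 > 0" "?v $ l \<ge> 0" "?v $ 1 = 0" for l
        using x y z K exhaust_3[of l] by (auto simp: vector_3 mult_nonpos_nonneg)
      ultimately show ?thesis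
        by blast
    qed
    show ?thesis
    proof (cases "\<sigma> = 1")
      case True
      have b: ?thesis if D: "D \<ge> 0" and K: "Kcoeff \<sigma> y z x < 0"
      proof -
        let ?v = "vector [- Kcoeff \<sigma> y z x * (1 - x), 0, 2 * z * (1 - z) * (1 - y)] :: real ^ 3"
        have "Gform \<sigma> r ?v = (1 - z) * (1 - x) * (1 - y) / x * (4 * z * x * (1 - y)\<^sup>2 - (Kcoeff \<sigma> y z x)\<^sup>2)"
          unfolding two_component_identity[OF z x y, of "Kcoeff \<sigma> y z x", symmetric]
          by (simp add: Gform_def vector_3 x_def y_def z_def)
        also have "\<dots> \<le> 0"
          using D x y z unfolding D2 by (intro mult_nonneg_nonpos) auto
        finally have "Gform \<sigma> r ?v \<le> 0" .
        moreover have "?v $ 3 > 0" "?v $ l \<ge> 0" for l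
          using x y z K exhaust_3[of l] by (auto simp: vector_3 mult_nonpos_nonneg)
        moreover have "\<sigma> \<noteq> - 1"
          using True by simp
        ultimately show ?thesis
          by blast
      qed
      have c: ?thesis if D: "D < 0"
      proof -
        \<comment> \<open>With \<open>r $ l = (tanh (t l))\<^sup>2\<close> the form is, up to scaling of the entries, the Gram matrix of the
          normals of the sides of a hyperbolic triangle with side lengths \<open>2 t l\<close>, and \<open>?v\<close> is the first
          column of its adjugate.\<close>
        let ?v = "vector [x * (1 - y) * (1 - z), y * (1 + z) * (1 - y), z * (1 + y) * (1 - z)] :: real ^ 3"
        have nz: "x \<noteq> 0" "1 - x \<noteq> 0" "y \<noteq> 0" "1 - y \<noteq> 0" "z \<noteq> 0" "1 - z \<noteq> 0"
          using x y z by auto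
        have "Gform \<sigma> r ?v = D * ((1 - y) * (1 - z) / (1 - x))"
        proof -
          define q where "q = x * (1 - y)\<^sup>2 * (1 - z)\<^sup>2 / (1 - x)"
          have w: "(x * (1 - y) * (1 - z))\<^sup>2 / (x * (1 - x)) = q"
            "(y * (1 + z) * (1 - y))\<^sup>2 / (y * (1 - y)) = y * (1 + z)\<^sup>2 * (1 - y)"
            "(z * (1 + y) * (1 - z))\<^sup>2 / (z * (1 - z)) = z * (1 + y)\<^sup>2 * (1 - z)"
            "x * (1 - y) * (1 - z) * (y * (1 + z) * (1 - y)) / (x * y) = (1 - y)\<^sup>2 * (1 - z) * (1 + z)"
            "y * (1 + z) * (1 - y) * (z * (1 + y) * (1 - z)) / (y * z) = (1 + z) * (1 - y) * (1 + y) * (1 - z)"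
            "z * (1 + y) * (1 - z) * (x * (1 - y) * (1 - z)) / (z * x) = (1 + y) * (1 - z)\<^sup>2 * (1 - y)"
            using nz by (simp_all add: q_def power2_eq_square)
          let ?P = "y * (1 + z)\<^sup>2 * (1 - x) + z * (1 + y)\<^sup>2 * (1 - x) + (1 - y) * (1 + z) * Kcoeff \<sigma> z x y
            + (1 + z) * (1 + y) * Kcoeff \<sigma> x y z + (1 + y) * (1 - z) * Kcoeff \<sigma> y z x"
          have "Gform \<sigma> r ?v = (1 - y) * (1 - z) * (q + ?P)"
            unfolding Gform_def x_def[symmetric] y_def[symmetric] z_def[symmetric] vector_3 w
            by algebra
          also have "\<dots> = (x * (1 - y)\<^sup>2 * (1 - z)\<^sup>2 + (1 - x) * ?P) * ((1 - y) * (1 - z) / (1 - x))"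
          proof -
            have "A * (s / t + p) = (s + t * p) * (A / t)" if "t \<noteq> 0" for A s t p :: real
              using that by (simp add: field_simps)
            then show ?thesis
              unfolding q_def using nz(2) .
          qed
          also have "x * (1 - y)\<^sup>2 * (1 - z)\<^sup>2 + (1 - x) * ?P = D"
            unfolding D_def Kcoeff_def using True by (simp add: power2_eq_square algebra_simps)
          finally show ?thesis .
        qed
        also have "\<dots> \<le> 0"
          using D x y z by (intro mult_nonpos_nonneg) auto
        finally have "Gform \<sigma> r ?v \<le> 0" .
        moreover have "?v $ 1 > 0" "?v $ l \<ge> 0" for l
          using x y z exhaust_3[of l] by (auto simp: vector_3)
        moreover have "\<sigma> \<noteq> - 1"
          using True by simp
        ultimately show ?thesis
          by blast
      qed
      \<comment> \<open>A negative sum forces one of the two mixed coefficients to be negative; when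
        the discriminant is nonnegative, that plane contains the required vector.\<close>
      have "Kcoeff \<sigma> x y z + Kcoeff \<sigma> y z x = - 2 * z * (1 - x * y)"
        using True by (simp add: Kcoeff_def algebra_simps)
      moreover have "x * y < 1"
        using x y by (metis less_le_trans less_imp_le mult_less_cancel_left2 mult.right_neutral not_less)
      then have "2 * z * (1 - x * y) > 0"
        using z by simp
      ultimately have "Kcoeff \<sigma> x y z < 0 \<or> Kcoeff \<sigma> y z x < 0"
        by linarith
      then show ?thesis
        using a b c by (meson not_le)
    next
      case False
      \<comment> \<open>For \<sigma> = - 1 the plane of coordinates 2 and 3 always suffices: minus
        the mixed coefficient is at least \<open>(y + z) * (1 - x)\<close>, whose square is at least
        \<open>4 * y * z * (1 - x)\<^sup>2\<close> by the inequality of arithmetic and geometric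
        means.\<close>
      have "(y + z) * (1 - x) \<le> 1 + y * z - x * (y + z)"
        using mult_nonneg_nonneg[of "1 - y" "1 - z"] y z by (simp add: algebra_simps)
      moreover have pos: "0 < (y + z) * (1 - x)"
        using x y z by simp
      ultimately have sq: "((y + z) * (1 - x))\<^sup>2 \<le> (1 + y * z - x * (y + z))\<^sup>2" and K: "Kcoeff \<sigma> x y z < 0"
        using False unfolding Kcoeff_def by (simp_all add: power_mono)
      have "4 * y * z * (1 - x)\<^sup>2 \<le> ((y + z) * (1 - x))\<^sup>2"
        unfolding power_mult_distrib
      proof (rule mult_right_mono)
        show "4 * y * z \<le> (y + z)\<^sup>2"
          using zero_le_power2[of "y - z"] by (simp add: power2_sum power2_diff)
      qed simp
      also have "\<dots> \<le> (Kcoeff \<sigma> x y z)\<^sup>2"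
        using sq False unfolding Kcoeff_def by (simp add: power2_commute)
      finally show ?thesis
        using a K unfolding D_def by simp
    qed
  qed
  then obtain w :: "real ^ 3" where w: "\<And>l. w $ l \<ge> 0" "\<exists>l. w $ l > 0" "Gform \<sigma> r w \<le> 0" "\<sigma> = - 1 \<Longrightarrow> w $ 1 = 0"
    by blast
  \<comment> \<open>The segment starts at the second axis, where the form is positive. This axis has
    first entry 0, so the condition on \<open>v $ 1\<close> for \<sigma> = - 1 holds along the whole
    segment.\<close>
  define u where "u t = (1 - t) *\<^sub>R axis 2 1 + t *\<^sub>R w" for t :: real
  have "\<exists>t\<ge>0. t \<le> 1 \<and> Gform \<sigma> r (u t) = 0"
  proof (rule IVT2')
    show "Gform \<sigma> r (u 1) \<le> 0"
      using w(3) by (simp add: u_def)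
    show "0 \<le> Gform \<sigma> r (u 0)"
      using x y z by (simp add: u_def Gform_def axis_def flip: x_def y_def z_def)
    show "continuous_on {0..1} (\<lambda>t. Gform \<sigma> r (u t))"
      unfolding Gform_def u_def x_def[symmetric] y_def[symmetric] z_def[symmetric]
      using x y z by (intro continuous_intros) auto
  qed simp
  then obtain t where t: "0 \<le> t" "t \<le> 1" "Gform \<sigma> r (u t) = 0"
    by blast
  have u: "u t $ l = (1 - t) * (if l = 2 then 1 else 0) + t * w $ l" for l
    by (auto simp: u_def axis_def)
  show thesis
  proof (rule that[OF _ _ t(3)])
    show "u t $ l \<ge> 0" for l
      unfolding u using t w(1)[of l] by simp
    show "\<exists>l. u t $ l > 0"
    proof (cases "t = 1")
      case True
      then show ?thesis
        using w(2) by (simp add: u_def)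
    next
      case False
      then have "u t $ 2 > 0"
        unfolding u using t w(1)[of 2] by (simp add: add_pos_nonneg)
      then show ?thesis
        by blast
    qed
    show "u t $ 1 = 0" if "\<sigma> = - 1"
      unfolding u using w(4)[OF that] by simp
  qed
qed

text \<open>
  The weights in \<open>Lop\<close> are chosen so that its second-order part is \<open>\<Sum>\<^sub>k \<Sum>\<^sub>l v\<^sub>k v\<^sub>l \<partial>\<^sub>k \<partial>\<^sub>l\<close>.
\<close>

definition Aop :: "real \<Rightarrow> (real ^ 3 \<Rightarrow> real) \<Rightarrow> 3 \<Rightarrow> real ^ 3 \<Rightarrow> real"
  where "Aop \<beta> f l r = r $ l * (1 - r $ l) * partial_deriv l (partial_deriv l f) r
      + (2 * \<beta> - 2 * r $ l) * partial_deriv l f r - \<beta> * (1 - \<beta>) * f r"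

text \<open>The left-hand side of (2) or (3), averaged over the two orders of the mixed derivative.
  The zero-order term is present only for \<sigma> = - 1.\<close>

definition Bop :: "real \<Rightarrow> real \<Rightarrow> (real ^ 3 \<Rightarrow> real) \<Rightarrow> 3 \<Rightarrow> 3 \<Rightarrow> 3 \<Rightarrow> real ^ 3 \<Rightarrow> real"
  where "Bop \<beta> \<sigma> f j k l r =
      r $ j * r $ k * (partial_deriv j (partial_deriv k f) r + partial_deriv k (partial_deriv j f) r)
      + \<beta> * r $ j * partial_deriv j f r + \<beta> * r $ k * partial_deriv k f r
      - \<sigma> * \<beta> * r $ l * partial_deriv l f r + (1 - \<sigma>) / 2 * \<beta>\<^sup>2 * f r"

definition Lop :: "real \<Rightarrow> real \<Rightarrow> real ^ 3 \<Rightarrow> (real ^ 3 \<Rightarrow> real) \<Rightarrow> real ^ 3 \<Rightarrow> real"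
  where "Lop \<beta> \<sigma> v f r =
    (v $ 1)\<^sup>2 / (r $ 1 * (1 - r $ 1)) * Aop \<beta> f 1 r
    + (v $ 2)\<^sup>2 / (r $ 2 * (1 - r $ 2)) * Aop \<beta> f 2 r
    + (v $ 3)\<^sup>2 / (r $ 3 * (1 - r $ 3)) * Aop \<beta> f 3 r
    + v $ 1 * v $ 2 / (r $ 1 * r $ 2) * Bop \<beta> \<sigma> f 1 2 3 r
    + v $ 2 * v $ 3 / (r $ 2 * r $ 3) * Bop \<beta> \<sigma> f 2 3 1 r
    + v $ 3 * v $ 1 / (r $ 3 * r $ 1) * Bop \<beta> \<sigma> f 3 1 2 r"

text \<open>Each building block applied to \<open>F\<close> is a known multiple of \<open>G\<close>,
  so the whole operator annihilates \<open>F\<close> in an isotropic direction, whatever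
  \<open>G\<close> is.\<close>

lemma Lop_solution:
  assumes r: "r \<in> box 0 1" and eq1: "hypergeo_eqs \<beta> F G"
    and eq2: "\<sigma> = 1 \<and> rainbow_eqs \<beta> F G \<or> \<sigma> = - 1 \<and> neighbor_eqs \<beta> F G"
  shows "Lop \<beta> \<sigma> v F r = Gform \<sigma> r v * G r"
proof -
  have A: "Aop \<beta> F l r = (1 - r $ j) * (1 - r $ k) * G r" if "{j, k, l} = UNIV" for j k l
    using eq1[unfolded hypergeo_eqs_def, rule_format, OF that r] by (simp add: Aop_def)
  have B: "Bop \<beta> \<sigma> F j k l r = Kcoeff \<sigma> (r $ l) (r $ j) (r $ k) * G r" if jkl: "{j, k, l} = UNIV" for j k l
  proof -
    have kjl: "{k, j, l} = UNIV"
      using jkl by (simp add: insert_commute)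
    show ?thesis
      using eq2
    proof (elim disjE conjE)
      assume "\<sigma> = 1" "rainbow_eqs \<beta> F G"
      then show ?thesis
        using \<open>rainbow_eqs \<beta> F G\<close>[unfolded rainbow_eqs_def, rule_format, OF jkl r]
          \<open>rainbow_eqs \<beta> F G\<close>[unfolded rainbow_eqs_def, rule_format, OF kjl r]
        by (simp add: Bop_def Kcoeff_def algebra_simps)
    next
      assume "\<sigma> = - 1" "neighbor_eqs \<beta> F G"
      then show ?thesis
        using \<open>neighbor_eqs \<beta> F G\<close>[unfolded neighbor_eqs_def, rule_format, OF jkl r]
          \<open>neighbor_eqs \<beta> F G\<close>[unfolded neighbor_eqs_def, rule_format, OF kjl r]
        by (simp add: Bop_def Kcoeff_def algebra_simps)
    qed
  qed
  have perm: "{2, 3, 1 :: 3} = UNIV" "{3, 1, 2 :: 3} = UNIV" "{1, 2, 3 :: 3} = UNIV"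
    unfolding UNIV_3 by auto
  show ?thesis
    unfolding Lop_def A[OF perm(1)] A[OF perm(2)] A[OF perm(3)] B[OF perm(1)] B[OF perm(2)] B[OF perm(3)] Gform_def
    by (simp add: distrib_right mult.assoc)
qed

lemma partial_deriv_linear:
  assumes "Ck_on (Suc 0) S f1" "Ck_on (Suc 0) S f2" "Ck_on (Suc 0) S f3" "x \<in> S"
  shows "partial_deriv i (\<lambda>x. f1 x - s * f2 x - t * f3 x) x =
    partial_deriv i f1 x - s * partial_deriv i f2 x - t * partial_deriv i f3 x"
proof -
  have "((\<lambda>x. f1 x - s * f2 x - t * f3 x) has_derivative
      (\<lambda>v. (\<Sum>i\<in>UNIV. v $ i * partial_deriv i f1 x) - s * (\<Sum>i\<in>UNIV. v $ i * partial_deriv i f2 x)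
        - t * (\<Sum>i\<in>UNIV. v $ i * partial_deriv i f3 x))) (at x)"
    using assms by (intro has_derivative_diff has_derivative_mult_right Ck_on_SucD)
  from partial_deriv_eq[OF this] show ?thesis
    by simp
qed

lemma Ck_on_partial_deriv: "Ck_on (Suc k) S f \<Longrightarrow> Ck_on k S (partial_deriv i f)"
  by simp

lemma Lop_linear:
  assumes f: "Ck_on 2 (box 0 1) f1" "Ck_on 2 (box 0 1) f2" "Ck_on 2 (box 0 1) f3" and r: "r \<in> box 0 1"
  shows "Lop \<beta> \<sigma> v (\<lambda>r. f1 r - s * f2 r - t * f3 r) r =
    Lop \<beta> \<sigma> v f1 r - s * Lop \<beta> \<sigma> v f2 r - t * Lop \<beta> \<sigma> v f3 r"
proof -
  have f': "Ck_on (Suc (Suc 0)) (box 0 1) f1" "Ck_on (Suc (Suc 0)) (box 0 1) f2" "Ck_on (Suc (Suc 0)) (box 0 1) f3"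
    using f by (simp_all only: numeral_2_eq_2)
  note f1 = f'[THEN Ck_on_Suc_imp]
  have f2: "Ck_on (Suc 0) (box 0 1) (partial_deriv k f1)" "Ck_on (Suc 0) (box 0 1) (partial_deriv k f2)"
    "Ck_on (Suc 0) (box 0 1) (partial_deriv k f3)" for k
    by (rule f'[THEN Ck_on_partial_deriv])+
  note lin = partial_deriv_linear[OF f1]
  have lin2: "partial_deriv l (partial_deriv k (\<lambda>r. f1 r - s * f2 r - t * f3 r)) r =
      partial_deriv l (partial_deriv k f1) r - s * partial_deriv l (partial_deriv k f2) r
      - t * partial_deriv l (partial_deriv k f3) r" for k l
  proof -
    have "partial_deriv l (partial_deriv k (\<lambda>r. f1 r - s * f2 r - t * f3 r)) r =
        partial_deriv l (\<lambda>r. partial_deriv k f1 r - s * partial_deriv k f2 r - t * partial_deriv k f3 r) r"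
      by (rule partial_deriv_cong[OF open_box r]) (rule lin)
    also have "\<dots> = partial_deriv l (partial_deriv k f1) r - s * partial_deriv l (partial_deriv k f2) r
        - t * partial_deriv l (partial_deriv k f3) r"
      by (rule partial_deriv_linear[OF f2 r])
    finally show ?thesis .
  qed
  have A: "Aop \<beta> (\<lambda>r. f1 r - s * f2 r - t * f3 r) l r = Aop \<beta> f1 l r - s * Aop \<beta> f2 l r - t * Aop \<beta> f3 l r" for l
    unfolding Aop_def lin[OF r] lin2 by (simp add: algebra_simps)
  have B: "Bop \<beta> \<sigma> (\<lambda>r. f1 r - s * f2 r - t * f3 r) j k l r =
      Bop \<beta> \<sigma> f1 j k l r - s * Bop \<beta> \<sigma> f2 j k l r - t * Bop \<beta> \<sigma> f3 j k l r" for j k l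
  proof -
    define \<gamma> where "\<gamma> = (1 - \<sigma>) / 2 * \<beta>\<^sup>2"
    show ?thesis
      unfolding Bop_def lin[OF r] lin2 \<gamma>_def[symmetric] by (simp add: algebra_simps)
  qed
  have comb: "c * (y1 - s * y2 - t * y3) = c * y1 - s * (c * y2) - t * (c * y3)" for c y1 y2 y3 :: real
    by (simp add: algebra_simps)
  show ?thesis
    unfolding Lop_def A B comb by (simp add: distrib_left)
qed

text \<open>At a minimum with value zero both the function and its gradient vanish. Only the
  second-order part of the operator remains, and its weights leave exactly the Hessian in direction
  \<open>v\<close>.\<close>

lemma Lop_at_local_min:
  assumes W: "Ck_on 2 (box 0 1) W" and r: "r \<in> box 0 1" and min: "\<And>y. y \<in> box 0 1 \<Longrightarrow> 0 \<le> W y" and "W r = 0"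
  shows "Lop \<beta> \<sigma> v W r \<ge> 0"
proof -
  have min': "\<And>y. y \<in> box 0 1 \<Longrightarrow> W r \<le> W y"
    using min assms(4) by simp
  note so = local_min_second_order[OF open_box W r min']
  have r01: "r $ l \<noteq> 0" "1 - r $ l \<noteq> 0" for l
    using r by (auto simp: mem_box_cart less_le)
  have A: "(v $ l)\<^sup>2 / (r $ l * (1 - r $ l)) * Aop \<beta> W l r = v $ l * v $ l * partial_deriv l (partial_deriv l W) r" for l
    using r01[of l] assms(4) so(1) by (simp add: Aop_def power2_eq_square)
  have B: "v $ j * v $ k / (r $ j * r $ k) * Bop \<beta> \<sigma> W j k l r =
      v $ j * v $ k * (partial_deriv j (partial_deriv k W) r + partial_deriv k (partial_deriv j W) r)" for j k l
    using r01 assms(4) so(1) by (simp add: Bop_def)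
  have "Lop \<beta> \<sigma> v W r = (\<Sum>k\<in>UNIV. \<Sum>l\<in>UNIV. v $ k * v $ l * partial_deriv l (partial_deriv k W) r)"
    unfolding Lop_def A B by (simp add: sum_3 algebra_simps)
  with so(2) show ?thesis
    by simp
qed

lemma Lop_monom3:
  assumes r: "r \<in> box 0 1"
  shows "Aop \<beta> (monom3 e) l r = (e l * (e l - 1) * (1 - r $ l) / r $ l + (2 * \<beta> - 2 * r $ l) * e l / r $ l - \<beta> * (1 - \<beta>)) * monom3 e r"
    and "j \<noteq> k \<Longrightarrow> Bop \<beta> \<sigma> (monom3 e) j k l r = (2 * e j * e k + \<beta> * e j + \<beta> * e k - \<sigma> * \<beta> * e l + (1 - \<sigma>) / 2 * \<beta>\<^sup>2) * monom3 e r"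
proof -
  have r0: "r $ l \<noteq> 0" for l
    using r by (auto simp: mem_box_cart less_le)
  show "Aop \<beta> (monom3 e) l r = (e l * (e l - 1) * (1 - r $ l) / r $ l + (2 * \<beta> - 2 * r $ l) * e l / r $ l - \<beta> * (1 - \<beta>)) * monom3 e r"
    unfolding Aop_def partial_deriv_monom3[OF r] using r0[of l] by (simp add: field_simps)
  define \<gamma> where "\<gamma> = (1 - \<sigma>) / 2 * \<beta>\<^sup>2"
  show "Bop \<beta> \<sigma> (monom3 e) j k l r = (2 * e j * e k + \<beta> * e j + \<beta> * e k - \<sigma> * \<beta> * e l + (1 - \<sigma>) / 2 * \<beta>\<^sup>2) * monom3 e r"
    if "j \<noteq> k"
    unfolding Bop_def partial_deriv_monom3[OF r] \<gamma>_def[symmetric] using r0 that by (simp add: field_simps)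
qed

lemma monom3_pos: "monom3 e r > 0"
  by (simp add: monom3_def)

section \<open>Supersolutions and subsolutions\<close>

lemma Lop_nonzero_direction:
  fixes r v :: "real ^ 3"
  assumes r: "r \<in> box 0 1" and v: "\<And>l. v $ l \<ge> 0" "\<exists>l. v $ l > 0"
  shows "(v $ 1)\<^sup>2 / (r $ 1 * (1 - r $ 1)) \<ge> 0" "(v $ 2)\<^sup>2 / (r $ 2 * (1 - r $ 2)) \<ge> 0"
    "(v $ 3)\<^sup>2 / (r $ 3 * (1 - r $ 3)) \<ge> 0"
    "(v $ 1)\<^sup>2 / (r $ 1 * (1 - r $ 1)) + (v $ 2)\<^sup>2 / (r $ 2 * (1 - r $ 2)) + (v $ 3)\<^sup>2 / (r $ 3 * (1 - r $ 3)) > 0"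
    "v $ j * v $ k / (r $ j * r $ k) \<ge> 0"
proof -
  have r01: "r $ l > 0" "1 - r $ l > 0" for l
    using r by (simp_all add: mem_box_cart)
  have nn: "(v $ l)\<^sup>2 / (r $ l * (1 - r $ l)) \<ge> 0" for l
    using r01[of l] by simp
  show "(v $ 1)\<^sup>2 / (r $ 1 * (1 - r $ 1)) \<ge> 0" "(v $ 2)\<^sup>2 / (r $ 2 * (1 - r $ 2)) \<ge> 0"
    "(v $ 3)\<^sup>2 / (r $ 3 * (1 - r $ 3)) \<ge> 0"
    by (rule nn)+
  obtain l where "v $ l > 0"
    using v(2) by blast
  then have "(v $ l)\<^sup>2 / (r $ l * (1 - r $ l)) > 0"
    using r01[of l] by simp
  then show "(v $ 1)\<^sup>2 / (r $ 1 * (1 - r $ 1)) + (v $ 2)\<^sup>2 / (r $ 2 * (1 - r $ 2)) + (v $ 3)\<^sup>2 / (r $ 3 * (1 - r $ 3)) > 0"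
    using nn[of 1] nn[of 2] nn[of 3] exhaust_3[of l] by (elim disjE) simp_all
  show "v $ j * v $ k / (r $ j * r $ k) \<ge> 0"
    using v(1) r01(1) by (intro divide_nonneg_pos mult_nonneg_nonneg mult_pos_pos)
qed

text \<open>The exponents are chosen to make every mixed contribution vanish, leaving the diagonal
  ones, whose sign is explicit. Two choices are made because -\<beta>(1 - \<beta>) is negative only
  for \<beta> < 1.\<close>

lemma supersolution:
  assumes \<beta>: "\<beta> > 1 / 2" and \<sigma>: "\<sigma> = 1 \<or> \<sigma> = - 1"
  obtains e :: "3 \<Rightarrow> real" where
    "\<And>r v. r \<in> box 0 1 \<Longrightarrow> (\<And>l. v $ l \<ge> 0) \<Longrightarrow> \<exists>l. v $ l > 0 \<Longrightarrow> (\<sigma> = - 1 \<Longrightarrow> v $ 1 = 0) \<Longrightarrow>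
      Lop \<beta> \<sigma> v (monom3 e) r < 0"
proof (cases "\<beta> < 1")
  case True
  \<comment> \<open>For \<sigma> = 1 a constant works, because \<open>Bop\<close> then has no
    zero-order term. For \<sigma> = - 1 the condition \<open>v $ 1 = 0\<close> leaves only the mixed
    pair 2, 3, whose term \<open>\<beta>\<^sup>2\<close> is cancelled by the exponent - \<beta> of
    the first cross-ratio.\<close>
  define e :: "3 \<Rightarrow> real" where "e = (\<lambda>l. if \<sigma> = - 1 \<and> l = 1 then - \<beta> else 0)"
  show thesis
  proof (rule that[of e])
    fix r v :: "real ^ 3"
    assume r: "r \<in> box 0 1" and v: "\<And>l. v $ l \<ge> 0" "\<exists>l. v $ l > 0" "\<sigma> = - 1 \<Longrightarrow> v $ 1 = 0"
    note w = Lop_nonzero_direction[OF r v(1,2)]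
    have "Lop \<beta> \<sigma> v (monom3 e) r = - (\<beta> * (1 - \<beta>) * monom3 e r) * ((v $ 1)\<^sup>2 / (r $ 1 * (1 - r $ 1))
        + (v $ 2)\<^sup>2 / (r $ 2 * (1 - r $ 2)) + (v $ 3)\<^sup>2 / (r $ 3 * (1 - r $ 3)))"
    proof -
      have A: "(v $ l)\<^sup>2 / (r $ l * (1 - r $ l)) * Aop \<beta> (monom3 e) l r = - (\<beta> * (1 - \<beta>) * monom3 e r) * ((v $ l)\<^sup>2 / (r $ l * (1 - r $ l)))" for l
        unfolding Lop_monom3(1)[OF r] using v(3) by (auto simp: e_def)
      have B: "v $ j * v $ k / (r $ j * r $ k) * Bop \<beta> \<sigma> (monom3 e) j k l r = 0"
        if "{j, k, l} = UNIV" "j \<noteq> k" for j k l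
      proof (cases "\<sigma> = 1")
        case True
        then show ?thesis
          unfolding Lop_monom3(2)[OF r that(2)] by (simp add: e_def)
      next
        case False
        then have s: "\<sigma> = - 1"
          using \<sigma> by simp
        have "j = 1 \<or> k = 1 \<or> l = 1"
          using that(1) by auto
        then show ?thesis
          unfolding Lop_monom3(2)[OF r that(2)] using v(3)[OF s] that s
          by (auto simp: e_def power2_eq_square)
      qed
      have perm: "{2, 3, 1 :: 3} = UNIV" "{3, 1, 2 :: 3} = UNIV" "{1, 2, 3 :: 3} = UNIV"
        unfolding UNIV_3 by auto
      show ?thesis
        unfolding Lop_def A by (subst B[OF perm(1)], simp, subst B[OF perm(2)], simp, subst B[OF perm(3)], simp)
          (simp add: distrib_left)
    qed
    also have "\<dots> < 0"
      using w(4) True \<beta> monom3_pos[of e r] by (intro mult_neg_pos) auto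
    finally show "Lop \<beta> \<sigma> v (monom3 e) r < 0" .
  qed
next
  case False
  \<comment> \<open>In the partition function \<open>F\<close> is multiplied by the product of the
    cross-ratios to the power 2/\<kappa> = \<beta>/2. This monomial is the inverse of that factor,
    so it corresponds to the product of the powers of the link lengths alone.\<close>
  define e :: "3 \<Rightarrow> real" where "e = (\<lambda>l. - \<beta> / 2)"
  show thesis
  proof (rule that[of e])
    fix r v :: "real ^ 3"
    assume r: "r \<in> box 0 1" and v: "\<And>l. v $ l \<ge> 0" "\<exists>l. v $ l > 0"
    have r01: "r $ l > 0" "1 - r $ l > 0" for l
      using r by (simp_all add: mem_box_cart)
    define C where "C = \<beta> / 2 * (3 * \<beta> / 2 - 1) * monom3 e r"
    have C: "C > 0"
      unfolding C_def using False monom3_pos[of e r] by simp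
    have A: "(v $ l)\<^sup>2 / (r $ l * (1 - r $ l)) * Aop \<beta> (monom3 e) l r = - C * (v $ l / r $ l)\<^sup>2" for l
    proof -
      have "e l * (e l - 1) * (1 - r $ l) / r $ l + (2 * \<beta> - 2 * r $ l) * e l / r $ l - \<beta> * (1 - \<beta>)
          = - (\<beta> / 2 * (3 * \<beta> / 2 - 1)) * ((1 - r $ l) / r $ l)"
        using r01(1)[of l] by (simp add: e_def divide_simps) (simp add: algebra_simps)
      then have "Aop \<beta> (monom3 e) l r = - C * ((1 - r $ l) / r $ l)"
        unfolding Lop_monom3(1)[OF r] C_def by simp
      then show ?thesis
        using r01[of l] by (simp add: power2_eq_square)
    qed
    have B: "Bop \<beta> \<sigma> (monom3 e) j k l r = 0" if "j \<noteq> k" for j k l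
      unfolding Lop_monom3(2)[OF r that] using \<sigma> by (auto simp: e_def power2_eq_square)
    have "Lop \<beta> \<sigma> v (monom3 e) r = - C * ((v $ 1 / r $ 1)\<^sup>2 + (v $ 2 / r $ 2)\<^sup>2 + (v $ 3 / r $ 3)\<^sup>2)"
      unfolding Lop_def A using B[of 1 2 3] B[of 2 3 1] B[of 3 1 2] by (simp add: distrib_left)
    also have "\<dots> < 0"
    proof -
      obtain l where "v $ l > 0"
        using v(2) by blast
      then have "(v $ l / r $ l)\<^sup>2 > 0"
        using r01(1)[of l] by simp
      then have "(v $ 1 / r $ 1)\<^sup>2 + (v $ 2 / r $ 2)\<^sup>2 + (v $ 3 / r $ 3)\<^sup>2 > 0"
        using exhaust_3[of l] by (elim disjE) (simp_all add: add_pos_nonneg add_nonneg_pos)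
      with C show ?thesis
        by (intro mult_neg_pos) auto
    qed
    finally show "Lop \<beta> \<sigma> v (monom3 e) r < 0" .
  qed
qed

text \<open>For a large exponent \<open>M\<close> the second-order contribution, of size
  \<open>M\<^sup>2 * (1 - r $ l) / r $ l\<close>, dominates. The bound
  \<open>r $ l \<le> 1 - \<eta>\<close> keeps it away from zero, so \<open>M\<close> depends on
  \<eta>.\<close>

lemma subsolution:
  assumes \<beta>: "\<beta> > 1 / 2" and \<sigma>: "\<sigma> = 1 \<or> \<sigma> = - 1" and \<eta>: "0 < \<eta>"
  obtains M :: real where "M > 0"
    "\<And>r v. r \<in> box 0 1 \<Longrightarrow> (\<And>l. r $ l \<le> 1 - \<eta>) \<Longrightarrow> (\<And>l. v $ l \<ge> 0) \<Longrightarrow> \<exists>l. v $ l > 0 \<Longrightarrow>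
      Lop \<beta> \<sigma> v (monom3 (\<lambda>l. M)) r > 0"
proof -
  \<comment> \<open>After multiplication by \<open>r $ l\<close>, the competing terms in
    \<open>Aop\<close> are at most \<open>2 * M\<close> and \<open>M * \<beta>\<close>; they are
    beaten by \<open>M * M * \<eta>\<close>.\<close>
  define M where "M = (2 + \<beta>) / \<eta> + 1"
  have M: "M > 1" "M * \<eta> > 2 + \<beta>"
    using \<eta> \<beta> by (simp_all add: M_def field_simps)
  show thesis
  proof (rule that[of M])
    fix r v :: "real ^ 3"
    assume r: "r \<in> box 0 1" and r\<eta>: "\<And>l. r $ l \<le> 1 - \<eta>" and v: "\<And>l. v $ l \<ge> 0" "\<exists>l. v $ l > 0"
    note w = Lop_nonzero_direction[OF r v]
    have A: "Aop \<beta> (monom3 (\<lambda>l. M)) l r > 0" for l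
    proof -
      define t where "t = r $ l"
      have t: "0 < t" "t < 1" "\<eta> \<le> 1 - t"
        using r r\<eta>[of l] by (simp_all add: mem_box_cart t_def)
      have "M * (2 + \<beta>) < M * (M * \<eta>)"
        using M by simp
      also have "\<dots> \<le> M * (M * (1 - t))"
        using M t by simp
      finally have "M * (2 + \<beta>) < M * M * (1 - t)"
        by (simp add: mult.assoc)
      moreover have "M * (1 - 2 * \<beta> + t) \<le> M * 2"
        using M(1) t \<beta> by simp
      moreover have "t * (\<beta> * (1 - \<beta>)) \<le> M * \<beta>"
      proof -
        have "t * (1 - \<beta>) \<le> t * 1"
          using t \<beta> by (intro mult_left_mono) auto
        also have "\<dots> \<le> M"
          using t M by simp
        finally have "\<beta> * (t * (1 - \<beta>)) \<le> \<beta> * M"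
          using \<beta> by (intro mult_left_mono) auto
        then show ?thesis
          by (simp add: mult_ac)
      qed
      ultimately have "M * M * (1 - t) - M * (1 - 2 * \<beta> + t) - t * (\<beta> * (1 - \<beta>)) > 0"
        unfolding distrib_left by linarith
      also have "M * M * (1 - t) - M * (1 - 2 * \<beta> + t) - t * (\<beta> * (1 - \<beta>))
          = t * (M * (M - 1) * (1 - t) / t + (2 * \<beta> - 2 * t) * M / t - \<beta> * (1 - \<beta>))"
        using t by (simp add: divide_simps) (simp add: algebra_simps)
      finally show ?thesis
        unfolding Lop_monom3(1)[OF r] t_def[symmetric] using t(1) monom3_pos by (simp add: zero_less_mult_iff)
    qed
    have B: "Bop \<beta> \<sigma> (monom3 (\<lambda>l. M)) j k l r \<ge> 0" if "j \<noteq> k" for j k l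
    proof -
      have "0 \<le> 2 * M * M + \<beta> * M + \<beta> * M - \<sigma> * \<beta> * M + (1 - \<sigma>) / 2 * \<beta>\<^sup>2"
        using \<sigma> M(1) \<beta> by auto
      then show ?thesis
        unfolding Lop_monom3(2)[OF r that] using monom3_pos less_imp_le by (intro mult_nonneg_nonneg) auto
    qed
    have AA: "w1 * a1 + w2 * a2 + w3 * a3 > 0"
      if "w1 \<ge> 0" "w2 \<ge> 0" "w3 \<ge> 0" "w1 + w2 + w3 > 0" "a1 > 0" "a2 > 0" "a3 > 0" for w1 w2 w3 a1 a2 a3 :: real
    proof -
      have "w1 * a1 \<ge> 0" "w2 * a2 \<ge> 0" "w3 * a3 \<ge> 0" "w1 > 0 \<or> w2 > 0 \<or> w3 > 0"
        using that by auto
      moreover have "w1 > 0 \<Longrightarrow> w1 * a1 > 0" "w2 > 0 \<Longrightarrow> w2 * a2 > 0" "w3 > 0 \<Longrightarrow> w3 * a3 > 0"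
        using that by auto
      ultimately show ?thesis
        by linarith
    qed
    have "v $ 1 * v $ 2 / (r $ 1 * r $ 2) * Bop \<beta> \<sigma> (monom3 (\<lambda>l. M)) 1 2 3 r \<ge> 0"
      "v $ 2 * v $ 3 / (r $ 2 * r $ 3) * Bop \<beta> \<sigma> (monom3 (\<lambda>l. M)) 2 3 1 r \<ge> 0"
      "v $ 3 * v $ 1 / (r $ 3 * r $ 1) * Bop \<beta> \<sigma> (monom3 (\<lambda>l. M)) 3 1 2 r \<ge> 0"
      by (intro mult_nonneg_nonneg w(5) B; simp)+
    with AA[OF w(1-4) A A A] show "Lop \<beta> \<sigma> v (monom3 (\<lambda>l. M)) r > 0"
      unfolding Lop_def by (smt (verit))
  qed (use M in simp)
qed

text \<open>At the minimum of the quotient by the supersolution, the function \<open>W\<close>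
  touches zero from above, so the operator is nonnegative on it. In an isotropic direction, however,
  \<open>F\<close> contributes nothing and both comparison monomials contribute negatively.\<close>

lemma F_positive:
  fixes F G E :: "real ^ 3 \<Rightarrow> real" and \<sigma> :: real
  assumes \<beta>: "\<beta> > 1 / 2" and F: "smooth_on (box 0 1) F" and eq1: "hypergeo_eqs \<beta> F G"
    and eq2: "\<sigma> = 1 \<and> rainbow_eqs \<beta> F G \<or> \<sigma> = - 1 \<and> neighbor_eqs \<beta> F G"
    and E: "extends_continuously_by F E" and pos: "\<forall>r\<in>frontier (cbox 0 1). E r > 0"
    and r: "r \<in> box 0 1"
  shows "F r > 0"
proof (rule ccontr)
  assume neg: "\<not> F r > 0"
  have \<sigma>: "\<sigma> = 1 \<or> \<sigma> = - 1"
    using eq2 by blast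
  have Ec: "continuous_on (cbox 0 1) E" and EF: "\<And>r. r \<in> box 0 1 \<Longrightarrow> E r = F r"
    using E by (simp_all add: extends_continuously_by_def)
  have cb: "y \<in> cbox 0 1" if "y \<in> box 0 1" for y :: "real ^ 3"
    using that box_subset_cbox by blast
  have "\<exists>\<delta>>0. \<forall>y\<in>frontier (cbox (0 :: real ^ 3) 1). \<delta> \<le> E y"
  proof (cases "frontier (cbox (0 :: real ^ 3) 1) = {}")
    case True
    then show ?thesis
      by (intro exI[of _ 1]) auto
  next
    case False
    have "compact (frontier (cbox (0 :: real ^ 3) 1))"
      by (intro compact_frontier compact_cbox)
    moreover have "continuous_on (frontier (cbox (0 :: real ^ 3) 1)) E"
      using Ec by (rule continuous_on_subset) (rule frontier_subset_closed[OF closed_cbox])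
    ultimately obtain y where "y \<in> frontier (cbox (0 :: real ^ 3) 1)" "\<forall>z\<in>frontier (cbox 0 1). E y \<le> E z"
      using continuous_attains_inf[OF _ False] by blast
    then show ?thesis
      using pos by blast
  qed
  then obtain \<delta> where \<delta>: "\<delta> > 0" "\<And>y. y \<in> frontier (cbox 0 1) \<Longrightarrow> \<delta> \<le> E y"
    by blast
  \<comment> \<open>This sublevel set misses the boundary, where \<open>E\<close> is at least
    \<delta>. It is therefore compact inside the open cube, where the monomials are continuous and
    positive and the cross-ratios are bounded away from 1.\<close>
  define K where "K = {y \<in> cbox 0 1. E y \<le> \<delta> / 2}"
  have "K = cbox 0 1 \<inter> E -` {..\<delta> / 2}"
    by (auto simp: K_def)
  then have "closed K"
    using continuous_closed_preimage[OF Ec closed_cbox closed_atMost] by simp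
  moreover have "bounded K"
    using bounded_cbox by (rule bounded_subset) (auto simp: K_def)
  ultimately have K: "compact K"
    by (simp add: compact_eq_bounded_closed)
  have K_box: "K \<subseteq> box 0 1"
  proof
    fix y assume y: "y \<in> K"
    then have "y \<notin> frontier (cbox 0 1)"
      using \<delta>(1) \<delta>(2)[of y] by (auto simp: K_def)
    with y show "y \<in> box 0 1"
      by (simp add: K_def frontier_def interior_cbox)
  qed
  have rK: "r \<in> K"
    using r neg \<delta>(1) cb EF by (simp add: K_def)
  have "\<exists>\<eta>>0. \<forall>y\<in>K. y $ l \<le> 1 - \<eta>" for l
  proof -
    obtain y where y: "y \<in> K" "\<forall>z\<in>K. z $ l \<le> y $ l"
      using continuous_attains_sup[OF K _ continuous_on_component[OF continuous_on_id, of K l]] rK by auto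
    have "y $ l < 1"
      using y(1) K_box by (auto simp: mem_box_cart)
    with y(2) show ?thesis
      by (intro exI[of _ "1 - y $ l"]) auto
  qed
  then obtain \<eta>' where \<eta>': "\<And>l. \<eta>' l > 0" "\<And>l y. y \<in> K \<Longrightarrow> y $ l \<le> 1 - \<eta>' l"
    by metis
  define \<eta> where "\<eta> = Min (range \<eta>')"
  have \<eta>: "\<eta> > 0" "\<And>l y. y \<in> K \<Longrightarrow> y $ l \<le> 1 - \<eta>"
  proof -
    show "\<eta> > 0"
      unfolding \<eta>_def using \<eta>'(1) by (subst Min_gr_iff) auto
    have "\<eta> \<le> \<eta>' l" for l
      unfolding \<eta>_def by (rule Min_le) auto
    then show "y $ l \<le> 1 - \<eta>" if "y \<in> K" for l y
      using \<eta>'(2)[OF that, of l] by (smt (verit))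
  qed
  obtain M where M: "M > 0" and sub: "\<And>r v. r \<in> box 0 1 \<Longrightarrow> (\<And>l. r $ l \<le> 1 - \<eta>) \<Longrightarrow> (\<And>l. v $ l \<ge> 0) \<Longrightarrow> \<exists>l. v $ l > 0 \<Longrightarrow>
      Lop \<beta> \<sigma> v (monom3 (\<lambda>l. M)) r > 0"
    using subsolution[OF \<beta> \<sigma> \<eta>(1)] by blast
  obtain e where super: "\<And>r v. r \<in> box 0 1 \<Longrightarrow> (\<And>l. v $ l \<ge> 0) \<Longrightarrow> \<exists>l. v $ l > 0 \<Longrightarrow> (\<sigma> = - 1 \<Longrightarrow> v $ 1 = 0) \<Longrightarrow>
      Lop \<beta> \<sigma> v (monom3 e) r < 0"
    using supersolution[OF \<beta> \<sigma>] by blast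
  let ?F0 = "monom3 e" and ?F1 = "monom3 (\<lambda>l. M)"
  have F1_le: "?F1 y \<le> 1" if "y \<in> box 0 1" for y
  proof -
    have "(\<Sum>l\<in>UNIV. M * ln (y $ l)) \<le> 0"
    proof (rule sum_nonpos)
      fix l
      have "0 < y $ l" "y $ l < 1"
        using that by (simp_all add: mem_box_cart)
      then show "M * ln (y $ l) \<le> 0"
        using M by (intro mult_nonneg_nonpos) auto
    qed
    then show ?thesis
      by (simp add: monom3_def)
  qed
  \<comment> \<open>The subsolution is at most 1, so a quarter of \<delta> keeps \<open>F\<close>
    minus its multiple positive outside \<open>K\<close>, where \<open>F\<close> exceeds
    \<delta>/2.\<close>
  define \<epsilon> where "\<epsilon> = \<delta> / 4"
  have \<epsilon>: "\<epsilon> > 0"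
    using \<delta>(1) by (simp add: \<epsilon>_def)
  define Q where "Q y = (F y - \<epsilon> * ?F1 y) / ?F0 y" for y
  have mono_cont: "continuous_on K (monom3 f)" for f
    using Ck_on_monom3[of 0 f] K_box continuous_on_subset by auto
  have Fcont: "continuous_on K F"
    using F K_box continuous_on_subset unfolding smooth_on_def by (metis Ck_on.simps(1))
  have "continuous_on K Q"
    unfolding Q_def[abs_def] using less_imp_neq[OF monom3_pos]
    by (intro continuous_on_divide continuous_on_diff continuous_on_mult continuous_on_const mono_cont Fcont) (metis)
  then obtain p where p: "p \<in> K" "\<And>y. y \<in> K \<Longrightarrow> Q p \<le> Q y"
    using continuous_attains_inf[OF K] rK by blast
  define m where "m = Q p"
  \<comment> \<open>Only \<open>F r \<le> 0\<close> is known; the subtracted positive term makes the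
    value strictly negative, so the minimum \<open>m\<close> is negative even if \<open>F r\<close>
    is 0.\<close>
  have "F r - \<epsilon> * ?F1 r < 0"
    using neg \<epsilon> monom3_pos[of "\<lambda>l. M" r] by (smt (verit) mult_pos_pos)
  then have "Q r < 0"
    unfolding Q_def using monom3_pos by (simp add: divide_neg_pos)
  then have m: "m < 0"
    using p(2)[OF rK] by (simp add: m_def)
  have pb: "p \<in> box 0 1"
    using p(1) K_box by blast
  define W where "W = (\<lambda>y. F y - \<epsilon> * ?F1 y - m * ?F0 y)"
  have W_min: "0 \<le> W y" if y: "y \<in> box 0 1" for y
  proof (cases "y \<in> K")
    case True
    then have "m \<le> (F y - \<epsilon> * ?F1 y) / ?F0 y"
      using p(2) by (simp add: m_def Q_def)
    then show ?thesis
      unfolding W_def using monom3_pos[of e y] by (simp add: pos_le_divide_eq)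
  next
    case False
    then have "F y > \<delta> / 2"
      using y cb EF by (force simp: K_def)
    moreover have "\<epsilon> * ?F1 y \<le> \<epsilon>"
      using F1_le[OF y] \<epsilon> by simp
    moreover have "m * ?F0 y < 0"
      using m monom3_pos by (intro mult_neg_pos)
    ultimately show ?thesis
      unfolding W_def \<epsilon>_def using \<delta>(1) by linarith
  qed
  have Wp: "W p = 0"
    unfolding W_def m_def Q_def using monom3_pos[of e p] by simp
  obtain v :: "real ^ 3" where v: "\<And>l. v $ l \<ge> 0" "\<exists>l. v $ l > 0" "Gform \<sigma> p v = 0" "\<sigma> = - 1 \<Longrightarrow> v $ 1 = 0"
    using null_direction[OF pb \<sigma>] by blast
  have F2: "Ck_on 2 (box 0 1) F"
    using F by (simp add: smooth_on_def)
  have "Ck_on 2 (box 0 1) W"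
    unfolding W_def diff_conv_add_uminus minus_mult_left
    by (intro Ck_on_add[OF open_box] Ck_on_mult[OF open_box] Ck_on_const Ck_on_monom3 F2)
  then have "0 \<le> Lop \<beta> \<sigma> v W p"
    using pb W_min Wp by (rule Lop_at_local_min)
  also have "Lop \<beta> \<sigma> v W p = Lop \<beta> \<sigma> v F p - \<epsilon> * Lop \<beta> \<sigma> v ?F1 p - m * Lop \<beta> \<sigma> v ?F0 p"
    unfolding W_def by (rule Lop_linear[OF F2 Ck_on_monom3 Ck_on_monom3 pb])
  also have "Lop \<beta> \<sigma> v F p = 0"
    unfolding Lop_solution[OF pb eq1 eq2] v(3) by simp
  also have "0 - \<epsilon> * Lop \<beta> \<sigma> v ?F1 p - m * Lop \<beta> \<sigma> v ?F0 p < 0"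
  proof -
    have "\<epsilon> * Lop \<beta> \<sigma> v ?F1 p > 0"
      using \<epsilon> sub[OF pb \<eta>(2)[OF p(1)] v(1,2)] by simp
    moreover have "m * Lop \<beta> \<sigma> v ?F0 p > 0"
      using m super[OF pb v(1,2,4)] by (simp add: mult_neg_neg)
    ultimately show ?thesis
      by linarith
  qed
  finally show False
    by simp
qed

section \<open>Positivity on the chamber and the common treatment of both settings\<close>

lemma pf3_positive:
  assumes or: "oriented \<sigma> a b" "\<sigma> = 1 \<or> \<sigma> = - 1" and x: "x \<in> chamber" and c: "c > 0"
    and F: "\<And>r. r \<in> box 0 1 \<Longrightarrow> F r > 0"
  shows "pf3 \<kappa> h c F a b x > 0"
  unfolding pf3_oriented[OF or x]
proof (intro mult_pos_pos c F)
  show "(\<chi> l. exp (if l = 1 then \<sigma> * log_ratio (of_nat (a 1)) (of_nat (b 1)) (of_nat (a 2)) (of_nat (b 2)) x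
          else if l = 2 then \<sigma> * log_ratio (of_nat (a 2)) (of_nat (b 2)) (of_nat (a 3)) (of_nat (b 3)) x
          else \<sigma> * log_ratio (of_nat (a 3)) (of_nat (b 3)) (of_nat (a 1)) (of_nat (b 1)) x)) \<in> (box 0 1 :: (real ^ 3) set)"
    using link_cross_ratio_oriented(3)[OF or x, of 1 2] link_cross_ratio_oriented(3)[OF or x, of 2 3]
      link_cross_ratio_oriented(3)[OF or x, of 3 1]
    by (auto simp: mem_box_cart)
qed simp

text \<open>Replaces the distinction of rainbow and neighbor patterns by the sign \<sigma>, passing
  to an oriented labelling that defines the same partition function.\<close>

lemma setting_orientation:
  assumes lab: "labelling 3 \<alpha> a b"
    and setting: "rainbow_setting \<beta> \<alpha> F G \<or> neighbor_setting \<beta> \<alpha> F G"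
  obtains \<sigma> a' b' where "oriented \<sigma> a' b'" "\<sigma> = 1 \<or> \<sigma> = - 1" "labelling 3 \<alpha> a' b'"
    "\<And>\<kappa> h c F. pf3 \<kappa> h c F a b = pf3 \<kappa> h c F a' b'"
    "\<sigma> = 1 \<and> rainbow_eqs \<beta> F G \<or> \<sigma> = - 1 \<and> neighbor_eqs \<beta> F G"
    "smooth_on (box 0 1) F" "hypergeo_eqs \<beta> F G"
proof -
  obtain \<sigma> a' b' where 1: "oriented \<sigma> a' b'" "\<sigma> = 1 \<or> \<sigma> = - 1"
    "\<sigma> = 1 \<and> rainbow_eqs \<beta> F G \<or> \<sigma> = - 1 \<and> neighbor_eqs \<beta> F G"
    and sw: "\<And>j. j \<in> {1..3} \<Longrightarrow> a' j = a j \<and> b' j = b j \<or> a' j = b j \<and> b' j = a j"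
    using setting rainbow_orientation[OF lab] neighbor_orientation[OF lab]
    unfolding rainbow_setting_def neighbor_setting_def by metis
  have "{a' j, b' j} = {a j, b j}" if "j \<in> {1..3}" for j
    using sw[OF that] by auto
  then have "labelling 3 \<alpha> a' b'"
    using lab unfolding labelling_def by simp
  moreover have "pf3 \<kappa> h c F a b = pf3 \<kappa> h c F a' b'" for \<kappa> h c F
    using pf3_swap[OF sw] by simp
  moreover have "smooth_on (box 0 1) F" "hypergeo_eqs \<beta> F G"
    using setting by (auto simp: rainbow_setting_def neighbor_setting_def)
  ultimately show thesis
    using that 1 by blast
qed

theorem theorem2p1:
  fixes \<kappa> \<beta> h :: real
    and \<alpha> :: "nat set set"
    and a b :: "nat \<Rightarrow> nat"
  assumes "0 < \<kappa>" and "\<kappa> < 8"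
    and "\<beta> = 4 / \<kappa>"
    and "h = (6 - \<kappa>) / (2 * \<kappa>)"
    and "\<alpha> \<in> LP 3"
    and "labelling 3 \<alpha> a b"
  shows
    "(\<forall>F G c. rainbow_setting \<beta> \<alpha> F G \<longrightarrow> c > 0 \<longrightarrow>
        (let Z = pf3 \<kappa> h c F a b in
          smooth_on chamber Z \<and> satisfies_PDE \<kappa> h Z \<and> satisfies_COV h Z)) \<and>
     (\<forall>F G c. neighbor_setting \<beta> \<alpha> F G \<longrightarrow> c > 0 \<longrightarrow>
        (let Z = pf3 \<kappa> h c F a b in
          smooth_on chamber Z \<and> satisfies_PDE \<kappa> h Z \<and> satisfies_COV h Z)) \<and>
     (\<forall>F G E cF. rainbow_setting \<beta> \<alpha> F G \<or> neighbor_setting \<beta> \<alpha> F G \<longrightarrow>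
        extends_continuously_by F E \<longrightarrow> cF > 0 \<longrightarrow>
        (\<forall>r\<in>{0<..<1}.
           E (vector [r, 1, 1]) = cF * hyp2F1 (1 - \<beta>) \<beta> (2 * \<beta>) r \<and>
           E (vector [1, r, 1]) = cF * hyp2F1 (1 - \<beta>) \<beta> (2 * \<beta>) r \<and>
           E (vector [1, 1, r]) = cF * hyp2F1 (1 - \<beta>) \<beta> (2 * \<beta>) r) \<longrightarrow>
        (let c = inverse cF * inverse (hyp2F1 (1 - \<beta>) \<beta> (2 * \<beta>) 1) in
          satisfies_ASY \<kappa> h \<alpha> (pf3 \<kappa> h c F a b))) \<and>
     (\<forall>F G E c. rainbow_setting \<beta> \<alpha> F G \<or> neighbor_setting \<beta> \<alpha> F G \<longrightarrow>
        extends_continuously_by F E \<longrightarrow> (\<forall>r\<in>frontier (cbox 0 1). E r > 0) \<longrightarrow> c > 0 \<longrightarrow>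
        (\<forall>x\<in>chamber. pf3 \<kappa> h c F a b x > 0))"
proof -
  have i: "smooth_on chamber (pf3 \<kappa> h c F a b)" "satisfies_PDE \<kappa> h (pf3 \<kappa> h c F a b)"
      "satisfies_COV h (pf3 \<kappa> h c F a b)"
    if set: "rainbow_setting \<beta> \<alpha> F G \<or> neighbor_setting \<beta> \<alpha> F G" for F G c
  proof -
    obtain \<sigma> a' b' where or: "oriented \<sigma> a' b'" "\<sigma> = 1 \<or> \<sigma> = - 1"
      and eq: "pf3 \<kappa> h c F a b = pf3 \<kappa> h c F a' b'"
      and eqs: "\<sigma> = 1 \<and> rainbow_eqs \<beta> F G \<or> \<sigma> = - 1 \<and> neighbor_eqs \<beta> F G"
      and F: "smooth_on (box 0 1) F" "hypergeo_eqs \<beta> F G"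
      using setting_orientation[OF assms(6) set] by metis
    show "smooth_on chamber (pf3 \<kappa> h c F a b)" "satisfies_PDE \<kappa> h (pf3 \<kappa> h c F a b)"
      "satisfies_COV h (pf3 \<kappa> h c F a b)"
      unfolding eq using smooth_on_pf3[OF or F(1)] satisfies_COV_pf3[OF or(1)]
        satisfies_PDE_pf3[OF or assms(1,3,4) F eqs] by simp_all
  qed
  have iii: "satisfies_ASY \<kappa> h \<alpha> (pf3 \<kappa> h (inverse cF * inverse (hyp2F1 (1 - \<beta>) \<beta> (2 * \<beta>) 1)) F a b)"
    if set: "rainbow_setting \<beta> \<alpha> F G \<or> neighbor_setting \<beta> \<alpha> F G"
      and "extends_continuously_by F E" "cF > 0"
        "\<forall>r\<in>{0<..<1}.
           E (vector [r, 1, 1]) = cF * hyp2F1 (1 - \<beta>) \<beta> (2 * \<beta>) r \<and>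
           E (vector [1, r, 1]) = cF * hyp2F1 (1 - \<beta>) \<beta> (2 * \<beta>) r \<and>
           E (vector [1, 1, r]) = cF * hyp2F1 (1 - \<beta>) \<beta> (2 * \<beta>) r" for F G E cF
  proof -
    obtain \<sigma> a' b' where or: "oriented \<sigma> a' b'" "\<sigma> = 1 \<or> \<sigma> = - 1" and lab: "labelling 3 \<alpha> a' b'"
      and eq: "\<And>c. pf3 \<kappa> h c F a b = pf3 \<kappa> h c F a' b'"
      using setting_orientation[OF assms(6) set] by metis
    show ?thesis
      unfolding eq by (rule satisfies_ASY_pf3[OF or lab assms(1-4) that(2-4)])
  qed
  have iv: "pf3 \<kappa> h c F a b x > 0"
    if set: "rainbow_setting \<beta> \<alpha> F G \<or> neighbor_setting \<beta> \<alpha> F G"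
      and E: "extends_continuously_by F E" "\<forall>r\<in>frontier (cbox 0 1). E r > 0" and c: "c > 0" and x: "x \<in> chamber"
    for F G E c x
  proof -
    obtain \<sigma> a' b' where or: "oriented \<sigma> a' b'" "\<sigma> = 1 \<or> \<sigma> = - 1"
      and eq: "pf3 \<kappa> h c F a b = pf3 \<kappa> h c F a' b'"
      and eqs: "\<sigma> = 1 \<and> rainbow_eqs \<beta> F G \<or> \<sigma> = - 1 \<and> neighbor_eqs \<beta> F G"
      and F: "smooth_on (box 0 1) F" "hypergeo_eqs \<beta> F G"
      using setting_orientation[OF assms(6) set] by metis
    have "\<beta> > 1 / 2"
      unfolding assms(3) using assms(1,2) by (simp add: pos_less_divide_eq)
    then show ?thesis
      unfolding eq by (intro pf3_positive[OF or x c] F_positive[OF _ F eqs E])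
  qed
  show ?thesis
    unfolding Let_def
    by (intro conjI allI impI ballI; rule i iii iv; (assumption | rule disjI1, assumption | rule disjI2, assumption))
qed

end
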